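(* Let $G$ be a compact Lie group, $1\leq p_1,p_2<\infty$ and $0<r\leq 1$. Put $\widetilde{p_1}=\min\{2,p_1\}$ and $\widetilde{p_2}=\max\{2,p_2\}$. Let $A:L^{p_1}(G)\to L^{p_2}(G)$ be a linear continuous operator whose matrix-valued symbol $\sigma_A(\xi)$ depends only on $\xi$ (and not on $x\in G$) and is a diagonal matrix for every $[\xi]\in\widehat G$. Assume that $$\sum_{[\xi]\in\widehat G}d_{\xi}^{\,1+\left(\frac{1}{\widetilde{p_1}}-\frac{1}{\widetilde{p_2}}\right)r}\,\|\sigma_A(\xi)\|_{S_r}^r<\infty.$$ Then $A:L^{p_1}(G)\to L^{p_2}(G)$ is $r$-nuclear.
   Context: $G$ carries its normalised Haar measure. $\widehat G$ is the set of equivalence classes of continuous irreducible unitary representations of $G$; for each $[\xi]\in\widehat G$ one fixes a representative viewed, via an orthonormal basis of its representation space, as a unitary-matrix-valued function $\xi:G\to\mathbb C^{d_\xi\times d_\xi}$, where $d_\xi$ is its dimension. The matrix-valued symbol of a linear continuous operator $A$ from $C^\infty(G)$ to $\mathcal D'(G)$ (in particular of a bounded operator $L^{p_1}(G)\to L^{p_2}(G)$) is $\sigma_A(x,\xi):=\xi(x)^*(A\xi)(x)\in\mathbb C^{d_\xi\times d_\xi}$, where $(A\xi)_{ij}=A(\xi_{ij})$; then $Af(x)=\sum_{[\xi]\in\widehat G}d_\xi\operatorname{Tr}(\xi(x)\sigma_A(x,\xi)\widehat f(\xi))$ (in the sense of distributions, for $f\in C^\infty(G)$) with $\widehat f(\xi)=\int_G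 f(x)\xi(x)^*dx$. For a matrix $M$, $|M|=(M^*M)^{1/2}$ and $\|M\|_{S_r}=(\operatorname{Tr}(|M|^r))^{1/r}$. For $0<r\le1$ and Banach spaces $E,F$, a linear operator $T:E\to F$ is $r$-nuclear if there are sequences $(x_n')$ in $E'$ and $(y_n)$ in $F$ with $Tx=\sum_{n=1}^\infty\langle x,x_n'\rangle y_n$ for all $x\in E$ and $\sum_{n=1}^\infty\|x_n'\|_{E'}^r\|y_n\|_F^r<\infty$. *)

theory Defs
  imports
    "HOL-Analysis.Analysis"
    "Jordan_Normal_Form.Schur_Decomposition"
    "Jordan_Normal_Form.VS_Connect"
begin

section \<open>Lie groups\<close>

text \<open>
  \<open>\<real>\<^sup>n\<close> is \<^term>\<open>Euclidean_space n\<close>, the sequences vanishing from index \<open>n\<close> on, so that the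
  dimension is a number and \<open>n = 0\<close> (finite groups) is allowed. A real function is \<open>C\<^sup>k\<close> on an
  open \<open>S \<subseteq> \<real>\<^sup>n\<close> iff its partial derivatives of order at most \<open>k\<close> exist and are continuous.
\<close>

primrec Ck_on :: "nat \<Rightarrow> (nat \<Rightarrow> real) set \<Rightarrow> nat \<Rightarrow> ((nat \<Rightarrow> real) \<Rightarrow> real) \<Rightarrow> bool" where
  "Ck_on n S 0 f \<longleftrightarrow> continuous_map (subtopology (Euclidean_space n) S) euclideanreal f"
| "Ck_on n S (Suc k) f \<longleftrightarrow>
     continuous_map (subtopology (Euclidean_space n) S) euclideanreal f \<and>
     (\<forall>i<n. (\<forall>x\<in>S. (\<lambda>t. f (x(i := t))) field_differentiable at (x i)) \<and>
            Ck_on n S k (\<lambda>x. deriv (\<lambda>t. f (x(i := t))) (x i)))"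

definition smooth_map_on ::
    "nat \<Rightarrow> nat \<Rightarrow> (nat \<Rightarrow> real) set \<Rightarrow> ((nat \<Rightarrow> real) \<Rightarrow> nat \<Rightarrow> real) \<Rightarrow> bool" where
  "smooth_map_on m n S F \<longleftrightarrow> (\<forall>i<n. \<forall>k. Ck_on m S k (\<lambda>x. F x i))"

type_synonym 'g chart = "'g set \<times> ('g \<Rightarrow> nat \<Rightarrow> real)"

definition is_chart :: "nat \<Rightarrow> 'g::topological_space chart \<Rightarrow> bool" where
  "is_chart n = (\<lambda>(U, \<phi>). open U \<and> openin (Euclidean_space n) (\<phi> ` U) \<and>
     homeomorphic_map (subtopology euclidean U) (subtopology (Euclidean_space n) (\<phi> ` U)) \<phi>)"

definition smooth_atlas :: "nat \<Rightarrow> 'g::topological_space chart set \<Rightarrow> bool" where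
  "smooth_atlas n \<A> \<longleftrightarrow>
     (\<forall>c\<in>\<A>. is_chart n c) \<and> (\<Union>(U, \<phi>)\<in>\<A>. U) = UNIV \<and>
     (\<forall>(U, \<phi>)\<in>\<A>. \<forall>(V, \<psi>)\<in>\<A>.
        smooth_map_on n n (\<phi> ` (U \<inter> V)) (\<lambda>x. \<psi> (the_inv_into U \<phi> x)))"

text \<open>The two projections \<open>\<real>\<^sup>n\<^sup>+\<^sup>n \<rightarrow> \<real>\<^sup>n\<close>.\<close>

definition fst_coords :: "nat \<Rightarrow> (nat \<Rightarrow> real) \<Rightarrow> nat \<Rightarrow> real" where
  "fst_coords n z = (\<lambda>i. if i < n then z i else 0)"

definition snd_coords :: "nat \<Rightarrow> (nat \<Rightarrow> real) \<Rightarrow> nat \<Rightarrow> real" where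
  "snd_coords n z = (\<lambda>i. z (n + i))"

text \<open>
  The group is a type of class \<^class>\<open>topological_group_add\<close>. It is written additively, as in that
  class, but is not assumed to be commutative.
\<close>

definition lie_group ::
    "nat \<Rightarrow> 'g::{topological_group_add, t2_space, second_countable_topology} chart set \<Rightarrow> bool" where
  "lie_group n \<A> \<longleftrightarrow> smooth_atlas n \<A> \<and>
     (\<forall>(U, \<phi>)\<in>\<A>. \<forall>(V, \<psi>)\<in>\<A>. \<forall>(W, \<theta>)\<in>\<A>.
        let m = (\<lambda>z. the_inv_into U \<phi> (fst_coords n z) + the_inv_into V \<psi> (snd_coords n z)) in
        smooth_map_on (n + n) n
          {z \<in> topspace (Euclidean_space (n + n)).
             fst_coords n z \<in> \<phi> ` U \<and> snd_coords n z \<in> \<psi> ` V \<and> m z \<in> W}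
          (\<lambda>z. \<theta> (m z))) \<and>
     (\<forall>(U, \<phi>)\<in>\<A>. \<forall>(W, \<theta>)\<in>\<A>.
        smooth_map_on n n (\<phi> ` {g \<in> U. - g \<in> W}) (\<lambda>x. \<theta> (- the_inv_into U \<phi> x)))"

text \<open>
  Normalised Haar measure. On a second countable compact Hausdorff group every Borel probability
  measure is regular, so regularity need not be required.
\<close>

definition normalised_haar :: "'g::topological_group_add measure \<Rightarrow> bool" where
  "normalised_haar \<mu> \<longleftrightarrow> sets \<mu> = sets borel \<and> emeasure \<mu> UNIV = 1 \<and>
     (\<forall>g. \<forall>B\<in>sets \<mu>. emeasure \<mu> ((\<lambda>x. g + x) ` B) = emeasure \<mu> B)"

section \<open>Matrices\<close>

definition unitary_mat :: "nat \<Rightarrow> complex mat \<Rightarrow> bool" where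
  "unitary_mat d U \<longleftrightarrow> U \<in> carrier_mat d d \<and>
     mat_adjoint U * U = 1\<^sub>m d \<and> U * mat_adjoint U = 1\<^sub>m d"

definition mat_trace :: "complex mat \<Rightarrow> complex" where
  "mat_trace M = (\<Sum>i<dim_row M. M $$ (i, i))"

text \<open>
  Real powers of a positive semidefinite matrix, by functional calculus: if
  \<open>P = U diag(e\<^sub>0, \<dots>) U\<^sup>*\<close> with \<open>U\<close> unitary and \<open>e\<^sub>i \<ge> 0\<close>, then \<open>P\<^sup>s = U diag(e\<^sub>0\<^sup>s, \<dots>) U\<^sup>*\<close>,
  which does not depend on the diagonalisation. Used with \<open>s > 0\<close> only, where \<open>0\<^sup>s = 0\<close>.
\<close>

definition psd_powr :: "complex mat \<Rightarrow> real \<Rightarrow> complex mat" where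
  "psd_powr P s = (THE Q. \<exists>U e. unitary_mat (dim_row P) U \<and> (\<forall>i<dim_row P. 0 \<le> e i) \<and>
     P = U * mat_diag (dim_row P) (\<lambda>i. complex_of_real (e i)) * mat_adjoint U \<and>
     Q = U * mat_diag (dim_row P) (\<lambda>i. complex_of_real (e i powr s)) * mat_adjoint U)"

definition mat_abs :: "complex mat \<Rightarrow> complex mat" where
  "mat_abs M = psd_powr (mat_adjoint M * M) (1/2)"

definition schatten_norm :: "real \<Rightarrow> complex mat \<Rightarrow> real" where
  "schatten_norm r M = Re (mat_trace (psd_powr (mat_abs M) r)) powr (1/r)"

section \<open>The unitary dual\<close>

definition unitary_rep :: "nat \<Rightarrow> ('g::topological_group_add \<Rightarrow> complex mat) \<Rightarrow> bool" where
  "unitary_rep d \<xi> \<longleftrightarrow> (\<forall>x. unitary_mat d (\<xi> x)) \<and> (\<forall>x y. \<xi> (x + y) = \<xi> x * \<xi> y) \<and>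
     (\<forall>i<d. \<forall>j<d. continuous_on UNIV (\<lambda>x. \<xi> x $$ (i, j)))"

definition irreducible_unitary_rep :: "nat \<Rightarrow> ('g::topological_group_add \<Rightarrow> complex mat) \<Rightarrow> bool" where
  "irreducible_unitary_rep d \<xi> \<longleftrightarrow> 0 < d \<and> unitary_rep d \<xi> \<and>
     (\<forall>W. VectorSpace.subspace class_ring W (module_vec TYPE(complex) d) \<and>
          (\<forall>x. \<forall>w\<in>W. \<xi> x *\<^sub>v w \<in> W) \<longrightarrow> W = {0\<^sub>v d} \<or> W = carrier_vec d)"

definition rep_dim :: "('g::topological_group_add \<Rightarrow> complex mat) \<Rightarrow> nat" where
  "rep_dim \<xi> = dim_row (\<xi> 0)"

definition equivalent_reps ::
    "('g::topological_group_add \<Rightarrow> complex mat) \<Rightarrow> ('g \<Rightarrow> complex mat) \<Rightarrow> bool" where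
  "equivalent_reps \<xi> \<eta> \<longleftrightarrow> (\<exists>T \<in> carrier_mat (rep_dim \<eta>) (rep_dim \<xi>).
     invertible_mat T \<and> (\<forall>x. T * \<xi> x = \<eta> x * T))"

text \<open>
  A choice of one matrix representative for each class in the unitary dual. Irreducible unitary
  representations of a compact group are finite-dimensional, so matrix representations suffice.
\<close>

definition unitary_dual_representatives ::
    "('g::topological_group_add \<Rightarrow> complex mat) set \<Rightarrow> bool" where
  "unitary_dual_representatives R \<longleftrightarrow>
     (\<forall>\<xi>\<in>R. irreducible_unitary_rep (rep_dim \<xi>) \<xi>) \<and>
     (\<forall>d \<eta>. irreducible_unitary_rep d \<eta> \<longrightarrow> (\<exists>!\<xi>. \<xi> \<in> R \<and> equivalent_reps \<eta> \<xi>))"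

section \<open>Lebesgue spaces, operators and nuclearity\<close>

text \<open>
  A Banach space of (classes of) functions is given by a vector space \<open>E\<close> of functions with a
  seminorm \<open>N\<close>; the Banach space is the quotient by \<open>{f \<in> E. N f = 0}\<close>. Operators act on
  functions, and identities between values hold modulo functions of seminorm zero, i.e. almost
  everywhere in the case of \<open>L\<^sup>p\<close>. Boundedness makes every operator and functional well defined
  on the quotient.
\<close>

definition Lp_space :: "'g measure \<Rightarrow> real \<Rightarrow> ('g \<Rightarrow> complex) set" where
  "Lp_space \<mu> p = {f \<in> borel_measurable \<mu>. integrable \<mu> (\<lambda>x. cmod (f x) powr p)}"

definition Lp_norm :: "'g measure \<Rightarrow> real \<Rightarrow> ('g \<Rightarrow> complex) \<Rightarrow> real" where
  "Lp_norm \<mu> p f = (LINT x|\<mu>. cmod (f x) powr p) powr (1/p)"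

definition bounded_operator ::
    "('a \<Rightarrow> complex) set \<Rightarrow> (('a \<Rightarrow> complex) \<Rightarrow> real) \<Rightarrow>
     ('b \<Rightarrow> complex) set \<Rightarrow> (('b \<Rightarrow> complex) \<Rightarrow> real) \<Rightarrow>
     (('a \<Rightarrow> complex) \<Rightarrow> ('b \<Rightarrow> complex)) \<Rightarrow> bool" where
  "bounded_operator E NE F NF T \<longleftrightarrow>
     (\<forall>f\<in>E. T f \<in> F) \<and>
     (\<forall>f\<in>E. \<forall>g\<in>E. NF (\<lambda>x. T (\<lambda>y. f y + g y) x - (T f x + T g x)) = 0) \<and>
     (\<forall>c. \<forall>f\<in>E. NF (\<lambda>x. T (\<lambda>y. c * f y) x - c * T f x) = 0) \<and>
     (\<exists>C. \<forall>f\<in>E. NF (T f) \<le> C * NE f)"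

definition dual_space ::
    "('a \<Rightarrow> complex) set \<Rightarrow> (('a \<Rightarrow> complex) \<Rightarrow> real) \<Rightarrow> (('a \<Rightarrow> complex) \<Rightarrow> complex) set" where
  "dual_space E NE = {\<phi>.
     (\<forall>f\<in>E. \<forall>g\<in>E. \<phi> (\<lambda>y. f y + g y) = \<phi> f + \<phi> g) \<and>
     (\<forall>c. \<forall>f\<in>E. \<phi> (\<lambda>y. c * f y) = c * \<phi> f) \<and>
     (\<exists>C. \<forall>f\<in>E. cmod (\<phi> f) \<le> C * NE f)}"

definition dual_norm ::
    "('a \<Rightarrow> complex) set \<Rightarrow> (('a \<Rightarrow> complex) \<Rightarrow> real) \<Rightarrow> (('a \<Rightarrow> complex) \<Rightarrow> complex) \<Rightarrow> real" where
  "dual_norm E NE \<phi> = (SUP f\<in>{f \<in> E. NE f \<le> 1}. cmod (\<phi> f))"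

definition r_nuclear ::
    "real \<Rightarrow> ('a \<Rightarrow> complex) set \<Rightarrow> (('a \<Rightarrow> complex) \<Rightarrow> real) \<Rightarrow>
     ('b \<Rightarrow> complex) set \<Rightarrow> (('b \<Rightarrow> complex) \<Rightarrow> real) \<Rightarrow>
     (('a \<Rightarrow> complex) \<Rightarrow> ('b \<Rightarrow> complex)) \<Rightarrow> bool" where
  "r_nuclear r E NE F NF T \<longleftrightarrow>
     (\<exists>\<phi> y. (\<forall>n::nat. \<phi> n \<in> dual_space E NE \<and> y n \<in> F) \<and>
       (\<forall>f\<in>E. (\<lambda>k. NF (\<lambda>x. T f x - (\<Sum>n<k. \<phi> n f * y n x))) \<longlonglongrightarrow> 0) \<and>
       summable (\<lambda>n. dual_norm E NE (\<phi> n) powr r * NF (y n) powr r))"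

section \<open>Symbols\<close>

text \<open>
  \<open>\<sigma>\<^sub>A(x, \<xi>) = \<xi>(x)\<^sup>* (A\<xi>)(x)\<close>; for an operator between \<open>L\<^sup>p\<close> spaces it is determined for almost
  every \<open>x\<close>.
\<close>

definition op_symbol ::
    "(('g \<Rightarrow> complex) \<Rightarrow> ('g \<Rightarrow> complex)) \<Rightarrow> 'g \<Rightarrow>
     ('g::topological_group_add \<Rightarrow> complex mat) \<Rightarrow> complex mat" where
  "op_symbol A x \<xi> = mat_adjoint (\<xi> x) *
     mat (rep_dim \<xi>) (rep_dim \<xi>) (\<lambda>(i, j). A (\<lambda>y. \<xi> y $$ (i, j)) x)"

end

theory Submission
  imports Defs "HOL-Complex_Analysis.Great_Picard" "Jordan_Normal_Form.Spectral_Radius"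
begin

text \<open>
  For a diagonal symbol the Fourier expansion of \<open>A f\<close> reads
  \<open>A f = \<Sum> d\<^sub>\<xi> \<sigma>(\<xi>)\<^sub>j\<^sub>j \<langle>f, \<xi>\<^sub>i\<^sub>j\<rangle> \<xi>\<^sub>i\<^sub>j\<close>, which is a candidate for a nuclear decomposition.
  Since \<open>|\<xi>\<^sub>i\<^sub>j| \<le> 1\<close> and \<open>\<parallel>\<xi>\<^sub>i\<^sub>j\<parallel>\<^sub>2\<^sup>2 = 1/d\<^sub>\<xi>\<close>, the coefficient \<open>\<xi>\<^sub>i\<^sub>j\<close> has norm at most
  \<open>d\<^sub>\<xi>\<close> to the power \<open>- 1 / max 2 q\<close> in \<open>L\<^sup>q\<close>; with Hoelder's inequality for the functional
  \<open>\<langle>\<sqdot>, \<xi>\<^sub>i\<^sub>j\<rangle>\<close>, the \<open>r\<close>-th powers of the norms sum to the series of the hypothesis.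
  The expansion is exact on matrix coefficients by Schur orthogonality, and it extends to \<open>L\<^sup>p\<close>
  because matrix coefficients are dense (Peter--Weyl).

  For Peter--Weyl, let \<open>T\<close> be convolution with a continuous hermitian kernel. If \<open>T\<close> did not vanish
  on the continuous functions orthogonal to all coefficients, compactness would give an eigenfunction
  of \<open>T\<^sup>2\<close> there; a minimal translation invariant subspace of its finite-dimensional eigenspace
  carries an irreducible representation, so it consists of coefficients, which is absurd.
  Projecting \<open>f\<close> onto the coefficients therefore approximates \<open>T f\<close> uniformly, and \<open>T f\<close> is close
  to \<open>f\<close> for a kernel concentrated near the neutral element.
\<close>

text \<open>Three features shape the argument. Convergence in L^p is reached by density: because
  \<open>r \<le> 1\<close>, summability of the r-th powers forces summability of the norms
  themselves, so the partial sums are operators bounded uniformly in their length, and convergence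
  on a dense set is enough. The spectral part works with continuous functions only, an inner product
  space that is in general not complete; the limits that completeness would provide come from the
  compactness of convolution, which sends L^2-bounded sequences to sequences with uniformly
  convergent subsequences, and orthogonal projection onto the coefficients is replaced by nearly
  minimising sequences. Diagonality enters twice: up to null sets it makes each coefficient \<xi>_ij
  an eigenfunction of \<open>A\<close> with eigenvalue \<sigma>_jj, so that each triple (\<xi>, i,
  j) yields one rank-one term, and it turns the Schatten norm into the l^r norm of the diagonal
  entries.\<close>

section \<open>Lebesgue spaces\<close>

text \<open>Convexity of the power settles two positive points. If one point is zero, what remains
  is \<open>(c * w) powr p \<le> c * w powr p\<close>, which is \<open>c powr p \<le> c\<close> on
  the unit interval.\<close>

lemma powr_convex_combination:
  fixes u v s t p :: real
  assumes p: "1 \<le> p" and "0 \<le> u" "0 \<le> v" "0 \<le> s" "0 \<le> t" "s + t = 1"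
  shows "(s * u + t * v) powr p \<le> s * u powr p + t * v powr p"
proof -
  have contract: "(c * w) powr p \<le> c * w powr p" if "0 \<le> c" "c \<le> 1" "0 \<le> w" for c w :: real
  proof -
    have "c powr p \<le> c powr 1" if "c \<noteq> 0"
      using p \<open>0 \<le> c\<close> \<open>c \<le> 1\<close> that by (intro powr_mono') auto
    then have "c powr p \<le> c" using \<open>0 \<le> c\<close> by (cases "c = 0") auto
    then show ?thesis using that by (simp add: powr_mult mult_right_mono)
  qed
  consider "u = 0" | "v = 0" | "0 < u" "0 < v" using assms by fastforce
  then show ?thesis
  proof cases
    case 1
    then show ?thesis using contract[of t v] assms by simp
  next
    case 2
    then show ?thesis using contract[of s u] assms by simp
  next
    case 3
    have s: "s = 1 - t" using assms by simp
    then show ?thesis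
      using convex_onD[OF powr_convex[OF p], of t u v] 3 assms by (simp add: s)
  qed
qed

lemma Lp_norm_nonneg: "0 \<le> Lp_norm \<mu> p f"
  by (simp add: Lp_norm_def)

lemma Lp_space_measurable: "f \<in> Lp_space \<mu> p \<Longrightarrow> f \<in> borel_measurable \<mu>"
  and Lp_space_integrable: "f \<in> Lp_space \<mu> p \<Longrightarrow> integrable \<mu> (\<lambda>x. cmod (f x) powr p)"
  by (auto simp: Lp_space_def)

lemma Lp_norm_powr:
  assumes "0 < p"
  shows "Lp_norm \<mu> p f powr p = (LINT x|\<mu>. cmod (f x) powr p)"
  using assms by (simp add: Lp_norm_def powr_powr)

lemma Lp_norm_le_iff:
  assumes "0 < p" "0 \<le> a"
  shows "Lp_norm \<mu> p f \<le> a \<longleftrightarrow> (LINT x|\<mu>. cmod (f x) powr p) \<le> a powr p"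
proof
  assume "Lp_norm \<mu> p f \<le> a"
  then have "Lp_norm \<mu> p f powr p \<le> a powr p"
    using assms by (intro powr_mono2) (auto simp: Lp_norm_nonneg)
  then show "(LINT x|\<mu>. cmod (f x) powr p) \<le> a powr p" using assms by (simp add: Lp_norm_powr)
next
  assume *: "(LINT x|\<mu>. cmod (f x) powr p) \<le> a powr p"
  show "Lp_norm \<mu> p f \<le> a"
  proof (rule ccontr)
    assume "\<not> Lp_norm \<mu> p f \<le> a"
    then have "a powr p < Lp_norm \<mu> p f powr p" using assms by (intro powr_less_mono2) auto
    then show False using * assms by (simp add: Lp_norm_powr)
  qed
qed

lemma Lp_space_dominated:
  assumes "f \<in> borel_measurable \<mu>" "integrable \<mu> h" "\<And>x. cmod (f x) powr p \<le> h x"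
  shows "f \<in> Lp_space \<mu> p"
proof -
  have "integrable \<mu> (\<lambda>x. cmod (f x) powr p)"
    by (rule Bochner_Integration.integrable_bound[OF assms(2)])
      (use assms in \<open>auto intro: order_trans[OF assms(3) abs_ge_self]\<close>)
  then show ?thesis using assms by (simp add: Lp_space_def)
qed

lemma Lp_space_scale:
  assumes "f \<in> Lp_space \<mu> p"
  shows "(\<lambda>x. c * f x) \<in> Lp_space \<mu> p"
  using assms by (auto simp: Lp_space_def norm_mult powr_mult)

lemma Lp_norm_scale:
  assumes "0 < p"
  shows "Lp_norm \<mu> p (\<lambda>x. c * f x) = cmod c * Lp_norm \<mu> p f"
  using assms by (simp add: Lp_norm_def norm_mult powr_mult powr_powr integral_nonneg)

lemma Lp_space_add:
  assumes "f \<in> Lp_space \<mu> p" "g \<in> Lp_space \<mu> p" "0 < p"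
  shows "(\<lambda>x. f x + g x) \<in> Lp_space \<mu> p"
proof (rule Lp_space_dominated)
  show "(\<lambda>x. f x + g x) \<in> borel_measurable \<mu>"
    using assms by (intro borel_measurable_add) (auto dest: Lp_space_measurable)
  show "integrable \<mu> (\<lambda>x. 2 powr p * (cmod (f x) powr p + cmod (g x) powr p))"
    using assms by (auto dest: Lp_space_integrable)
  fix x
  have "cmod (f x + g x) \<le> 2 * max (cmod (f x)) (cmod (g x))"
    using norm_triangle_ineq[of "f x" "g x"] by linarith
  then have "cmod (f x + g x) powr p \<le> (2 * max (cmod (f x)) (cmod (g x))) powr p"
    using assms by (intro powr_mono2) auto
  also have "\<dots> \<le> 2 powr p * (cmod (f x) powr p + cmod (g x) powr p)"
    by (auto simp: powr_mult max_def)
  finally show "cmod (f x + g x) powr p \<le> 2 powr p * (cmod (f x) powr p + cmod (g x) powr p)" .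
qed

lemma Lp_space_zero: "(\<lambda>x. 0) \<in> Lp_space \<mu> p"
  by (simp add: Lp_space_def)

lemma Lp_norm_zero: "Lp_norm \<mu> p (\<lambda>x. 0) = 0"
  by (simp add: Lp_norm_def)

lemma Lp_space_diff:
  assumes "f \<in> Lp_space \<mu> p" "g \<in> Lp_space \<mu> p" "0 < p"
  shows "(\<lambda>x. f x - g x) \<in> Lp_space \<mu> p"
  using Lp_space_add[OF assms(1) Lp_space_scale[OF assms(2), of "-1"] assms(3)] by simp

lemma Lp_space_sum:
  assumes "\<And>i. i \<in> I \<Longrightarrow> f i \<in> Lp_space \<mu> p" "0 < p"
  shows "(\<lambda>x. \<Sum>i\<in>I. f i x) \<in> Lp_space \<mu> p"
  using assms
proof (induction I rule: infinite_finite_induct)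
  case (insert a I)
  then show ?case using Lp_space_add[of "f a" \<mu> p "\<lambda>x. \<Sum>i\<in>I. f i x"] by simp
qed (auto intro: Lp_space_zero)

text \<open>Minkowski's inequality by convexity: f + g, divided by a + b, is the mean of f / a and g
  / b with weights a / (a + b) and b / (a + b). Positive upper bounds \<open>a\<close>,
  \<open>b\<close> stand in for the norms, so that nothing is divided by a vanishing norm; letting
  them decrease to the norms gives the claim.\<close>

lemma Lp_norm_triangle:
  assumes f: "f \<in> Lp_space \<mu> p" and g: "g \<in> Lp_space \<mu> p" and p: "1 \<le> p"
  shows "Lp_norm \<mu> p (\<lambda>x. f x + g x) \<le> Lp_norm \<mu> p f + Lp_norm \<mu> p g"
proof -
  have strict: "Lp_norm \<mu> p (\<lambda>x. f x + g x) \<le> a + b"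
    if a: "0 < a" "Lp_norm \<mu> p f \<le> a" and b: "0 < b" "Lp_norm \<mu> p g \<le> b" for a b
  proof -
    have F: "(LINT x|\<mu>. cmod (f x) powr p) \<le> a powr p"
      and G: "(LINT x|\<mu>. cmod (g x) powr p) \<le> b powr p"
      using a b p Lp_norm_le_iff[of p a \<mu> f] Lp_norm_le_iff[of p b \<mu> g] by auto
    let ?k = "\<lambda>x. (a + b) powr p * (a / (a + b) * (cmod (f x) powr p / a powr p)
        + b / (a + b) * (cmod (g x) powr p / b powr p))"
    have pt: "cmod (f x + g x) powr p \<le> ?k x" for x
    proof -
      have "cmod (f x + g x) powr p \<le> (cmod (f x) + cmod (g x)) powr p"
        using p by (intro powr_mono2 norm_triangle_ineq) auto
      also have "cmod (f x) + cmod (g x) =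
          (a + b) * (a / (a + b) * (cmod (f x) / a) + b / (a + b) * (cmod (g x) / b))"
        using a b by (simp add: add_divide_distrib[symmetric])
      also have "\<dots> powr p = (a + b) powr p *
          (a / (a + b) * (cmod (f x) / a) + b / (a + b) * (cmod (g x) / b)) powr p"
        using a b by (subst powr_mult) auto
      also have "\<dots> \<le> (a + b) powr p * (a / (a + b) * (cmod (f x) / a) powr p
          + b / (a + b) * (cmod (g x) / b) powr p)"
        using a b p
        by (intro mult_left_mono powr_convex_combination) (auto simp: add_divide_distrib[symmetric])
      finally show ?thesis using a b by (simp add: powr_divide)
    qed
    have int: "integrable \<mu> ?k"
      using f g
      by (intro integrable_mult_right Bochner_Integration.integrable_add integrable_divide_zero)
        (auto dest: Lp_space_integrable)
    have "(LINT x|\<mu>. cmod (f x + g x) powr p) \<le> (LINT x|\<mu>. ?k x)"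
      using Lp_space_integrable[OF Lp_space_add[OF f g]] p pt by (intro integral_mono int) auto
    also have "\<dots> = (a + b) powr p * (a / (a + b) * ((LINT x|\<mu>. cmod (f x) powr p) / a powr p)
        + b / (a + b) * ((LINT x|\<mu>. cmod (g x) powr p) / b powr p))"
      using f g by (simp add: Lp_space_integrable)
    also have "\<dots> \<le> (a + b) powr p * (a / (a + b) * 1 + b / (a + b) * 1)"
      using a b F G by (intro mult_left_mono add_mono) auto
    also have "\<dots> = (a + b) powr p"
      using a b by (simp add: add_divide_distrib[symmetric])
    finally show ?thesis
      using p a b by (subst Lp_norm_le_iff) auto
  qed
  show ?thesis
  proof (rule field_le_epsilon)
    fix e :: real assume "0 < e"
    then show "Lp_norm \<mu> p (\<lambda>x. f x + g x) \<le> Lp_norm \<mu> p f + Lp_norm \<mu> p g + e"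
      using strict[of "Lp_norm \<mu> p f + e/2" "Lp_norm \<mu> p g + e/2"]
        Lp_norm_nonneg[of \<mu> p f] Lp_norm_nonneg[of \<mu> p g] by simp
  qed
qed

lemma Lp_norm_triangle_diff:
  assumes f: "f \<in> Lp_space \<mu> p" and g: "g \<in> Lp_space \<mu> p" and p: "1 \<le> p"
  shows "Lp_norm \<mu> p (\<lambda>x. f x - g x) \<le> Lp_norm \<mu> p f + Lp_norm \<mu> p g"
  using Lp_norm_triangle[OF f Lp_space_scale[OF g, of "-1"] p] Lp_norm_scale[of p \<mu> "-1" g] p by simp

lemma Lp_norm_sum:
  assumes "\<And>i. i \<in> I \<Longrightarrow> f i \<in> Lp_space \<mu> p" "1 \<le> p"
  shows "Lp_norm \<mu> p (\<lambda>x. \<Sum>i\<in>I. f i x) \<le> (\<Sum>i\<in>I. Lp_norm \<mu> p (f i))"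
  using assms
proof (induction I rule: infinite_finite_induct)
  case (insert a I)
  then have "Lp_norm \<mu> p (\<lambda>x. f a x + (\<Sum>i\<in>I. f i x)) \<le>
      Lp_norm \<mu> p (f a) + Lp_norm \<mu> p (\<lambda>x. \<Sum>i\<in>I. f i x)"
    by (intro Lp_norm_triangle Lp_space_sum) auto
  then show ?case using insert by simp
qed (auto simp: Lp_norm_zero)

lemma Lp_norm_cong_AE:
  assumes "AE x in \<mu>. f x = g x" "f \<in> borel_measurable \<mu>" "g \<in> borel_measurable \<mu>"
  shows "Lp_norm \<mu> p f = Lp_norm \<mu> p g"
proof -
  have "(LINT x|\<mu>. cmod (f x) powr p) = (LINT x|\<mu>. cmod (g x) powr p)"
    using assms by (intro integral_cong_AE) auto
  then show ?thesis by (simp add: Lp_norm_def)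
qed

text \<open>For \<open>p = 1\<close> the conjugate exponent is infinite, which is why the bound \<open>1\<close> and
  the exponent \<open>1 - 1 / p\<close> are used in place of a norm of the second factor.\<close>

lemma Holder_bounded:
  assumes f: "f \<in> Lp_space \<mu> p" and p: "1 \<le> p" "p \<le> 2"
    and g: "g \<in> Lp_space \<mu> 2" and g1: "\<And>x. cmod (g x) \<le> 1"
  shows "integrable \<mu> (\<lambda>x. f x * g x)"
    and "cmod (LINT x|\<mu>. f x * g x) \<le>
      Lp_norm \<mu> p f * (LINT x|\<mu>. (cmod (g x))\<^sup>2) powr (1 - 1 / p)" (is "?lhs \<le> ?rhs")
proof -
  have mf: "f \<in> borel_measurable \<mu>" and mg: "g \<in> borel_measurable \<mu>"
    using f g by (auto dest: Lp_space_measurable)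
  have If: "integrable \<mu> (\<lambda>x. cmod (f x) powr p)" using f by (rule Lp_space_integrable)
  have Ig: "integrable \<mu> (\<lambda>x. (cmod (g x))\<^sup>2)"
    using Lp_space_integrable[OF g] by (simp add: powr_numeral)
  define B where "B = (LINT x|\<mu>. (cmod (g x))\<^sup>2)"
  have B0: "0 \<le> B" by (simp add: B_def)
  \<comment> \<open>Young's inequality with weights 1/p and 1 - 1/p for the normalised |f|^p and
    |g|^2. The second factor may appear as a power of |g|^2 because |g| \<le> 1 and 2 (1 - 1/p)
    \<le> 1 for p \<le> 2.\<close>
  have young: "cmod (f x * g x) \<le> a * b powr (1 - 1 / p) *
      (1 / p * (cmod (f x) powr p / a powr p) + (1 - 1 / p) * ((cmod (g x))\<^sup>2 / b))"
    if "0 < a" "0 < b" for a b x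
  proof (cases "f x = 0 \<or> g x = 0")
    case True
    then show ?thesis using that p by auto
  next
    case False
    let ?u = "cmod (f x) powr p / a powr p" and ?v = "(cmod (g x))\<^sup>2 / b"
    have "cmod (g x) \<le> (cmod (g x))\<^sup>2 powr (1 - 1 / p)"
    proof -
      have "cmod (g x) powr 1 \<le> cmod (g x) powr (2 * (1 - 1 / p))"
        using p g1[of x] False by (intro powr_mono') (auto simp: field_simps)
      then show ?thesis
        using False by (simp add: powr_powr flip: powr_numeral)
    qed
    also have "\<dots> = b powr (1 - 1 / p) * ?v powr (1 - 1 / p)"
      using that by (subst powr_mult[symmetric]) auto
    finally have g': "cmod (g x) \<le> b powr (1 - 1 / p) * ?v powr (1 - 1 / p)" .
    have f': "cmod (f x) = a * ?u powr (1 / p)"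
      using that p False by (simp add: powr_divide powr_powr)
    have "cmod (f x * g x) \<le> (a * ?u powr (1 / p)) * (b powr (1 - 1 / p) * ?v powr (1 - 1 / p))"
      unfolding norm_mult
      by (subst (1) f') (intro mult_left_mono g', use that in auto)
    also have "\<dots> = a * b powr (1 - 1 / p) * (?u powr (1 / p) * ?v powr (1 - 1 / p))"
      by (simp only: mult.assoc mult.left_commute)
    also have "\<dots> \<le> a * b powr (1 - 1 / p) * (1 / p * ?u + (1 - 1 / p) * ?v)"
      using that p False by (intro mult_left_mono Youngs_inequality_0) auto
    finally show ?thesis .
  qed
  have Iab: "integrable \<mu> (\<lambda>x. a * b powr (1 - 1 / p) *
      (1 / p * (cmod (f x) powr p / a powr p) + (1 - 1 / p) * ((cmod (g x))\<^sup>2 / b)))" for a b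
    using If Ig by auto
  show I: "integrable \<mu> (\<lambda>x. f x * g x)"
    by (rule Bochner_Integration.integrable_bound[OF Iab[of 1 1]])
      (use young[of 1 1] mf mg in \<open>auto intro!: AE_I2 order_trans[OF _ abs_ge_self]\<close>)
  have main: "cmod (LINT x|\<mu>. f x * g x) \<le> a * b powr (1 - 1 / p)"
    if a: "0 < a" "Lp_norm \<mu> p f \<le> a" and b: "0 < b" "B \<le> b" for a b
  proof -
    have F: "(LINT x|\<mu>. cmod (f x) powr p) \<le> a powr p"
      using a p Lp_norm_le_iff[of p a \<mu> f] by auto
    have "cmod (LINT x|\<mu>. f x * g x) \<le> (LINT x|\<mu>. cmod (f x * g x))"
      by (rule integral_norm_bound)
    also have "\<dots> \<le> (LINT x|\<mu>. a * b powr (1 - 1 / p) *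
      (1 / p * (cmod (f x) powr p / a powr p) + (1 - 1 / p) * ((cmod (g x))\<^sup>2 / b)))"
      using I young a b by (intro integral_mono Iab) auto
    also have "\<dots> = a * b powr (1 - 1 / p) *
      (1 / p * ((LINT x|\<mu>. cmod (f x) powr p) / a powr p) + (1 - 1 / p) * (B / b))"
      using If Ig by (simp add: B_def)
    also have "\<dots> \<le> a * b powr (1 - 1 / p) * (1 / p * 1 + (1 - 1 / p) * 1)"
      using a b F p by (intro mult_left_mono add_mono) auto
    finally show ?thesis by simp
  qed
  \<comment> \<open>The positive bounds tend to the true values. The case \<open>B = 0\<close>,
    \<open>p = 1\<close> is excluded since \<open>0 powr 0 = 0\<close> while
    \<open>e powr 0 = 1\<close> for positive \<open>e\<close>, so the right-hand side jumps at 0.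
    When \<open>B = 0\<close>, \<open>g\<close> vanishes almost everywhere and the integral is 0
    anyway.\<close>
  have "((\<lambda>e. (Lp_norm \<mu> p f + e) * (B + e) powr (1 - 1 / p)) \<longlongrightarrow>
      (Lp_norm \<mu> p f + 0) * (B + 0) powr (1 - 1 / p)) (at_right 0)" if "B \<noteq> 0 \<or> p \<noteq> 1"
  proof (cases "p = 1")
    case True
    then have "B \<noteq> 0" using that by simp
    then show ?thesis by (intro tendsto_intros) auto
  next
    case False
    have "((\<lambda>e. (B + e) powr (1 - 1 / p)) \<longlongrightarrow> (B + 0) powr (1 - 1 / p)) (at_right 0)"
    proof (rule tendsto_powr')
      have "\<forall>\<^sub>F e in at_right 0. 0 \<le> B + e"
        using eventually_at_right_less[of "0::real"] by eventually_elim (use B0 in simp)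
      then show "B + 0 \<noteq> 0 \<or> 0 < 1 - 1 / p \<and> (\<forall>\<^sub>F e in at_right 0. 0 \<le> B + e)"
        using False p by simp
    qed (intro tendsto_intros)+
    then show ?thesis by (intro tendsto_mult tendsto_add tendsto_const tendsto_ident_at)
  qed
  moreover have "\<forall>\<^sub>F e in at_right 0. cmod (LINT x|\<mu>. f x * g x) \<le>
      (Lp_norm \<mu> p f + e) * (B + e) powr (1 - 1 / p)"
    using eventually_at_right_less[of "0::real"]
  proof eventually_elim
    case (elim e)
    then show ?case using main[of "Lp_norm \<mu> p f + e" "B + e"] B0 Lp_norm_nonneg[of \<mu> p f] by simp
  qed
  ultimately have ok: "?lhs \<le> ?rhs" if "B \<noteq> 0 \<or> p \<noteq> 1"
    using that by (auto simp: B_def intro: tendsto_lowerbound)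
  have "AE x in \<mu>. g x = 0" if "B = 0"
    using that integral_nonneg_eq_0_iff_AE[OF Ig] by (auto simp: B_def)
  then have "(LINT x|\<mu>. f x * g x) = 0" if "B = 0"
  proof -
    have "AE x in \<mu>. f x * g x = 0"
      using \<open>B = 0 \<Longrightarrow> AE x in \<mu>. g x = 0\<close> that by (auto elim!: eventually_mono)
    then show ?thesis
      using integral_cong_AE[of "\<lambda>x. f x * g x" \<mu> "\<lambda>x. 0"] mf mg by simp
  qed
  then show "?lhs \<le> ?rhs" using ok Lp_norm_nonneg[of \<mu> p f] by (cases "B = 0") auto
qed

section \<open>Convolution operators on a compact group\<close>

locale haar_group =
  fixes \<mu> :: "'g::{topological_group_add, t2_space, second_countable_topology} measure"
  assumes compact_group: "compact (UNIV :: 'g set)"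
    and haar: "normalised_haar \<mu>"
begin

section \<open>Haar measure and integration of continuous functions\<close>

lemma sets_haar: "sets \<mu> = sets borel"
  using haar by (simp add: normalised_haar_def)

lemma space_haar [simp]: "space \<mu> = UNIV"
  using sets_eq_imp_space_eq[OF sets_haar] by simp

lemma measurable_haar: "measurable \<mu> M = measurable borel M"
  by (rule measurable_cong_sets) (simp_all add: sets_haar)

sublocale finite_measure \<mu>
  by standard (use haar in \<open>simp add: normalised_haar_def\<close>)

lemma measure_UNIV [simp]: "measure \<mu> UNIV = 1"
  using haar by (simp add: normalised_haar_def measure_def)

lemma translate_image: "(+) a ` B = (+) (- a) -` (B :: 'g set)"
proof (intro Set.set_eqI iffI)
  fix x assume "x \<in> (+) (- a) -` B"
  then show "x \<in> (+) a ` B" using image_eqI[of x "(+) a" "- a + x" B] by simp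
qed auto

lemma measurable_translate: "(+) a \<in> measurable \<mu> \<mu>"
  unfolding measurable_haar measurable_cong_sets[OF refl sets_haar]
  by (intro borel_measurable_continuous_onI continuous_intros)

lemma distr_translate: "distr \<mu> \<mu> ((+) a) = \<mu>"
proof (rule measure_eqI)
  fix B assume "B \<in> sets (distr \<mu> \<mu> ((+) a))"
  then have B: "B \<in> sets \<mu>" by simp
  have "(+) a -` B = (+) (- a) ` B"
    using translate_image[of "- a" B] by simp
  then show "emeasure (distr \<mu> \<mu> ((+) a)) B = emeasure \<mu> B"
    using haar B by (simp add: emeasure_distr[OF measurable_translate B] normalised_haar_def)
qed simp

lemma integral_translate:
  fixes f :: "'g \<Rightarrow> 'b::{banach, second_countable_topology}"
  assumes "f \<in> borel_measurable \<mu>"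
  shows "(LINT x|\<mu>. f (a + x)) = (LINT x|\<mu>. f x)"
  using integral_distr[OF measurable_translate assms] by (simp add: distr_translate)

abbreviation cts :: "('g \<Rightarrow> 'b::topological_space) \<Rightarrow> bool" where
  "cts f \<equiv> continuous_on UNIV f"

lemma cts_translate: "cts f \<Longrightarrow> cts (\<lambda>x. f (a + x))"
  by (rule continuous_on_compose2[of UNIV f]) (auto intro!: continuous_intros)

lemma cts_measurable: "cts f \<Longrightarrow> f \<in> borel_measurable \<mu>"
  unfolding measurable_haar by (rule borel_measurable_continuous_onI)

lemma cts_bounded:
  fixes f :: "'g \<Rightarrow> 'b::real_normed_vector"
  assumes "cts f"
  obtains B where "0 \<le> B" "\<And>x. norm (f x) \<le> B"
proof -
  have "bounded (f ` UNIV)"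
    by (intro compact_imp_bounded compact_continuous_image assms compact_group)
  then obtain B where "\<And>x. norm (f x) \<le> B" by (auto simp: bounded_iff)
  moreover from this[of 0] have "0 \<le> B" using norm_ge_zero order_trans by blast
  ultimately show thesis using that by blast
qed

lemma integrable_bounded:
  fixes f :: "'g \<Rightarrow> 'b::{banach, second_countable_topology}"
  assumes "f \<in> borel_measurable \<mu>" "\<And>x. norm (f x) \<le> B"
  shows "integrable \<mu> f"
  using assms by (intro integrable_const_bound[of _ B]) auto

lemma integrable_cts:
  fixes f :: "'g \<Rightarrow> 'b::{banach, second_countable_topology}"
  assumes "cts f"
  shows "integrable \<mu> f"
proof -
  obtain B where "\<And>x. norm (f x) \<le> B" using cts_bounded[OF assms] by blast
  then show ?thesis using assms by (intro integrable_bounded cts_measurable)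
qed

lemma integral_norm_le:
  fixes f :: "'g \<Rightarrow> 'b::{banach, second_countable_topology}"
  assumes "\<And>x. norm (f x) \<le> B"
  shows "norm (LINT x|\<mu>. f x) \<le> B"
proof (cases "integrable \<mu> f")
  case True
  have "norm (LINT x|\<mu>. f x) \<le> (LINT x|\<mu>. norm (f x))" by (rule integral_norm_bound)
  also have "\<dots> \<le> (LINT x|\<mu>. B)" using True assms by (intro integral_mono) auto
  finally show ?thesis by simp
next
  case False
  \<comment> \<open>A function that is not integrable has integral 0 by convention, and
    \<open>B\<close> is nonnegative because it bounds a norm; hence the estimate carries no side
    condition.\<close>
  have "0 \<le> B" using assms[of undefined] norm_ge_zero order_trans by blast
  then show ?thesis using False by (simp add: not_integrable_integral_eq)
qed

text \<open>By compactness finitely many left translates of \<open>U\<close> cover the group. They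
  all have the measure of \<open>U\<close>, so a null \<open>U\<close> would make the whole group
  null.\<close>

lemma emeasure_open_pos:
  assumes "open U" "U \<noteq> {}"
  shows "emeasure \<mu> U \<noteq> 0"
proof
  assume 0: "emeasure \<mu> U = 0"
  obtain u where u: "u \<in> U" using assms by auto
  have op: "open ((+) a ` U)" for a :: 'g
  proof -
    have "(+) a ` U = (+) (- a) -` U"
      by (rule translate_image)
    moreover have "open ((+) (- a) -` U)"
      by (intro open_vimage assms continuous_intros)
    ultimately show ?thesis by simp
  qed
  have "UNIV \<subseteq> (\<Union>a\<in>UNIV. (+) a ` U)"
  proof
    fix x
    have "x = (x - u) + u" by simp
    then show "x \<in> (\<Union>a\<in>UNIV. (+) a ` U)" using u by blast
  qed
  then obtain F where F: "finite F" "UNIV \<subseteq> (\<Union>a\<in>F. (+) a ` U)"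
    using compactE_image[OF compact_group, of UNIV "\<lambda>a. (+) a ` U"] op by metis
  have U: "U \<in> sets \<mu>" using assms by (simp add: sets_haar)
  have "(\<Union>a\<in>F. (+) a ` U) \<in> null_sets \<mu>"
  proof (rule null_sets_UN')
    fix a
    show "(+) a ` U \<in> null_sets \<mu>"
      using haar U op[of a] 0 by (simp add: null_sets_def normalised_haar_def sets_haar)
  qed (use F in \<open>auto intro: countable_finite\<close>)
  then have "UNIV \<in> null_sets \<mu>" using F by (simp add: top.extremum_unique)
  then show False using haar by (simp add: normalised_haar_def null_sets_def)
qed

text \<open>Tube lemma: compactness of the second factor lets one neighbourhood of \<open>a\<close>
  serve all \<open>y\<close>. This is the source of both the continuity of parametric integrals and
  the uniform continuity of functions on the group, where no metric is given.\<close>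

lemma uniform_tube:
  fixes K :: "'g \<Rightarrow> 'g \<Rightarrow> complex"
  assumes "continuous_on UNIV (\<lambda>z. K (fst z) (snd z))" "0 < e"
  obtains U where "open U" "a \<in> U" "\<And>x y. x \<in> U \<Longrightarrow> cmod (K x y - K a y) \<le> e"
proof -
  have "continuous_on (UNIV \<times> UNIV) (\<lambda>z. K (fst z) (snd z))" using assms by simp
  from continuous_on_prod_compactE[OF this compact_group UNIV_I \<open>0 < e\<close>, of a]
  obtain X where X: "a \<in> X" "open X"
    "\<forall>x\<in>X \<inter> UNIV. \<forall>t\<in>UNIV. dist (K (fst (x, t)) (snd (x, t))) (K (fst (a, t)) (snd (a, t))) \<le> e"
    by blast
  then show thesis using that[OF X(2,1)] by (simp add: dist_norm)
qed

lemma cts_parametric_integral: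
  fixes K :: "'g \<Rightarrow> 'g \<Rightarrow> complex"
  assumes K: "continuous_on UNIV (\<lambda>z. K (fst z) (snd z))"
  shows "cts (\<lambda>x. CLINT y|\<mu>. K x y)"
  unfolding continuous_on_def
proof (intro ballI tendstoI)
  fix a :: 'g and e :: real assume "0 < e"
  then have "0 < e / 2" by simp
  from uniform_tube[of K, OF K this, of a]
  obtain U where U: "open U" "a \<in> U" "\<And>x y. x \<in> U \<Longrightarrow> cmod (K x y - K a y) \<le> e / 2"
    by blast
  have c: "cts (K x)" for x
    using continuous_on_compose2[OF K, of UNIV "\<lambda>y. (x, y)"] by (simp add: continuous_on_Pair)
  have "dist (CLINT y|\<mu>. K x y) (CLINT y|\<mu>. K a y) < e" if "x \<in> U" for x
  proof -
    have "cmod (CLINT y|\<mu>. K x y - K a y) \<le> e / 2"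
      using U that by (intro integral_norm_le) auto
    then show ?thesis
      using \<open>0 < e\<close> by (simp add: dist_norm integrable_cts[OF c])
  qed
  then show "\<forall>\<^sub>F x in at a within UNIV. dist (CLINT y|\<mu>. K x y) (CLINT y|\<mu>. K a y) < e"
    using U(1,2) by (auto simp: eventually_at_topological)
qed

lemma cts_comp2:
  fixes f :: "'g \<Rightarrow> 'b::topological_space" and h :: "'g \<times> 'g \<Rightarrow> 'g"
  shows "cts f \<Longrightarrow> continuous_on UNIV h \<Longrightarrow> continuous_on UNIV (\<lambda>z. f (h z))"
  by (rule continuous_on_compose2[of UNIV f]) auto

lemma cts_uniform:
  fixes f :: "'g \<Rightarrow> complex"
  assumes "cts f" "0 < e"
  obtains V where "open V" "0 \<in> V" "\<And>x v. v \<in> V \<Longrightarrow> cmod (f (x + v) - f x) \<le> e"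
proof -
  have "continuous_on UNIV (\<lambda>z. f (snd z + fst z))"
    by (rule cts_comp2[OF assms(1)]) (intro continuous_intros)
  from uniform_tube[of "\<lambda>v x. f (x + v)", OF this \<open>0 < e\<close>, of 0]
  obtain V where V: "open V" "0 \<in> V" "\<And>v x. v \<in> V \<Longrightarrow> cmod (f (x + v) - f (x + 0)) \<le> e"
    by blast
  show thesis using that[OF V(1,2)] V(3) by simp
qed

section \<open>The L^2 inner product on continuous functions\<close>

definition ip :: "('g \<Rightarrow> complex) \<Rightarrow> ('g \<Rightarrow> complex) \<Rightarrow> complex" where
  "ip f g = (CLINT x|\<mu>. f x * cnj (g x))"

definition nsq :: "('g \<Rightarrow> complex) \<Rightarrow> real" where
  "nsq f = (LINT x|\<mu>. (cmod (f x))\<^sup>2)"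

lemma integrable_ip: "cts f \<Longrightarrow> cts g \<Longrightarrow> integrable \<mu> (\<lambda>x. f x * cnj (g x))"
  by (intro integrable_cts continuous_intros)

lemma integrable_nsq:
  fixes f :: "'g \<Rightarrow> complex"
  shows "cts f \<Longrightarrow> integrable \<mu> (\<lambda>x. (cmod (f x))\<^sup>2)"
  by (intro integrable_cts continuous_intros)

lemma ip_add_left: "cts f \<Longrightarrow> cts g \<Longrightarrow> cts h \<Longrightarrow> ip (\<lambda>x. f x + g x) h = ip f h + ip g h"
  by (simp add: ip_def distrib_right integrable_ip)

lemma ip_diff_left: "cts f \<Longrightarrow> cts g \<Longrightarrow> cts h \<Longrightarrow> ip (\<lambda>x. f x - g x) h = ip f h - ip g h"
  by (simp add: ip_def left_diff_distrib integrable_ip)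

lemma ip_scale_left: "ip (\<lambda>x. c * f x) h = c * ip f h"
  by (simp add: ip_def mult.assoc)

lemma ip_zero_left [simp]: "ip (\<lambda>x. 0) h = 0"
  by (simp add: ip_def)

lemma ip_commute: "ip g f = cnj (ip f g)"
  using Bochner_Integration.integral_cnj[of \<mu> "\<lambda>x. f x * cnj (g x)"] by (simp add: ip_def mult.commute)

lemma ip_zero_right [simp]: "ip h (\<lambda>x. 0) = 0"
  by (simp add: ip_def)

lemma ip_diff_right: "cts f \<Longrightarrow> cts g \<Longrightarrow> cts h \<Longrightarrow> ip h (\<lambda>x. f x - g x) = ip h f - ip h g"
  using arg_cong[OF ip_diff_left[of f g h], of cnj] by (simp add: ip_commute[of h])

lemma ip_scale_right: "ip h (\<lambda>x. c * f x) = cnj c * ip h f"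
  using arg_cong[OF ip_scale_left[of c f h], of cnj] by (simp add: ip_commute[of h])

lemma ip_sum_left:
  "(\<And>i. i \<in> I \<Longrightarrow> cts (f i)) \<Longrightarrow> cts h \<Longrightarrow> ip (\<lambda>x. \<Sum>i\<in>I. f i x) h = (\<Sum>i\<in>I. ip (f i) h)"
  unfolding ip_def sum_distrib_right by (intro Bochner_Integration.integral_sum integrable_ip) auto

lemma ip_sum_right:
  "(\<And>i. i \<in> I \<Longrightarrow> cts (f i)) \<Longrightarrow> cts h \<Longrightarrow> ip h (\<lambda>x. \<Sum>i\<in>I. f i x) = (\<Sum>i\<in>I. ip h (f i))"
  using arg_cong[OF ip_sum_left[of I f h], of cnj] by (simp add: ip_commute[of h])

lemma ip_translate: "cts f \<Longrightarrow> cts g \<Longrightarrow> ip (\<lambda>x. f (a + x)) (\<lambda>x. g (a + x)) = ip f g"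
  unfolding ip_def
  by (rule integral_translate[of "\<lambda>x. f x * cnj (g x)"]) (intro cts_measurable continuous_intros)

lemma ip_self: "ip f f = complex_of_real (nsq f)"
  by (simp add: ip_def nsq_def complex_norm_square[symmetric] flip: of_real_power integral_complex_of_real)

lemma nsq_nonneg [simp]: "0 \<le> nsq f"
  by (simp add: nsq_def)

lemma nsq_zero [simp]: "nsq (\<lambda>x. 0) = 0"
  by (simp add: nsq_def)

lemma nsq_scale: "nsq (\<lambda>x. c * f x) = (cmod c)\<^sup>2 * nsq f"
  by (simp add: nsq_def norm_mult power_mult_distrib)

text \<open>The set where \<open>f\<close> does not vanish is open and null, hence empty. Thus the
  inner product is definite on continuous functions and no passage to classes is required
  there.\<close>

lemma nsq_eq_0:
  assumes "cts f" "nsq f = 0"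
  shows "f = (\<lambda>x. 0)"
proof (rule ccontr)
  assume "f \<noteq> (\<lambda>x. 0)"
  then obtain a where a: "f a \<noteq> 0" by auto
  let ?U = "{x. f x \<noteq> 0}"
  have "open ?U"
    using open_vimage[of "- {0}" f] assms by (simp add: vimage_def open_Compl)
  moreover have "AE x in \<mu>. f x = 0"
    using assms integral_nonneg_eq_0_iff_AE[OF integrable_nsq[OF assms(1)]] by (simp add: nsq_def)
  then have "emeasure \<mu> ?U = 0"
    using \<open>open ?U\<close> by (subst (asm) AE_iff_measurable[of ?U]) (auto simp: sets_haar)
  ultimately show False using emeasure_open_pos[of ?U] a by auto
qed

lemma nsq_diff_scale:
  assumes "cts f" "cts g"
  shows "nsq (\<lambda>x. f x - c * g x) = nsq f - 2 * Re (cnj c * ip f g) + (cmod c)\<^sup>2 * nsq g"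
proof -
  have cg: "cts (\<lambda>x. c * g x)" using assms by (intro continuous_intros)
  have "complex_of_real (nsq (\<lambda>x. f x - c * g x)) =
      ip f f - cnj c * ip f g - c * cnj (ip f g) + c * cnj c * ip g g"
    unfolding ip_self[symmetric] using assms cg
    by (simp add: ip_diff_left ip_diff_right ip_scale_left ip_scale_right continuous_on_diff
        ip_commute[of g f] algebra_simps)
  also have "\<dots> = complex_of_real (nsq f - 2 * Re (cnj c * ip f g) + (cmod c)\<^sup>2 * nsq g)"
    by (simp add: ip_self complex_eq_iff cmod_power2 algebra_simps)
      (simp add: power2_eq_square algebra_simps)
  finally show ?thesis by (simp only: of_real_eq_iff)
qed

text \<open>Pythagoras for the projection onto the line spanned by \<open>g\<close>. Nonnegativity
  of the left-hand side is Cauchy-Schwarz; the exact value measures how much subtracting a multiple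
  of \<open>g\<close> improves an approximation.\<close>

lemma nsq_residual:
  assumes "cts f" "cts g" "nsq g \<noteq> 0"
  shows "nsq (\<lambda>x. f x - ip f g / nsq g * g x) = nsq f - (cmod (ip f g))\<^sup>2 / nsq g"
proof -
  let ?c = "ip f g / nsq g"
  have "cnj ?c * ip f g = complex_of_real ((cmod (ip f g))\<^sup>2 / nsq g)"
    by (simp add: complex_norm_square[unfolded of_real_power] mult.commute)
  then have re: "Re (cnj ?c * ip f g) = (cmod (ip f g))\<^sup>2 / nsq g"
    by (simp only: Re_complex_of_real)
  have sq: "(cmod ?c)\<^sup>2 * nsq g = (cmod (ip f g))\<^sup>2 / nsq g"
    using assms(3) by (simp add: norm_divide power_divide power2_eq_square)
  show ?thesis unfolding nsq_diff_scale[OF assms(1,2)] re sq by simp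
qed

lemma ip_cauchy_schwarz:
  assumes "cts f" "cts g"
  shows "(cmod (ip f g))\<^sup>2 \<le> nsq f * nsq g"
proof (cases "nsq g = 0")
  case True
  then have "g = (\<lambda>x. 0)" using nsq_eq_0 assms by blast
  then show ?thesis by simp
next
  case False
  then have "0 < nsq g" using nsq_nonneg[of g] by linarith
  moreover have "0 \<le> nsq f - (cmod (ip f g))\<^sup>2 / nsq g"
    unfolding nsq_residual[OF assms False, symmetric] by (rule nsq_nonneg)
  ultimately show ?thesis by (simp add: field_simps)
qed

lemma nsq_le:
  assumes "\<And>x. cmod (f x) \<le> B" "0 \<le> B"
  shows "nsq f \<le> B\<^sup>2"
proof -
  have "norm (LINT x|\<mu>. (cmod (f x))\<^sup>2) \<le> B\<^sup>2"
    using assms by (intro integral_norm_le) (auto intro: power_mono)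
  then show ?thesis by (simp add: nsq_def)
qed

lemma ip_bound:
  assumes "cts f" "cts g" "nsq f \<le> A" "\<And>x. cmod (g x) \<le> B" "0 \<le> B"
  shows "cmod (ip f g) \<le> sqrt A * B"
proof -
  have "(cmod (ip f g))\<^sup>2 \<le> nsq f * nsq g" by (intro ip_cauchy_schwarz assms)
  also have "\<dots> \<le> A * B\<^sup>2"
    using assms nsq_le[of g B] order_trans[OF nsq_nonneg assms(3)] by (intro mult_mono) auto
  finally show ?thesis
    using assms real_le_rsqrt[of "cmod (ip f g)" "A * B\<^sup>2"] by (simp add: real_sqrt_mult)
qed

lemma ip_tendsto:
  assumes "uniform_limit UNIV F g sequentially" "\<And>n. cts (F n)" "cts g" "cts h"
  shows "(\<lambda>n. ip (F n) h) \<longlonglongrightarrow> ip g h"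
proof (rule LIMSEQ_I)
  fix e :: real assume "0 < e"
  define d where "d = e / (2 * (sqrt (nsq h) + 1))"
  have sq: "0 < sqrt (nsq h) + 1" by (simp add: add_nonneg_pos)
  then have d: "0 < d" using \<open>0 < e\<close> by (simp add: d_def)
  obtain N where N: "\<And>n x. N \<le> n \<Longrightarrow> cmod (F n x - g x) < d"
    using uniform_limitD[OF assms(1) d] by (auto simp: eventually_sequentially dist_norm)
  have "norm (ip (F n) h - ip g h) < e" if "N \<le> n" for n
  proof -
    have "ip (F n) h - ip g h = cnj (ip h (\<lambda>x. F n x - g x))"
      using assms by (simp add: ip_diff_left ip_commute[of h] continuous_on_diff)
    then have "cmod (ip (F n) h - ip g h) = cmod (ip h (\<lambda>x. F n x - g x))" by simp
    also have "\<dots> \<le> sqrt (nsq h) * d"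
      using assms N[OF that] d by (intro ip_bound continuous_on_diff) (auto intro: less_imp_le)
    also have "\<dots> < e"
    proof -
      have "sqrt (nsq h) * d \<le> (sqrt (nsq h) + 1) * d" using d by (intro mult_right_mono) auto
      also have "\<dots> = e / 2" using sq by (simp add: d_def field_simps)
      finally show ?thesis using \<open>0 < e\<close> by linarith
    qed
    finally show ?thesis .
  qed
  then show "\<exists>N. \<forall>n\<ge>N. norm (ip (F n) h - ip g h) < e" by blast
qed

lemma nsq_tendsto_0:
  assumes "uniform_limit UNIV F g sequentially" "\<And>n. cts (F n)" "cts g"
  shows "(\<lambda>n. nsq (\<lambda>x. F n x - g x)) \<longlonglongrightarrow> 0"
proof (rule LIMSEQ_I)
  fix e :: real assume "0 < e"
  then have d: "0 < sqrt (e / 2)" by simp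
  obtain N where N: "\<And>n x. N \<le> n \<Longrightarrow> cmod (F n x - g x) < sqrt (e / 2)"
    using uniform_limitD[OF assms(1) d] by (auto simp: eventually_sequentially dist_norm)
  have "norm (nsq (\<lambda>x. F n x - g x) - 0) < e" if "N \<le> n" for n
  proof -
    have "nsq (\<lambda>x. F n x - g x) \<le> (sqrt (e / 2))\<^sup>2"
      using N[OF that] \<open>0 < e\<close> by (intro nsq_le) (auto intro: less_imp_le)
    then show ?thesis using \<open>0 < e\<close> by simp
  qed
  then show "\<exists>N. \<forall>n\<ge>N. norm (nsq (\<lambda>x. F n x - g x) - 0) < e" by blast
qed

section \<open>Convolution as a compact self-adjoint operator\<close>

definition conv :: "('g \<Rightarrow> complex) \<Rightarrow> ('g \<Rightarrow> complex) \<Rightarrow> 'g \<Rightarrow> complex" where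
  "conv k f = (\<lambda>x. CLINT y|\<mu>. f y * k (- y + x))"

lemma cts_kernel:
  assumes "cts k" shows "cts (\<lambda>y. k (- y + x))" "cts (\<lambda>x. k (- y + x))"
  by (rule continuous_on_compose2[OF assms]; auto intro!: continuous_intros)+

lemma cts_fst: "cts f \<Longrightarrow> continuous_on UNIV (\<lambda>z :: 'g \<times> 'g. f (fst z))"
  and cts_snd: "cts f \<Longrightarrow> continuous_on UNIV (\<lambda>z :: 'g \<times> 'g. f (snd z))"
  by (erule cts_comp2, rule continuous_on_fst continuous_on_snd, rule continuous_on_id)+

lemma conv_eq_ip: "conv k f x = ip f (\<lambda>y. cnj (k (- y + x)))"
  by (simp add: conv_def ip_def)

lemma cts_conv:
  assumes "cts k" "cts f"
  shows "cts (conv k f)"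
  unfolding conv_def
proof (rule cts_parametric_integral)
  have "continuous_on UNIV (\<lambda>z. k (- snd z + fst z))"
    by (rule cts_comp2[OF assms(1)]) (intro continuous_intros)
  moreover have "continuous_on UNIV (\<lambda>z :: 'g \<times> 'g. f (snd z))"
    by (rule cts_snd[OF assms(2)])
  ultimately show "continuous_on UNIV (\<lambda>z. f (snd z) * k (- snd z + fst z))"
    by (intro continuous_on_mult)
qed

lemma conv_add:
  assumes "cts k" "cts f" "cts g"
  shows "conv k (\<lambda>x. f x + g x) = (\<lambda>x. conv k f x + conv k g x)"
  using assms by (simp add: fun_eq_iff conv_eq_ip ip_add_left cts_kernel continuous_on_cnj)

lemma conv_diff:
  assumes "cts k" "cts f" "cts g"
  shows "conv k (\<lambda>x. f x - g x) = (\<lambda>x. conv k f x - conv k g x)"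
  using assms by (simp add: fun_eq_iff conv_eq_ip ip_diff_left cts_kernel continuous_on_cnj)

lemma conv_scale: "conv k (\<lambda>x. c * f x) = (\<lambda>x. c * conv k f x)"
  by (simp add: fun_eq_iff conv_eq_ip ip_scale_left)

lemma conv_zero [simp]: "conv k (\<lambda>x. 0) = (\<lambda>x. 0)"
  by (simp add: conv_def)

lemma minus_add_cancel_translate: "- (a + y) + (a + x) = - y + (x :: 'g)"
  by (simp only: minus_add add.assoc minus_add_cancel)

text \<open>The kernel depends on \<open>x\<close> and \<open>y\<close> only through
  \<open>- y + x\<close>, which does not change when both are translated by \<open>a\<close> from
  the left.\<close>

lemma conv_translate:
  assumes "cts k" "cts f"
  shows "conv k (\<lambda>x. f (a + x)) = (\<lambda>x. conv k f (a + x))"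
proof
  fix x
  have "cts (\<lambda>y. f y * k (- y + (a + x)))"
    by (intro continuous_on_mult cts_kernel assms)
  from integral_translate[OF cts_measurable[OF this], of a]
  show "conv k (\<lambda>x. f (a + x)) x = conv k f (a + x)"
    by (simp add: conv_def minus_add_cancel_translate)
qed

text \<open>Cauchy-Schwarz turns an L^2 bound on \<open>f\<close> into a uniform bound on its
  convolution. This gain is what upgrades L^2 convergence to uniform convergence in the
  eigenfunction argument.\<close>

lemma conv_bound:
  assumes "cts k" "cts f" and k: "\<And>x. cmod (k x) \<le> B" "0 \<le> B"
  shows "cmod (conv k f x) \<le> sqrt (nsq f) * B"
  unfolding conv_eq_ip using assms
  by (intro ip_bound continuous_on_cnj cts_kernel) auto

text \<open>The condition on \<open>k\<close> says that the kernel \<open>k (- y + x)\<close> is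
  hermitian in (x, y); exchanging the integrals then moves the operator to the other
  argument.\<close>

lemma conv_symmetric:
  assumes k: "cts k" "\<And>x. k (- x) = cnj (k x)" and f: "cts f" and g: "cts g"
  shows "ip (conv k f) g = ip f (conv k g)"
proof -
  interpret pair_sigma_finite \<mu> \<mu>
    by (intro pair_sigma_finite.intro sigma_finite_measure_axioms)
  let ?h = "\<lambda>(x, y). f y * k (- y + x) * cnj (g x)"
  have "continuous_on UNIV ?h"
  proof -
    have "continuous_on UNIV (\<lambda>z. k (- snd z + fst z))"
      by (rule cts_comp2[OF k(1)]) (intro continuous_intros)
    moreover have "continuous_on UNIV (\<lambda>z :: 'g \<times> 'g. f (snd z))"
      "continuous_on UNIV (\<lambda>z :: 'g \<times> 'g. g (fst z))"
      by (rule cts_snd[OF f] cts_fst[OF g])+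
    ultimately show ?thesis by (auto simp: case_prod_beta intro!: continuous_intros)
  qed
  then have "?h \<in> borel_measurable borel" by (rule borel_measurable_continuous_onI)
  \<comment> \<open>Second countability identifies the product of the Borel sigma-algebras with the
    Borel sigma-algebra of the product, so that a continuous integrand is measurable for
    Fubini.\<close>
  moreover have "sets (\<mu> \<Otimes>\<^sub>M \<mu>) = sets (borel :: ('g \<times> 'g) measure)"
    by (subst borel_prod[symmetric]) (intro sets_pair_measure_cong sets_haar)
  ultimately have m: "?h \<in> borel_measurable (\<mu> \<Otimes>\<^sub>M \<mu>)"
    by (subst measurable_cong_sets[OF _ refl])
  obtain K where K: "\<And>x. cmod (k x) \<le> K" "0 \<le> K" using cts_bounded[OF k(1)] by metis
  obtain F where F: "\<And>x. cmod (f x) \<le> F" "0 \<le> F" using cts_bounded[OF f] by metis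
  obtain G where G: "\<And>x. cmod (g x) \<le> G" "0 \<le> G" using cts_bounded[OF g] by metis
  have b: "cmod (?h z) \<le> F * K * G" for z
    using K F G by (cases z) (auto simp: norm_mult intro!: mult_mono)
  interpret P: finite_measure "\<mu> \<Otimes>\<^sub>M \<mu>"
    by (rule finite_measure_pair_measure) unfold_locales
  have int: "integrable (\<mu> \<Otimes>\<^sub>M \<mu>) ?h"
    by (intro P.integrable_const_bound[of _ "F * K * G"] m AE_I2 b)
  have "ip (conv k f) g = (CLINT x|\<mu>. CLINT y|\<mu>. ?h (x, y))"
    by (simp add: ip_def conv_def)
  also have "\<dots> = (CLINT y|\<mu>. CLINT x|\<mu>. ?h (x, y))"
    using Fubini_integral[of "\<lambda>x y. ?h (x, y)"] int by simp
  also have "\<dots> = (CLINT y|\<mu>. f y * cnj (conv k g y))"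
  proof (rule Bochner_Integration.integral_cong[OF refl])
    fix y
    have "k (- y + x) = cnj (k (- x + y))" for x using k(2)[of "- x + y"] by (simp add: minus_add)
    then have "(CLINT x|\<mu>. ?h (x, y)) = (CLINT x|\<mu>. f y * cnj (g x * k (- x + y)))"
      by (simp add: mult.assoc mult.commute[of "cnj (g _)"])
    also have "\<dots> = f y * cnj (conv k g y)"
      by (simp only: Bochner_Integration.integral_cnj integral_mult_right_zero conv_def)
    finally show "(CLINT x|\<mu>. ?h (x, y)) = f y * cnj (conv k g y)" .
  qed
  finally show ?thesis by (simp add: ip_def)
qed

text \<open>Arzela--Ascoli for the functions \<open>conv k f\<close> with \<open>f\<close> in an \<open>L\<^sup>2\<close> ball: the
  modulus of continuity is that of \<open>k\<close>.\<close>

lemma conv_compact: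
  assumes k: "cts k" and F: "\<And>n. cts (F n)" "\<And>n. nsq (F n) \<le> A"
  obtains s :: "nat \<Rightarrow> nat" and g where "strict_mono s" "cts g"
    "uniform_limit UNIV (\<lambda>n. conv k (F (s n))) g sequentially"
proof -
  obtain B where B: "\<And>x. cmod (k x) \<le> B" "0 \<le> B" using cts_bounded[OF k] by metis
  have A: "0 \<le> A" using F(2)[of 0] nsq_nonneg order_trans by blast
  obtain Q :: "'g set" where Q: "countable Q" "\<And>X. open X \<Longrightarrow> X \<noteq> {} \<Longrightarrow> \<exists>d\<in>Q. d \<in> X"
    using countable_dense_setE by blast
  have bound: "cmod (conv k (F n) x) \<le> sqrt A * B" for n x
    using conv_bound[OF k F(1) B, of n x] F(2)[of n] B
    by (meson order_trans mult_right_mono real_sqrt_le_mono)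
  \<comment> \<open>Pointwise boundedness on a countable dense set gives a diagonal subsequence
    converging there; equicontinuity then makes it uniformly Cauchy.\<close>
  obtain s :: "nat \<Rightarrow> nat" where s: "strict_mono s"
    "\<And>x. x \<in> Q \<Longrightarrow> \<exists>l. (\<lambda>n. conv k (F (s n)) x) \<longlonglongrightarrow> l"
    using function_convergent_subsequence[OF Q(1), of "\<lambda>n. conv k (F n)"] bound by blast
  have equi: "\<exists>V. open V \<and> 0 \<in> V \<and> (\<forall>n x. \<forall>v\<in>V. cmod (conv k (F n) (x + v) - conv k (F n) x) \<le> e)"
    if "0 < e" for e
  proof -
    \<comment> \<open>The summand 1 keeps the denominator positive when
      \<open>A = 0\<close>.\<close>
    define d where "d = e / (sqrt A + 1)"
    have sA: "0 < sqrt A + 1" using A by (simp add: add_nonneg_pos)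
    then have d: "0 < d" using that by (simp add: d_def)
    obtain V where V: "open V" "0 \<in> V" "\<And>x v. v \<in> V \<Longrightarrow> cmod (k (x + v) - k x) \<le> d"
      using cts_uniform[OF k d] by blast
    have "cmod (conv k (F n) (x + v) - conv k (F n) x) \<le> e" if "v \<in> V" for n x v
    proof -
      have "conv k (F n) (x + v) - conv k (F n) x =
          ip (F n) (\<lambda>y. cnj (k (- y + (x + v))) - cnj (k (- y + x)))"
        unfolding conv_eq_ip
        by (intro ip_diff_right[symmetric] continuous_on_cnj cts_kernel k F)
      also have "cmod \<dots> \<le> sqrt A * d"
      proof (intro ip_bound F continuous_on_diff continuous_on_cnj cts_kernel k)
        show "cmod (cnj (k (- y + (x + v))) - cnj (k (- y + x))) \<le> d" for y
          using V(3)[OF that, of "- y + x"]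
          by (simp add: add.assoc flip: complex_cnj_diff)
      qed (use d in simp)
      also have "\<dots> \<le> (sqrt A + 1) * d" using d by (intro mult_right_mono) auto
      also have "\<dots> = e" using sA by (simp add: d_def)
      finally show ?thesis .
    qed
    then show ?thesis using V by blast
  qed
  \<comment> \<open>Finitely many translates of \<open>V\<close> by dense points \<open>q\<close>
    cover the group, so one threshold serves them all. Each \<open>x\<close> is then compared with
    such a \<open>q\<close>: two errors from equicontinuity and one from the Cauchy property at
    \<open>q\<close>. The conjunct \<open>True\<close> fits the statement to
    \<open>uniformly_convergent_eq_cauchy\<close> with the predicate that is true on the whole
    group.\<close>
  have cauchy: "\<exists>N. \<forall>m n x. N \<le> m \<and> N \<le> n \<and> True \<longrightarrow>
      dist (conv k (F (s m)) x) (conv k (F (s n)) x) < e" if "0 < e" for e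
  proof -
    have "0 < e / 4" using that by simp
    from equi[OF this] obtain V where V: "open V" "0 \<in> V"
      and Ve: "\<And>n x v. v \<in> V \<Longrightarrow> cmod (conv k (F n) (x + v) - conv k (F n) x) \<le> e / 4"
      by blast
    have op: "open ((\<lambda>x. - q + x) -` V)" for q :: 'g
      by (intro open_vimage V continuous_intros)
    have "UNIV \<subseteq> (\<Union>q\<in>Q. (\<lambda>x. - q + x) -` V)"
    proof
      fix x
      have "open ((\<lambda>q. - q + x) -` V)" by (intro open_vimage V continuous_intros)
      moreover have "x \<in> (\<lambda>q. - q + x) -` V" using V by simp
      ultimately obtain q where "q \<in> Q" "q \<in> (\<lambda>q. - q + x) -` V" using Q(2) by blast
      then show "x \<in> (\<Union>q\<in>Q. (\<lambda>x. - q + x) -` V)" by auto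
    qed
    then obtain T where T: "T \<subseteq> Q" "finite T" "UNIV \<subseteq> (\<Union>q\<in>T. (\<lambda>x. - q + x) -` V)"
      using compactE_image[OF compact_group, of Q "\<lambda>q. (\<lambda>x. - q + x) -` V"] op by metis
    have "\<exists>M. \<forall>m\<ge>M. \<forall>n\<ge>M. dist (conv k (F (s m)) q) (conv k (F (s n)) q) < e / 4" if "q \<in> Q" for q
    proof -
      have "Cauchy (\<lambda>n. conv k (F (s n)) q)"
        using s(2)[OF that] convergent_eq_Cauchy by blast
      then show ?thesis using \<open>0 < e\<close> unfolding Cauchy_def by (meson divide_pos_pos zero_less_numeral)
    qed
    then obtain M where M: "\<And>q m n. q \<in> Q \<Longrightarrow> M q \<le> m \<Longrightarrow> M q \<le> n \<Longrightarrow>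
        dist (conv k (F (s m)) q) (conv k (F (s n)) q) < e / 4" by metis
    have "dist (conv k (F (s m)) x) (conv k (F (s n)) x) < e"
      if m: "Max (M ` T) \<le> m" and n: "Max (M ` T) \<le> n" for m n x
    proof -
      obtain q where q: "q \<in> T" "- q + x \<in> V" using T(3) by blast
      have Mq: "M q \<le> Max (M ` T)" using q T by simp
      have 1: "dist (conv k (F (s i)) x) (conv k (F (s i)) q) \<le> e / 4" for i
        using Ve[OF q(2), of "s i" q] by (simp add: dist_norm)
      have 2: "dist (conv k (F (s m)) q) (conv k (F (s n)) q) < e / 4"
        using M[of q m n] Mq m n q T by auto
      show ?thesis
        using 1[of m] 1[of n] 2 \<open>0 < e\<close>
          dist_triangle[of "conv k (F (s m)) x" "conv k (F (s n)) x" "conv k (F (s m)) q"]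
          dist_triangle[of "conv k (F (s m)) q" "conv k (F (s n)) x" "conv k (F (s n)) q"]
        by (simp add: dist_commute)
    qed
    then show ?thesis by blast
  qed
  then obtain g where g: "\<And>e. 0 < e \<Longrightarrow> \<exists>N. \<forall>n x. N \<le> n \<and> True \<longrightarrow> dist (conv k (F (s n)) x) (g x) < e"
    using uniformly_convergent_eq_cauchy[of "\<lambda>x. True" "\<lambda>n. conv k (F (s n))"] by auto
  have lim: "uniform_limit UNIV (\<lambda>n. conv k (F (s n))) g sequentially"
    using g by (auto simp: uniform_limit_sequentially_iff)
  have "cts g"
    by (rule uniform_limit_theorem[OF always_eventually lim]) (intro allI cts_conv k F, simp)
  then show thesis using that s(1) lim by blast
qed

lemma conv_uniform_limit:
  assumes k: "cts k" and F: "\<And>n. cts (F n)" "cts g"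
    and lim: "(\<lambda>n. nsq (\<lambda>x. F n x - g x)) \<longlonglongrightarrow> 0"
  shows "uniform_limit UNIV (\<lambda>n. conv k (F n)) (conv k g) sequentially"
proof -
  obtain B where B: "\<And>x. cmod (k x) \<le> B" "0 \<le> B" using cts_bounded[OF k] by metis
  have "(\<lambda>n. sqrt (nsq (\<lambda>x. F n x - g x)) * B) \<longlonglongrightarrow> sqrt 0 * B"
    by (intro tendsto_intros lim)
  moreover have "dist (conv k (F n) x) (conv k g x) \<le> sqrt (nsq (\<lambda>x. F n x - g x)) * B" for n x
    using conv_bound[OF k continuous_on_diff[OF F(1) F(2)] B, of n x]
    by (simp add: dist_norm conv_diff k F)
  ultimately show ?thesis
    by (auto simp: uniform_limit_iff elim!: eventually_mono[OF order_tendstoD(2)] intro: le_less_trans)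
qed

end

section \<open>Invariant spaces of eigenfunctions\<close>

context haar_group
begin

definition fun_subspace :: "('g \<Rightarrow> complex) set \<Rightarrow> bool" where
  "fun_subspace S \<longleftrightarrow> (\<forall>f\<in>S. cts f) \<and> (\<lambda>x. 0) \<in> S \<and>
     (\<forall>f\<in>S. \<forall>g\<in>S. (\<lambda>x. f x + g x) \<in> S) \<and> (\<forall>c. \<forall>f\<in>S. (\<lambda>x. c * f x) \<in> S)"

definition translation_invariant :: "('g \<Rightarrow> complex) set \<Rightarrow> bool" where
  "translation_invariant S \<longleftrightarrow> (\<forall>f\<in>S. \<forall>a. (\<lambda>x. f (a + x)) \<in> S)"

lemma fun_subspaceD:
  assumes "fun_subspace S"
  shows "f \<in> S \<Longrightarrow> cts f" "(\<lambda>x. 0) \<in> S" "f \<in> S \<Longrightarrow> g \<in> S \<Longrightarrow> (\<lambda>x. f x + g x) \<in> S"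
    "f \<in> S \<Longrightarrow> (\<lambda>x. c * f x) \<in> S" "f \<in> S \<Longrightarrow> g \<in> S \<Longrightarrow> (\<lambda>x. f x - g x) \<in> S"
proof -
  show *: "f \<in> S \<Longrightarrow> cts f" "(\<lambda>x. 0) \<in> S" "f \<in> S \<Longrightarrow> g \<in> S \<Longrightarrow> (\<lambda>x. f x + g x) \<in> S"
    "f \<in> S \<Longrightarrow> (\<lambda>x. c * f x) \<in> S" for f g c
    using assms unfolding fun_subspace_def by auto
  show "f \<in> S \<Longrightarrow> g \<in> S \<Longrightarrow> (\<lambda>x. f x - g x) \<in> S"
    using *(3)[of f "\<lambda>x. - 1 * g x"] *(4)[of g "- 1"] by simp
qed

lemma fun_subspace_sum:
  assumes "fun_subspace S" "\<And>i. i \<in> I \<Longrightarrow> f i \<in> S"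
  shows "(\<lambda>x. \<Sum>i\<in>I. f i x) \<in> S"
  using assms(2)
proof (induction I rule: infinite_finite_induct)
  case (insert a I)
  then show ?case using fun_subspaceD(3)[OF assms(1), of "f a" "\<lambda>x. \<Sum>i\<in>I. f i x"] by simp
qed (auto intro: fun_subspaceD(2)[OF assms(1)])

text \<open>The square of the convolution operator is used because its eigenvalue is found as the square
  of the operator norm, which avoids locating the sign of an eigenvalue of the operator itself.\<close>

lemma exists_eigenfunction:
  assumes k: "cts k" "\<And>x. k (- x) = cnj (k x)"
    and N: "fun_subspace N" and NT: "\<And>f. f \<in> N \<Longrightarrow> conv k f \<in> N"
    and closed: "\<And>F g. (\<And>n. F n \<in> N) \<Longrightarrow> cts g \<Longrightarrow> uniform_limit UNIV F g sequentially \<Longrightarrow> g \<in> N"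
    and nz: "\<exists>f\<in>N. conv k f \<noteq> (\<lambda>x. 0)"
  obtains s u where "0 < s" "u \<in> N" "u \<noteq> (\<lambda>x. 0)"
    "conv k (conv k u) = (\<lambda>x. complex_of_real s * u x)"
proof -
  note ctsN = fun_subspaceD(1)[OF N]
  obtain B where B: "\<And>x. cmod (k x) \<le> B" "0 \<le> B" using cts_bounded[OF k(1)] by metis
  \<comment> \<open>The supremum \<open>s\<close> of these values is the square of the norm of the
    operator on \<open>N\<close>, computed with L^2 norms; by homogeneity it yields
    \<open>upper\<close>.\<close>
  define V where "V = {nsq (conv k f) | f. f \<in> N \<and> nsq f \<le> 1}"
  define s where "s = Sup V"
  have bdd: "bdd_above V"
  proof (rule bdd_aboveI)
    fix v assume "v \<in> V"
    then obtain f where f: "v = nsq (conv k f)" "f \<in> N" "nsq f \<le> 1" by (auto simp: V_def)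
    have "cmod (conv k f x) \<le> B" for x
      using conv_bound[OF k(1) ctsN[OF f(2)] B, of x] f(3) B(2)
        mult_right_mono[of "sqrt (nsq f)" 1 B] by simp
    then show "v \<le> B\<^sup>2" unfolding f using B by (intro nsq_le) auto
  qed
  have upper: "nsq (conv k f) \<le> s * nsq f" if f: "f \<in> N" for f
  proof (cases "nsq f = 0")
    case True
    then have "f = (\<lambda>x. 0)" using nsq_eq_0 ctsN f by blast
    then show ?thesis by simp
  next
    case False
    then have pos: "0 < nsq f" using nsq_nonneg[of f] by linarith
    let ?c = "complex_of_real (1 / sqrt (nsq f))"
    have c2: "(cmod ?c)\<^sup>2 = 1 / nsq f"
      using pos by (simp add: norm_divide power_divide del: of_real_divide)
    have "nsq (\<lambda>x. ?c * f x) \<le> 1" unfolding nsq_scale c2 using pos by simp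
    then have "nsq (conv k (\<lambda>x. ?c * f x)) \<in> V"
      using fun_subspaceD(4)[OF N f, of ?c] unfolding V_def by blast
    then have "nsq (conv k (\<lambda>x. ?c * f x)) \<le> s" unfolding s_def by (intro cSup_upper bdd)
    then have "1 / nsq f * nsq (conv k f) \<le> s" unfolding conv_scale nsq_scale c2 .
    then show ?thesis using pos by (simp add: field_simps)
  qed
  obtain f0 where f0: "f0 \<in> N" "conv k f0 \<noteq> (\<lambda>x. 0)" using nz by auto
  have "nsq (conv k f0) \<noteq> 0" using f0 nsq_eq_0 cts_conv[OF k(1)] ctsN by blast
  then have "0 < s * nsq f0" using upper[OF f0(1)] nsq_nonneg[of "conv k f0"] by linarith
  then have s: "0 < s" using nsq_nonneg[of f0] by (metis mult_nonpos_nonneg not_le)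
  have "nsq (conv k (\<lambda>x. 0)) \<in> V" unfolding V_def using fun_subspaceD(2)[OF N] by force
  then have "V \<noteq> {}" by auto
  then have "\<exists>v\<in>V. s - 1 / Suc n < v" for n
    using less_cSup_iff[OF _ bdd, of "s - 1 / Suc n"] by (auto simp: s_def)
  then have "\<forall>n. \<exists>f. f \<in> N \<and> nsq f \<le> 1 \<and> s - 1 / Suc n < nsq (conv k f)"
    unfolding V_def by blast
  from choice[OF this]
  obtain f where fall: "\<forall>n. f n \<in> N \<and> nsq (f n) \<le> 1 \<and> s - 1 / Suc n < nsq (conv k (f n))" ..
  then have f: "f n \<in> N" "nsq (f n) \<le> 1" "s - 1 / Suc n < nsq (conv k (f n))" for n
    by simp_all
  note cf = ctsN[OF f(1)]
  obtain t u where t: "strict_mono t" and u: "cts u"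
    and lim: "uniform_limit UNIV (\<lambda>n. conv k (f (t n))) u sequentially"
    by (rule conv_compact[OF k(1) cf f(2)])
  have uN: "u \<in> N" by (rule closed[OF _ u lim]) (intro NT f)
  have t_le: "nsq (conv k (f n)) \<le> s" for n
  proof -
    have "s * nsq (f n) \<le> s * 1" using f(2) s by (intro mult_left_mono) auto
    then show ?thesis using upper[OF f(1), of n] by simp
  qed
  have lim_s: "(\<lambda>n. nsq (conv k (f (t n)))) \<longlonglongrightarrow> s"
  proof (rule tendsto_sandwich[of "\<lambda>n. s - 1 / Suc n"])
    have "(\<lambda>n. s - 1 / Suc n) \<longlonglongrightarrow> s - 0"
      by (intro tendsto_intros LIMSEQ_Suc[OF lim_1_over_n])
    then show "(\<lambda>n. s - 1 / Suc n) \<longlonglongrightarrow> s" by simp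
    have "s - 1 / Suc n \<le> nsq (conv k (f (t n)))" for n
    proof -
      have "1 / real (Suc (t n)) \<le> 1 / real (Suc n)"
        using strict_mono_imp_increasing[OF t] by (intro divide_left_mono) auto
      then show ?thesis using f(3)[of "t n"] by linarith
    qed
    then show "\<forall>\<^sub>F n in sequentially. s - 1 / Suc n \<le> nsq (conv k (f (t n)))" by simp
  qed (use t_le in auto)
  have "u \<noteq> (\<lambda>x. 0)"
  proof
    assume "u = (\<lambda>x. 0)"
    then have "(\<lambda>n. nsq (conv k (f (t n)))) \<longlonglongrightarrow> 0"
      using nsq_tendsto_0[OF lim cts_conv[OF k(1) cf] u] by simp
    then show False using LIMSEQ_unique[OF lim_s] s by blast
  qed
  moreover
  let ?T = "conv k"
  \<comment> \<open>The maximising \<open>f (t n)\<close> need not converge; only their images do,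
    with limit \<open>u\<close>. Expanding the square bounds \<open>nsq (D n)\<close> by
    \<open>s * (s - nsq (?T (f (t n))))\<close>, which tends to 0. Applying \<open>?T\<close> once
    more expresses everything through the convergent images and gives the eigenvalue equation for
    \<open>u\<close>.\<close>
  define D where "D n = (\<lambda>x. ?T (?T (f (t n))) x - complex_of_real s * f (t n) x)" for n
  have cD: "cts (D n)" for n
    unfolding D_def by (intro continuous_on_diff continuous_on_mult continuous_on_const cts_conv k cf)
  have D0: "(\<lambda>n. nsq (\<lambda>x. D n x - 0)) \<longlonglongrightarrow> 0"
  proof (rule tendsto_sandwich[of "\<lambda>n. 0"])
    have "(\<lambda>n. s * (s - nsq (?T (f (t n))))) \<longlonglongrightarrow> s * (s - s)"
      by (intro tendsto_intros lim_s)
    then show "(\<lambda>n. s * (s - nsq (?T (f (t n))))) \<longlonglongrightarrow> 0" by simp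
    have "nsq (D n) \<le> s * (s - nsq (?T (f (t n))))" for n
    proof -
      let ?f = "f (t n)"
      have "ip (?T (?T ?f)) ?f = complex_of_real (nsq (?T ?f))"
        using conv_symmetric[OF k cts_conv[OF k(1) cf] cf, of "t n" "t n"] by (simp add: ip_self)
      then have "nsq (D n) = nsq (?T (?T ?f)) - 2 * (s * nsq (?T ?f)) + s\<^sup>2 * nsq ?f"
        unfolding D_def
        by (subst nsq_diff_scale) (auto intro!: cts_conv k cf)
      also have "\<dots> \<le> s * nsq (?T ?f) - 2 * (s * nsq (?T ?f)) + s\<^sup>2 * 1"
        using upper[OF NT[OF f(1)]] f(2) s by (intro add_mono diff_mono mult_left_mono) auto
      finally show ?thesis by (simp add: algebra_simps power2_eq_square)
    qed
    then show "\<forall>\<^sub>F n in sequentially. nsq (\<lambda>x. D n x - 0) \<le> s * (s - nsq (?T (f (t n))))" by simp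
  qed auto
  have "?T (?T u) = (\<lambda>x. complex_of_real s * u x)"
  proof
    fix x
    have "uniform_limit UNIV (\<lambda>n. ?T (D n)) (?T (\<lambda>x. 0)) sequentially"
      by (rule conv_uniform_limit[OF k(1) cD _ D0]) simp
    from tendsto_uniform_limitI[OF this, of x]
    have 1: "(\<lambda>n. ?T (D n) x) \<longlonglongrightarrow> 0" by simp
    have c1: "cts (?T (f (t n)))" "cts (?T (?T (f (t n))))" for n by (intro cts_conv k cf)+
    have l2: "uniform_limit UNIV (\<lambda>n. ?T (?T (f (t n)))) (?T u) sequentially"
      by (rule conv_uniform_limit[OF k(1) c1(1) u nsq_tendsto_0[OF lim c1(1) u]])
    have "uniform_limit UNIV (\<lambda>n. ?T (?T (?T (f (t n))))) (?T (?T u)) sequentially"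
      by (rule conv_uniform_limit[OF k(1) c1(2) cts_conv[OF k(1) u]
            nsq_tendsto_0[OF l2 c1(2) cts_conv[OF k(1) u]]])
    then have "(\<lambda>n. ?T (?T (?T (f (t n)))) x) \<longlonglongrightarrow> ?T (?T u) x"
      by (rule tendsto_uniform_limitI) simp
    moreover have "(\<lambda>n. ?T (f (t n)) x) \<longlonglongrightarrow> u x"
      using lim by (rule tendsto_uniform_limitI) simp
    ultimately have "(\<lambda>n. ?T (?T (?T (f (t n)))) x - complex_of_real s * ?T (f (t n)) x)
        \<longlonglongrightarrow> ?T (?T u) x - complex_of_real s * u x"
      by (intro tendsto_intros)
    moreover have "?T (D n) x = ?T (?T (?T (f (t n)))) x - complex_of_real s * ?T (f (t n)) x" for n
    proof -
      have "cts (\<lambda>x. complex_of_real s * f (t n) x)" by (intro continuous_intros cf)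
      then show ?thesis unfolding D_def by (simp add: conv_diff c1 k conv_scale)
    qed
    ultimately have "(\<lambda>n. ?T (D n) x) \<longlonglongrightarrow> ?T (?T u) x - complex_of_real s * u x"
      by (simp only:)
    from LIMSEQ_unique[OF this 1] have "?T (?T u) x - complex_of_real s * u x = 0" .
    then show "?T (?T u) x = complex_of_real s * u x" by simp
  qed
  ultimately show thesis using that s uN by blast
qed

section \<open>Orthonormal systems and finite-dimensional invariant spaces\<close>

definition orthonormal :: "nat \<Rightarrow> (nat \<Rightarrow> 'g \<Rightarrow> complex) \<Rightarrow> bool" where
  "orthonormal m g \<longleftrightarrow> (\<forall>i<m. cts (g i)) \<and> (\<forall>i<m. \<forall>j<m. ip (g i) (g j) = (if i = j then 1 else 0))"

lemma orthonormalD: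
  assumes "orthonormal m g"
  shows "i < m \<Longrightarrow> cts (g i)" "i < m \<Longrightarrow> j < m \<Longrightarrow> ip (g i) (g j) = (if i = j then 1 else 0)"
  using assms by (auto simp: orthonormal_def)

lemma cts_combination: "(\<And>i. i < m \<Longrightarrow> cts (g i)) \<Longrightarrow> cts (\<lambda>x. \<Sum>i<m. c i * g i x)"
  for g :: "nat \<Rightarrow> 'g \<Rightarrow> complex"
  by (intro continuous_on_sum continuous_on_mult continuous_on_const) auto

lemma ip_combination:
  assumes "orthonormal m g" "j < m"
  shows "ip (\<lambda>x. \<Sum>i<m. c i * g i x) (g j) = c j"
proof -
  have "ip (\<lambda>x. \<Sum>i<m. c i * g i x) (g j) = (\<Sum>i<m. c i * ip (g i) (g j))"
    using orthonormalD[OF assms(1)] assms(2)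
    by (subst ip_sum_left) (auto intro!: continuous_intros simp: ip_scale_left)
  also have "\<dots> = (\<Sum>i<m. if i = j then c i else 0)"
    using orthonormalD(2)[OF assms(1)] assms(2) by (intro sum.cong) auto
  finally show ?thesis using assms(2) by simp
qed

lemma bessel:
  assumes g: "orthonormal m g" and h: "cts h"
  shows "(\<Sum>i<m. (cmod (ip h (g i)))\<^sup>2) \<le> nsq h"
proof -
  define p where "p = (\<lambda>x. \<Sum>i<m. ip h (g i) * g i x)"
  have cp: "cts p" unfolding p_def by (intro cts_combination orthonormalD[OF g])
  have expand: "ip q p = (\<Sum>i<m. cnj (ip h (g i)) * ip q (g i))" if "cts q" for q
    unfolding p_def using that orthonormalD[OF g]
    by (subst ip_sum_right) (auto intro!: continuous_intros simp: ip_scale_right)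
  have S: "cnj z * z = complex_of_real ((cmod z)\<^sup>2)" for z
    using complex_norm_square[of z] by (simp add: mult.commute)
  have hp: "ip h p = complex_of_real (\<Sum>i<m. (cmod (ip h (g i)))\<^sup>2)"
    unfolding expand[OF h] S by simp
  have "ip p p = (\<Sum>i<m. cnj (ip h (g i)) * ip h (g i))"
    unfolding expand[OF cp] by (intro sum.cong) (auto simp: p_def ip_combination[OF g])
  then have pp: "ip p p = complex_of_real (\<Sum>i<m. (cmod (ip h (g i)))\<^sup>2)" unfolding S by simp
  have "nsq p = (\<Sum>i<m. (cmod (ip h (g i)))\<^sup>2)"
    using pp unfolding ip_self of_real_eq_iff .
  then have "nsq (\<lambda>x. h x - 1 * p x) = nsq h - (\<Sum>i<m. (cmod (ip h (g i)))\<^sup>2)"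
    unfolding nsq_diff_scale[OF h cp] by (simp add: hp del: of_real_sum)
  then show ?thesis using nsq_nonneg[of "\<lambda>x. h x - 1 * p x"] by linarith
qed

text \<open>Writing the value at \<open>x\<close> as an inner product with the kernel function
  \<open>kx\<close> and using symmetry, \<open>s * g i x\<close> is up to conjugation the inner
  product of \<open>conv k kx\<close> with \<open>g i\<close>. Bessel's inequality bounds the sum of
  the |g_i(x)|^2 independently of \<open>m\<close> and \<open>x\<close>; its integral is
  \<open>m\<close>.\<close>

lemma eigenspace_bounded_dim:
  assumes k: "cts k" "\<And>x. k (- x) = cnj (k x)" and s: "0 < s"
  shows "\<exists>K. \<forall>m g. orthonormal m g \<longrightarrow>
    (\<forall>i<m. conv k (conv k (g i)) = (\<lambda>x. complex_of_real s * g i x)) \<longrightarrow> m \<le> K"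
proof -
  obtain B where B: "\<And>x. cmod (k x) \<le> B" "0 \<le> B" using cts_bounded[OF k(1)] by metis
  have "real m \<le> (B * B)\<^sup>2 / s\<^sup>2" if g: "orthonormal m g"
    and ev: "\<forall>i<m. conv k (conv k (g i)) = (\<lambda>x. complex_of_real s * g i x)" for m g
  proof -
    note cg = orthonormalD(1)[OF g]
    have pt: "(\<Sum>i<m. (cmod (g i x))\<^sup>2) \<le> (B * B)\<^sup>2 / s\<^sup>2" for x
    proof -
      define kx where "kx = (\<lambda>y. cnj (k (- y + x)))"
      have ckx: "cts kx" unfolding kx_def by (intro continuous_on_cnj cts_kernel k)
      have nkx: "sqrt (nsq kx) \<le> B"
        using nsq_le[of kx B] B real_sqrt_le_mono by (fastforce simp: kx_def)
      have bnd: "cmod (conv k kx y) \<le> B * B" for y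
        using order_trans[OF conv_bound[OF k(1) ckx B] mult_right_mono[OF nkx B(2)]] .
      have "complex_of_real s * g i x = cnj (ip (conv k kx) (g i))" if "i < m" for i
      proof -
        have "complex_of_real s * g i x = conv k (conv k (g i)) x" using ev that by simp
        also have "\<dots> = ip (conv k (g i)) kx" unfolding kx_def by (rule conv_eq_ip)
        also have "\<dots> = ip (g i) (conv k kx)"
          by (rule conv_symmetric[OF k cg[OF that] ckx])
        finally show ?thesis by (simp add: ip_commute[of "g i"])
      qed
      then have "cmod (complex_of_real s * g i x) = cmod (ip (conv k kx) (g i))" if "i < m" for i
        using that by (metis complex_mod_cnj)
      then have "s * cmod (g i x) = cmod (ip (conv k kx) (g i))" if "i < m" for i
        using that s by (simp add: norm_mult)
      then have "s\<^sup>2 * (\<Sum>i<m. (cmod (g i x))\<^sup>2) = (\<Sum>i<m. (cmod (ip (conv k kx) (g i)))\<^sup>2)"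
        unfolding sum_distrib_left by (intro sum.cong) (auto simp: power_mult_distrib[symmetric])
      also have "\<dots> \<le> nsq (conv k kx)" by (intro bessel g cts_conv k ckx)
      also have "\<dots> \<le> (B * B)\<^sup>2" using B by (intro nsq_le bnd) auto
      finally show ?thesis using s by (simp add: field_simps)
    qed
    have "nsq (g i) = 1" if "i < m" for i
      using orthonormalD(2)[OF g that that] unfolding ip_self by simp
    then have "real m = (\<Sum>i<m. nsq (g i))" by simp
    also have "\<dots> = (LINT x|\<mu>. (\<Sum>i<m. (cmod (g i x))\<^sup>2))"
      unfolding nsq_def by (intro Bochner_Integration.integral_sum[symmetric] integrable_nsq cg) auto
    also have "\<dots> \<le> (LINT x|\<mu>. (B * B)\<^sup>2 / s\<^sup>2)"
      by (intro integral_mono pt integrable_const Bochner_Integration.integrable_sum integrable_nsq cg) auto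
    finally show ?thesis by simp
  qed
  moreover have "m \<le> nat \<lceil>(B * B)\<^sup>2 / s\<^sup>2\<rceil>" if "real m \<le> (B * B)\<^sup>2 / s\<^sup>2" for m
    using that by linarith
  ultimately show ?thesis by blast
qed

text \<open>On a space satisfying \<open>fun_subspace\<close> this says that the dimension is at
  least \<open>m\<close>; it plays the part of the dimension in the arguments that follow.\<close>

definition orthonormal_in :: "('g \<Rightarrow> complex) set \<Rightarrow> nat \<Rightarrow> bool" where
  "orthonormal_in S m \<longleftrightarrow> (\<exists>g. orthonormal m g \<and> (\<forall>i<m. g i \<in> S))"

text \<open>A nonzero residual of \<open>f\<close> after projection would, once normalised, extend
  the system by one element of \<open>S\<close>.\<close>

lemma maximal_orthonormal_spans:
  assumes S: "fun_subspace S" and g: "orthonormal m g" "\<forall>i<m. g i \<in> S"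
    and maximal: "\<not> orthonormal_in S (Suc m)" and f: "f \<in> S"
  shows "f = (\<lambda>x. \<Sum>i<m. ip f (g i) * g i x)"
proof (rule ccontr)
  assume neq: "\<not> ?thesis"
  define p where "p = (\<lambda>x. \<Sum>i<m. ip f (g i) * g i x)"
  define d where "d = (\<lambda>x. f x - p x)"
  have cf: "cts f" using fun_subspaceD(1)[OF S f] .
  have cp: "cts p" unfolding p_def by (intro cts_combination orthonormalD[OF g(1)])
  have "p \<in> S" unfolding p_def
    by (rule fun_subspace_sum[OF S, of "{..<m}" "\<lambda>i x. ip f (g i) * g i x"])
      (use g fun_subspaceD(4)[OF S] in auto)
  then have dS: "d \<in> S" unfolding d_def by (intro fun_subspaceD(5)[OF S] f)
  have cd: "cts d" using fun_subspaceD(1)[OF S dS] .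
  have dg: "ip d (g i) = 0" if "i < m" for i
    unfolding d_def using that cf cp orthonormalD(1)[OF g(1)]
    by (simp add: ip_diff_left p_def ip_combination[OF g(1)])
  have "d \<noteq> (\<lambda>x. 0)" using neq unfolding d_def p_def by (auto simp: fun_eq_iff)
  then have "nsq d \<noteq> 0" using nsq_eq_0 cd by blast
  then have pos: "0 < nsq d" using nsq_nonneg[of d] by linarith
  define e where "e = (\<lambda>x. complex_of_real (1 / sqrt (nsq d)) * d x)"
  have "ip e e = 1"
    unfolding e_def ip_scale_left ip_scale_right ip_self using pos
    by (simp add: power2_eq_square[symmetric] flip: of_real_mult of_real_power)
  moreover have "ip e (g i) = 0" "ip (g i) e = 0" if "i < m" for i
    unfolding e_def ip_scale_left ip_scale_right using dg[OF that] ip_commute[of "g i" d] by simp_all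
  moreover have "e \<in> S" unfolding e_def by (intro fun_subspaceD(4)[OF S] dS)
  moreover have "cts e" using fun_subspaceD(1)[OF S \<open>e \<in> S\<close>] .
  ultimately have "orthonormal (Suc m) (g(m := e))" "\<forall>i<Suc m. (g(m := e)) i \<in> S"
    using g by (auto simp: orthonormal_def less_Suc_eq)
  then show False using maximal by (auto simp: orthonormal_in_def)
qed

lemma orthonormal_in_mono: "orthonormal_in S n \<Longrightarrow> m \<le> n \<Longrightarrow> orthonormal_in S m"
proof -
  assume "orthonormal_in S n" "m \<le> n"
  then obtain g where g: "orthonormal n g" "\<forall>i<n. g i \<in> S" by (auto simp: orthonormal_in_def)
  have "orthonormal m g"
    unfolding orthonormal_def using g(1)[unfolded orthonormal_def] \<open>m \<le> n\<close> by simp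
  then show "orthonormal_in S m" unfolding orthonormal_in_def using g(2) \<open>m \<le> n\<close> by fastforce
qed

lemma exists_orthonormal_basis:
  assumes S: "fun_subspace S" and K: "\<And>m. orthonormal_in S m \<Longrightarrow> m \<le> K"
  obtains m g where "orthonormal m g" "\<forall>i<m. g i \<in> S" "\<not> orthonormal_in S (Suc m)"
    "\<forall>f\<in>S. f = (\<lambda>x. \<Sum>i<m. ip f (g i) * g i x)"
proof -
  have 0: "orthonormal_in S 0" by (simp add: orthonormal_in_def orthonormal_def)
  define m where "m = Greatest (orthonormal_in S)"
  have "orthonormal_in S m" unfolding m_def by (rule GreatestI_nat[of "orthonormal_in S" 0 K, OF 0 K])
  then obtain g where g: "orthonormal m g" "\<forall>i<m. g i \<in> S" by (auto simp: orthonormal_in_def)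
  have mx: "\<not> orthonormal_in S (Suc m)"
  proof
    assume "orthonormal_in S (Suc m)"
    then have "Suc m \<le> m" unfolding m_def by (rule Greatest_le_nat[of "orthonormal_in S" _ K, OF _ K])
    then show False by simp
  qed
  have "\<forall>f\<in>S. f = (\<lambda>x. \<Sum>i<m. ip f (g i) * g i x)"
    using maximal_orthonormal_spans[OF S g mx] by blast
  then show thesis by (rule that[OF g mx])
qed

text \<open>Take a nonzero invariant subspace \<open>S\<close> whose dimension bound is least
  possible. A nonzero invariant \<open>S'\<close> inside it has an orthonormal basis of some size
  \<open>m\<close>, and leastness forbids systems of size \<open>Suc m\<close> in \<open>S\<close>;
  so the basis of \<open>S'\<close> already spans \<open>S\<close>.\<close>

lemma exists_minimal_invariant_subspace:
  assumes E: "fun_subspace E" "translation_invariant E" "E \<noteq> {\<lambda>x. 0}"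
    and K: "\<And>m. orthonormal_in E m \<Longrightarrow> m \<le> K"
  obtains S where "S \<subseteq> E" "fun_subspace S" "translation_invariant S" "S \<noteq> {\<lambda>x. 0}"
    "\<And>S'. S' \<subseteq> S \<Longrightarrow> fun_subspace S' \<Longrightarrow> translation_invariant S' \<Longrightarrow> S' = {\<lambda>x. 0} \<or> S' = S"
proof -
  let ?Q = "\<lambda>S. S \<subseteq> E \<and> fun_subspace S \<and> translation_invariant S \<and> S \<noteq> {\<lambda>x. 0}"
  define P where "P m \<longleftrightarrow> (\<exists>S. ?Q S \<and> \<not> orthonormal_in S (Suc m))" for m
  have "\<not> orthonormal_in E (Suc K)" using K by fastforce
  then have "P K" unfolding P_def using E by blast
  then have "P (LEAST m. P m)" by (rule LeastI)
  then obtain S where S: "?Q S" "\<not> orthonormal_in S (Suc (LEAST m. P m))" unfolding P_def by blast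
  have "S' = S" if S': "S' \<subseteq> S" "fun_subspace S'" "translation_invariant S'" "S' \<noteq> {\<lambda>x. 0}" for S'
  proof -
    have KS: "\<And>m. orthonormal_in S' m \<Longrightarrow> m \<le> K"
      using K S S'(1) unfolding orthonormal_in_def by blast
    obtain m g where g: "orthonormal m g" "\<forall>i<m. g i \<in> S'" "\<not> orthonormal_in S' (Suc m)"
      "\<forall>f\<in>S'. f = (\<lambda>x. \<Sum>i<m. ip f (g i) * g i x)"
      by (rule exists_orthonormal_basis[OF S'(2) KS])
    have "P m" unfolding P_def using S' S g(3) by blast
    then have "(LEAST m. P m) \<le> m" by (rule Least_le)
    then have mx: "\<not> orthonormal_in S (Suc m)"
      using S(2) orthonormal_in_mono[of S "Suc m" "Suc (LEAST m. P m)"] by auto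
    have gS: "\<forall>i<m. g i \<in> S" using g S' by auto
    have "f \<in> S'" if "f \<in> S" for f
    proof -
      have "fun_subspace S" using S by blast
      from maximal_orthonormal_spans[OF this g(1) gS mx that]
      have "f = (\<lambda>x. \<Sum>i<m. ip f (g i) * g i x)" .
      moreover have "(\<lambda>x. \<Sum>i<m. ip f (g i) * g i x) \<in> S'"
        by (rule fun_subspace_sum[OF S'(2), of "{..<m}" "\<lambda>i x. ip f (g i) * g i x"])
          (use g(2) fun_subspaceD(4)[OF S'(2)] in auto)
      ultimately show ?thesis by simp
    qed
    then show ?thesis using S' by blast
  qed
  then show thesis using that[of S] S(1) by blast
qed

end

section \<open>Complex matrices\<close>

unbundle no vec_syntax

lemma index_mult_mat_sum:
  assumes "A \<in> carrier_mat n m" "B \<in> carrier_mat m k" "i < n" "j < k"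
  shows "(A * B) $$ (i, j) = (\<Sum>l<m. A $$ (i, l) * B $$ (l, j))"
  using assms by (simp add: scalar_prod_def atLeast0LessThan)

lemma index_mult_mat_vec_sum:
  assumes "A \<in> carrier_mat n m" "v \<in> carrier_vec m" "i < n"
  shows "(A *\<^sub>v v) $ i = (\<Sum>l<m. A $$ (i, l) * v $ l)"
  using assms by (simp add: scalar_prod_def atLeast0LessThan)

lemma mat_adjoint_carrier [simp]: "A \<in> carrier_mat n m \<Longrightarrow> mat_adjoint A \<in> carrier_mat m n"
  by (auto simp: mat_adjoint_def mat_of_rows_def)

lemma dim_mat_adjoint [simp]:
  "dim_row (mat_adjoint A) = dim_col A" "dim_col (mat_adjoint A) = dim_row A"
  by (auto simp: mat_adjoint_def mat_of_rows_def)

lemma index_mat_adjoint [simp]: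
  fixes A :: "complex mat"
  assumes "i < dim_col A" "j < dim_row A"
  shows "mat_adjoint A $$ (i, j) = cnj (A $$ (j, i))"
  using assms by (auto simp: mat_adjoint_def mat_of_rows_index)

lemma mat_adjoint_one [simp]: "mat_adjoint (1\<^sub>m n :: complex mat) = 1\<^sub>m n"
  by (rule eq_matI) auto

lemma mat_adjoint_mult:
  fixes A B :: "complex mat"
  assumes "A \<in> carrier_mat n m" "B \<in> carrier_mat m k"
  shows "mat_adjoint (A * B) = mat_adjoint B * mat_adjoint A"
proof (rule eq_matI)
  fix i j assume "i < dim_row (mat_adjoint B * mat_adjoint A)" "j < dim_col (mat_adjoint B * mat_adjoint A)"
  then have ij: "i < k" "j < n" using assms by auto
  have "mat_adjoint (A * B) $$ (i, j) = cnj (\<Sum>l<m. A $$ (j, l) * B $$ (l, i))"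
    using assms ij index_mult_mat_sum[OF assms ij(2,1)] by simp
  also have "\<dots> = (\<Sum>l<m. mat_adjoint B $$ (i, l) * mat_adjoint A $$ (l, j))"
    using assms ij by (simp add: mult.commute)
  also have "\<dots> = (mat_adjoint B * mat_adjoint A) $$ (i, j)"
    using assms ij by (subst index_mult_mat_sum[of _ k m _ n]) auto
  finally show "mat_adjoint (A * B) $$ (i, j) = (mat_adjoint B * mat_adjoint A) $$ (i, j)" .
qed (use assms in auto)

lemma mat_adjoint_adjoint [simp]: "mat_adjoint (mat_adjoint A) = (A :: complex mat)"
  by (rule eq_matI) auto

lemma subspace_carrier_vec_iff:
  fixes W :: "complex vec set"
  shows "VectorSpace.subspace class_ring W (module_vec TYPE(complex) d) \<longleftrightarrow>
    W \<subseteq> carrier_vec d \<and> 0\<^sub>v d \<in> W \<and> (\<forall>v\<in>W. \<forall>w\<in>W. v + w \<in> W) \<and> (\<forall>c. \<forall>v\<in>W. c \<cdot>\<^sub>v v \<in> W)"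
proof -
  have "vectorspace (class_ring :: complex ring) (module_vec TYPE(complex) d)" by (rule vec_vs)
  moreover from this have "module (class_ring :: complex ring) (module_vec TYPE(complex) d)"
    by (rule vectorspace.axioms)
  ultimately show ?thesis
    by (auto simp: VectorSpace.subspace_def submodule_def module_vec_simps)
qed

lemma unitary_mat_carrier: "unitary_mat d U \<Longrightarrow> U \<in> carrier_mat d d"
  by (simp add: unitary_mat_def)

lemma unitary_rep_carrier: "unitary_rep d \<xi> \<Longrightarrow> \<xi> x \<in> carrier_mat d d"
  by (auto simp: unitary_rep_def unitary_mat_def)

lemma unitary_repD:
  assumes "unitary_rep d \<xi>"
  shows "mat_adjoint (\<xi> x) * \<xi> x = 1\<^sub>m d" "\<xi> x * mat_adjoint (\<xi> x) = 1\<^sub>m d"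
    "\<xi> (x + y) = \<xi> x * \<xi> y"
    "i < d \<Longrightarrow> j < d \<Longrightarrow> continuous_on UNIV (\<lambda>x. \<xi> x $$ (i, j))"
  using assms by (auto simp: unitary_rep_def unitary_mat_def)

lemma unitary_rep_zero:
  assumes "unitary_rep d \<xi>"
  shows "\<xi> 0 = 1\<^sub>m d"
proof -
  note c = unitary_rep_carrier[OF assms, of 0]
  have "1\<^sub>m d = mat_adjoint (\<xi> 0) * (\<xi> 0 * \<xi> 0)"
    using unitary_repD(1)[OF assms, of 0] unitary_repD(3)[OF assms, of 0 0] by simp
  also have "\<dots> = (mat_adjoint (\<xi> 0) * \<xi> 0) * \<xi> 0"
    using c by (intro assoc_mult_mat[symmetric]) auto
  also have "\<dots> = \<xi> 0" unfolding unitary_repD(1)[OF assms] using c by simp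
  finally show ?thesis by simp
qed

lemma unitary_rep_minus:
  assumes "unitary_rep d \<xi>"
  shows "\<xi> (- x) = mat_adjoint (\<xi> x)"
proof -
  note c = unitary_rep_carrier[OF assms]
  have "\<xi> (- x) = \<xi> (- x) * (\<xi> x * mat_adjoint (\<xi> x))"
    unfolding unitary_repD(2)[OF assms] using c[of "- x"] by simp
  also have "\<dots> = (\<xi> (- x) * \<xi> x) * mat_adjoint (\<xi> x)"
    by (rule assoc_mult_mat[symmetric, OF c c mat_adjoint_carrier[OF c]])
  also have "\<xi> (- x) * \<xi> x = 1\<^sub>m d"
    using unitary_repD(3)[OF assms, of "- x" x] unitary_rep_zero[OF assms] by simp
  finally show ?thesis using c[of x] by simp
qed

text \<open>Schur's lemma: over the complex numbers \<open>C\<close> has an eigenvalue, its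
  eigenspace is invariant because \<open>C\<close> commutes with the representation, and by
  irreducibility it is everything.\<close>

lemma irreducible_commutant_scalar:
  assumes irr: "irreducible_unitary_rep d \<xi>" and C: "C \<in> carrier_mat d d"
    and comm: "\<And>x. \<xi> x * C = C * \<xi> x"
  shows "\<exists>c. C = c \<cdot>\<^sub>m 1\<^sub>m d"
proof -
  have d: "0 < d" and rep: "unitary_rep d \<xi>" using irr by (auto simp: irreducible_unitary_rep_def)
  note c = unitary_rep_carrier[OF rep]
  obtain e v where ev: "eigenvector C v e"
    using spectrum_non_empty[OF C d] by (auto simp: spectrum_def eigenvalue_def)
  define W where "W = {w \<in> carrier_vec d. C *\<^sub>v w = e \<cdot>\<^sub>v w}"
  have "VectorSpace.subspace class_ring W (module_vec TYPE(complex) d)"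
    unfolding subspace_carrier_vec_iff W_def using C
    by (auto simp: mult_add_distrib_mat_vec smult_add_distrib_vec mult_mat_vec smult_smult_assoc mult.commute)
  moreover have "\<xi> x *\<^sub>v w \<in> W" if "w \<in> W" for x w
  proof -
    have w: "w \<in> carrier_vec d" "C *\<^sub>v w = e \<cdot>\<^sub>v w" using that by (auto simp: W_def)
    have "C *\<^sub>v (\<xi> x *\<^sub>v w) = (C * \<xi> x) *\<^sub>v w"
      using C c w by (intro assoc_mult_mat_vec[symmetric])
    also have "\<dots> = \<xi> x *\<^sub>v (C *\<^sub>v w)"
      unfolding comm[symmetric] using C c w by (intro assoc_mult_mat_vec)
    also have "\<dots> = e \<cdot>\<^sub>v (\<xi> x *\<^sub>v w)"
      unfolding w(2) using c w by (intro mult_mat_vec)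
    finally show ?thesis using w c[of x] by (auto simp: W_def)
  qed
  ultimately have "W = {0\<^sub>v d} \<or> W = carrier_vec d"
    using irr unfolding irreducible_unitary_rep_def by blast
  moreover have "v \<in> W" "v \<noteq> 0\<^sub>v d" using ev C by (auto simp: eigenvector_def W_def)
  ultimately have W: "W = carrier_vec d" by blast
  have "C = e \<cdot>\<^sub>m 1\<^sub>m d"
  proof (rule eq_matI)
    fix i j assume "i < dim_row (e \<cdot>\<^sub>m 1\<^sub>m d)" "j < dim_col (e \<cdot>\<^sub>m 1\<^sub>m d)"
    then have ij: "i < d" "j < d" by auto
    have "unit_vec d j \<in> W" using W by simp
    then have "(C *\<^sub>v unit_vec d j) $ i = (e \<cdot>\<^sub>v unit_vec d j) $ i" by (simp add: W_def)
    then show "C $$ (i, j) = (e \<cdot>\<^sub>m 1\<^sub>m d) $$ (i, j)"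
      using ij C by (simp add: mult_mat_vec_def)
  qed (use C in auto)
  then show ?thesis by blast
qed

section \<open>Schur orthogonality\<close>

text \<open>Take adjoints in the relation at \<open>- x\<close>; unitarity turns the adjoint of
  \<xi>(- x) back into \<xi>(x), and likewise for \<eta>.\<close>

lemma intertwiner_adjoint:
  assumes \<xi>: "unitary_rep n \<xi>" and \<eta>: "unitary_rep m \<eta>" and B: "B \<in> carrier_mat n m"
    and inter: "\<And>x. \<xi> x * B = B * \<eta> x"
  shows "\<eta> x * mat_adjoint B = mat_adjoint B * \<xi> x"
proof -
  note c\<xi> = unitary_rep_carrier[OF \<xi>] and c\<eta> = unitary_rep_carrier[OF \<eta>]
  have "mat_adjoint (\<xi> (- x) * B) = mat_adjoint (B * \<eta> (- x))" by (simp only: inter)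
  then show ?thesis
    unfolding mat_adjoint_mult[OF c\<xi> B] mat_adjoint_mult[OF B c\<eta>]
    by (simp add: unitary_rep_minus[OF \<xi>] unitary_rep_minus[OF \<eta>])
qed

text \<open>The products of \<open>B\<close> with its adjoint commute with irreducible
  representations, so they are scalars \<open>a\<close> and \<open>b\<close>. A nonzero
  \<open>B\<close> has \<open>a \<noteq> 0\<close>, and the triple product of \<open>B\<close>, its
  adjoint and \<open>B\<close>, bracketed in two ways, gives \<open>a = b\<close>. Summing the
  squared moduli of all entries by rows and by columns gives n a = m b, hence \<open>n = m\<close>;
  the inverse is the adjoint divided by \<open>a\<close>.\<close>

lemma intertwiner_eq_zero_or_invertible:
  assumes \<xi>: "irreducible_unitary_rep n \<xi>" and \<eta>: "irreducible_unitary_rep m \<eta>"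
    and B: "B \<in> carrier_mat n m" and inter: "\<And>x. \<xi> x * B = B * \<eta> x"
  shows "B = 0\<^sub>m n m \<or> n = m \<and> invertible_mat B"
proof (cases "B = 0\<^sub>m n m")
  case False
  have r\<xi>: "unitary_rep n \<xi>" and r\<eta>: "unitary_rep m \<eta>" and "0 < n" "0 < m"
    using \<xi> \<eta> by (auto simp: irreducible_unitary_rep_def)
  note c\<xi> = unitary_rep_carrier[OF r\<xi>] and c\<eta> = unitary_rep_carrier[OF r\<eta>]
  let ?A = "mat_adjoint B"
  have A: "?A \<in> carrier_mat m n" using B by simp
  note adj = intertwiner_adjoint[OF r\<xi> r\<eta> B inter]
  have "\<xi> x * (B * ?A) = (B * ?A) * \<xi> x" for x
  proof -
    have "\<xi> x * (B * ?A) = (\<xi> x * B) * ?A" by (rule assoc_mult_mat[symmetric, OF c\<xi> B A])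
    also have "\<dots> = B * (\<eta> x * ?A)" unfolding inter by (rule assoc_mult_mat[OF B c\<eta> A])
    also have "\<dots> = (B * ?A) * \<xi> x" unfolding adj by (rule assoc_mult_mat[symmetric, OF B A c\<xi>])
    finally show ?thesis .
  qed
  then obtain a where a: "B * ?A = a \<cdot>\<^sub>m 1\<^sub>m n"
    using irreducible_commutant_scalar[OF \<xi> mult_carrier_mat[OF B A]] by blast
  have "\<eta> x * (?A * B) = (?A * B) * \<eta> x" for x
  proof -
    have "\<eta> x * (?A * B) = (\<eta> x * ?A) * B" by (rule assoc_mult_mat[symmetric, OF c\<eta> A B])
    also have "\<dots> = ?A * (\<xi> x * B)" unfolding adj by (rule assoc_mult_mat[OF A c\<xi> B])
    also have "\<dots> = (?A * B) * \<eta> x" unfolding inter by (rule assoc_mult_mat[symmetric, OF A B c\<eta>])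
    finally show ?thesis .
  qed
  then obtain b where b: "?A * B = b \<cdot>\<^sub>m 1\<^sub>m m"
    using irreducible_commutant_scalar[OF \<eta> mult_carrier_mat[OF A B]] by blast
  obtain i l where il: "i < n" "l < m" "B $$ (i, l) \<noteq> 0"
    using False B by (metis eq_matI carrier_matD index_zero_mat)
  have rows: "(\<Sum>l<m. (cmod (B $$ (i, l)))\<^sup>2) = a" if "i < n" for i
  proof -
    have "a = (B * ?A) $$ (i, i)" using that by (simp add: a)
    also have "\<dots> = (\<Sum>l<m. B $$ (i, l) * cnj (B $$ (i, l)))"
      using that B by (subst index_mult_mat_sum[OF B A]) (auto intro!: sum.cong)
    finally show ?thesis by (simp add: complex_norm_square[unfolded of_real_power])
  qed
  have cols: "(\<Sum>i<n. (cmod (B $$ (i, l)))\<^sup>2) = b" if "l < m" for l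
  proof -
    have "b = (?A * B) $$ (l, l)" using that by (simp add: b)
    also have "\<dots> = (\<Sum>i<n. B $$ (i, l) * cnj (B $$ (i, l)))"
      using that B by (subst index_mult_mat_sum[OF A B]) (auto intro!: sum.cong simp: mult.commute)
    finally show ?thesis by (simp add: complex_norm_square[unfolded of_real_power])
  qed
  have "0 < (\<Sum>l<m. (cmod (B $$ (i, l)))\<^sup>2)"
    using il by (intro sum_pos2[of _ l]) auto
  then have "a \<noteq> 0" unfolding rows[OF il(1), symmetric] by (simp del: of_real_sum of_real_power)
  have "a \<cdot>\<^sub>m B = (B * ?A) * B" unfolding a using B mult_smult_assoc_mat[of "1\<^sub>m n" n n B m a] by simp
  also have "\<dots> = B * (?A * B)" by (rule assoc_mult_mat[OF B A B])
  also have "\<dots> = b \<cdot>\<^sub>m B" unfolding b using B mult_smult_distrib[of B n m "1\<^sub>m m" m b] by simp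
  finally have "(a \<cdot>\<^sub>m B) $$ (i, l) = (b \<cdot>\<^sub>m B) $$ (i, l)" by simp
  then have "a = b" using il B by simp
  have "of_nat n * a = (\<Sum>i<n. complex_of_real (\<Sum>l<m. (cmod (B $$ (i, l)))\<^sup>2))"
    by (simp add: rows del: of_real_sum of_real_power)
  also have "\<dots> = (\<Sum>l<m. complex_of_real (\<Sum>i<n. (cmod (B $$ (i, l)))\<^sup>2))"
    unfolding of_real_sum by (rule sum.swap)
  also have "\<dots> = of_nat m * a" by (simp add: cols \<open>a = b\<close> del: of_real_sum of_real_power)
  finally have nm: "n = m" using \<open>a \<noteq> 0\<close> by simp
  have "inverts_mat B ((1 / a) \<cdot>\<^sub>m ?A)" "inverts_mat ((1 / a) \<cdot>\<^sub>m ?A) B"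
    using A B a b \<open>a = b\<close> \<open>a \<noteq> 0\<close> nm mult_smult_distrib[OF B A, of "1 / a"]
      mult_smult_assoc_mat[OF A B, of "1 / a"]
    by (auto simp: inverts_mat_def intro!: eq_matI)
  then show ?thesis using B nm by (auto simp: invertible_mat_def)
qed simp

lemma rep_dim_eq: "irreducible_unitary_rep d \<xi> \<Longrightarrow> rep_dim \<xi> = d"
  using unitary_rep_carrier[of d \<xi> 0] by (auto simp: irreducible_unitary_rep_def rep_dim_def)

lemma representative_rep:
  "unitary_dual_representatives R \<Longrightarrow> \<xi> \<in> R \<Longrightarrow> unitary_rep (rep_dim \<xi>) \<xi>"
  by (auto simp: unitary_dual_representatives_def irreducible_unitary_rep_def)

text \<open>Only one member of \<open>R\<close> is equivalent to \<eta>, namely \<eta> itself; an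
  invertible intertwiner would make \<xi> a second one.\<close>

lemma inequivalent_intertwiner_zero:
  assumes R: "unitary_dual_representatives R" and "\<xi> \<in> R" "\<eta> \<in> R" "\<xi> \<noteq> \<eta>"
    and B: "B \<in> carrier_mat (rep_dim \<xi>) (rep_dim \<eta>)" and inter: "\<And>x. \<xi> x * B = B * \<eta> x"
  shows "B = 0\<^sub>m (rep_dim \<xi>) (rep_dim \<eta>)"
proof (rule ccontr)
  assume "B \<noteq> 0\<^sub>m (rep_dim \<xi>) (rep_dim \<eta>)"
  have i\<xi>: "irreducible_unitary_rep (rep_dim \<xi>) \<xi>" and i\<eta>: "irreducible_unitary_rep (rep_dim \<eta>) \<eta>"
    using assms by (auto simp: unitary_dual_representatives_def)
  then have "invertible_mat B"
    using intertwiner_eq_zero_or_invertible[OF i\<xi> i\<eta> B inter] \<open>B \<noteq> _\<close> by blast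
  then have "equivalent_reps \<eta> \<xi>"
    unfolding equivalent_reps_def using B inter by (intro bexI[of _ B]) auto
  moreover have "equivalent_reps \<eta> \<eta>"
  proof -
    have c: "\<eta> x \<in> carrier_mat (rep_dim \<eta>) (rep_dim \<eta>)" for x
      using i\<eta> unitary_rep_carrier by (auto simp: irreducible_unitary_rep_def)
    show ?thesis
      unfolding equivalent_reps_def
      by (intro bexI[of _ "1\<^sub>m (rep_dim \<eta>)"])
        (auto simp: invertible_mat_def inverts_mat_def left_mult_one_mat[OF c] right_mult_one_mat[OF c] intro!: exI[of _ "1\<^sub>m (rep_dim \<eta>)"])
  qed
  moreover have "\<exists>!\<zeta>. \<zeta> \<in> R \<and> equivalent_reps \<eta> \<zeta>"
    using R i\<eta> by (auto simp: unitary_dual_representatives_def)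
  ultimately show False using assms by blast
qed

context haar_group
begin

lemma cts_coefficient:
  "unitary_rep d \<xi> \<Longrightarrow> i < d \<Longrightarrow> j < d \<Longrightarrow> cts (\<lambda>x. \<xi> x $$ (i, j))"
  by (rule unitary_repD(4))

lemma coefficient_translate:
  assumes "unitary_rep d \<xi>" "i < d" "j < d"
  shows "\<xi> (a + x) $$ (i, j) = (\<Sum>p<d. \<xi> a $$ (i, p) * \<xi> x $$ (p, j))"
  unfolding unitary_repD(3)[OF assms(1)]
  by (rule index_mult_mat_sum[OF unitary_rep_carrier[OF assms(1)] unitary_rep_carrier[OF assms(1)] assms(2,3)])

text \<open>\<open>B\<close> is the average over the group of \<xi>(x) E \<eta>(x)^*, where E is the
  matrix unit with its 1 in position (j, l). Left invariance of the Haar measure makes such an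
  average an intertwiner.\<close>

lemma averaged_intertwiner:
  assumes \<xi>: "unitary_rep n \<xi>" and \<eta>: "unitary_rep m \<eta>" and jl: "j < n" "l < m"
  defines "B \<equiv> mat n m (\<lambda>(i, k). ip (\<lambda>x. \<xi> x $$ (i, j)) (\<lambda>x. \<eta> x $$ (k, l)))"
  shows "\<xi> a * B = B * \<eta> a"
proof (rule eq_matI)
  note c\<xi> = unitary_rep_carrier[OF \<xi>] and c\<eta> = unitary_rep_carrier[OF \<eta>]
  note cts\<xi> = cts_coefficient[OF \<xi>] and cts\<eta> = cts_coefficient[OF \<eta>]
  have B: "B \<in> carrier_mat n m" by (simp add: B_def)
  fix i k assume "i < dim_row (B * \<eta> a)" "k < dim_col (B * \<eta> a)"
  then have ik: "i < n" "k < m" using B c\<eta>[of a] by auto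
  have "(\<xi> a * B) $$ (i, k) = (\<Sum>p<n. \<xi> a $$ (i, p) * B $$ (p, k))"
    by (rule index_mult_mat_sum[OF c\<xi> B ik])
  also have "\<dots> = (\<Sum>p<n. ip (\<lambda>x. \<xi> a $$ (i, p) * \<xi> x $$ (p, j)) (\<lambda>x. \<eta> x $$ (k, l)))"
    using ik by (intro sum.cong) (auto simp: B_def ip_scale_left)
  also have "\<dots> = ip (\<lambda>x. \<xi> (a + x) $$ (i, j)) (\<lambda>x. \<eta> x $$ (k, l))"
    unfolding coefficient_translate[OF \<xi> ik(1) jl(1)]
    by (rule ip_sum_left[symmetric]) (use cts\<xi> cts\<eta> jl ik in \<open>auto intro!: continuous_intros\<close>)
  also have "\<dots> = ip (\<lambda>x. \<xi> (a + x) $$ (i, j)) (\<lambda>x. \<eta> (- a + (a + x)) $$ (k, l))" by simp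
  also have "\<dots> = ip (\<lambda>x. \<xi> x $$ (i, j)) (\<lambda>x. \<eta> (- a + x) $$ (k, l))"
    by (rule ip_translate) (intro cts\<xi> cts_translate cts\<eta> ik jl)+
  also have "\<dots> = (\<Sum>q<m. ip (\<lambda>x. \<xi> x $$ (i, j)) (\<lambda>x. \<eta> (- a) $$ (k, q) * \<eta> x $$ (q, l)))"
    unfolding coefficient_translate[OF \<eta> ik(2) jl(2)]
    by (rule ip_sum_right) (use cts\<xi> cts\<eta> jl ik in \<open>auto intro!: continuous_intros\<close>)
  also have "\<dots> = (\<Sum>q<m. B $$ (i, q) * \<eta> a $$ (q, k))"
    using ik c\<eta>[of a]
    by (intro sum.cong) (auto simp: B_def ip_scale_right unitary_rep_minus[OF \<eta>] intro: mult.commute)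
  also have "\<dots> = (B * \<eta> a) $$ (i, k)"
    by (rule index_mult_mat_sum[OF B c\<eta> ik, symmetric])
  finally show "(\<xi> a * B) $$ (i, k) = (B * \<eta> a) $$ (i, k)" .
qed (use unitary_rep_carrier[OF \<xi>, of a] unitary_rep_carrier[OF \<eta>, of a] in \<open>auto simp: B_def\<close>)

text \<open>Here the averaged intertwiner is a scalar \<open>c\<close>. Its trace is the integral of
  the (l, j) entry of \<xi>(x)^* \<xi>(x), the identity matrix, so d c is 1 or 0 according to
  whether \<open>j = l\<close>.\<close>

lemma schur_orthogonality_same:
  assumes \<xi>: "irreducible_unitary_rep d \<xi>" and "i < d" "j < d" "k < d" "l < d"
  shows "ip (\<lambda>x. \<xi> x $$ (i, j)) (\<lambda>x. \<xi> x $$ (k, l)) = (if i = k \<and> j = l then 1 / of_nat d else 0)"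
proof -
  have r: "unitary_rep d \<xi>" and d: "0 < d" using \<xi> by (auto simp: irreducible_unitary_rep_def)
  let ?B = "mat d d (\<lambda>(i, k). ip (\<lambda>x. \<xi> x $$ (i, j)) (\<lambda>x. \<xi> x $$ (k, l)))"
  obtain c where c: "?B = c \<cdot>\<^sub>m 1\<^sub>m d"
    using irreducible_commutant_scalar[OF \<xi> _ averaged_intertwiner[OF r r \<open>j < d\<close> \<open>l < d\<close>]] by auto
  have B: "ip (\<lambda>x. \<xi> x $$ (i, j)) (\<lambda>x. \<xi> x $$ (k, l)) = (if i = k then c else 0)" if "i < d" "k < d" for i k
    using arg_cong[OF c, of "\<lambda>M. M $$ (i, k)"] that by simp
  have "of_nat d * c = (\<Sum>p<d. ip (\<lambda>x. \<xi> x $$ (p, j)) (\<lambda>x. \<xi> x $$ (p, l)))"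
    by (simp add: B)
  also have "\<dots> = (CLINT x|\<mu>. \<Sum>p<d. \<xi> x $$ (p, j) * cnj (\<xi> x $$ (p, l)))"
    unfolding ip_def
    by (intro Bochner_Integration.integral_sum[symmetric] integrable_ip cts_coefficient[OF r])
      (use assms in auto)
  also have "(\<lambda>x. \<Sum>p<d. \<xi> x $$ (p, j) * cnj (\<xi> x $$ (p, l))) = (\<lambda>x. (mat_adjoint (\<xi> x) * \<xi> x) $$ (l, j))"
  proof
    fix x
    note cx = unitary_rep_carrier[OF r, of x]
    show "(\<Sum>p<d. \<xi> x $$ (p, j) * cnj (\<xi> x $$ (p, l))) = (mat_adjoint (\<xi> x) * \<xi> x) $$ (l, j)"
      using cx assms
      by (subst index_mult_mat_sum[OF mat_adjoint_carrier[OF cx] cx]) (auto intro!: sum.cong)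
  qed
  also have "(CLINT x|\<mu>. (mat_adjoint (\<xi> x) * \<xi> x) $$ (l, j)) = (if j = l then 1 else 0)"
    unfolding unitary_repD(1)[OF r] using assms by simp
  finally have "c = (if j = l then 1 / of_nat d else 0)"
    using d by (auto simp: field_simps split: if_splits)
  then show ?thesis using B[of i k] assms by simp
qed

lemma schur_orthogonality_distinct:
  assumes R: "unitary_dual_representatives R" and \<xi>\<eta>: "\<xi> \<in> R" "\<eta> \<in> R" "\<xi> \<noteq> \<eta>"
    and ij: "i < rep_dim \<xi>" "j < rep_dim \<xi>" and kl: "k < rep_dim \<eta>" "l < rep_dim \<eta>"
  shows "ip (\<lambda>x. \<xi> x $$ (i, j)) (\<lambda>x. \<eta> x $$ (k, l)) = 0"
proof -
  note r\<xi> = representative_rep[OF R \<xi>\<eta>(1)] and r\<eta> = representative_rep[OF R \<xi>\<eta>(2)]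
  have "mat (rep_dim \<xi>) (rep_dim \<eta>) (\<lambda>(i, k). ip (\<lambda>x. \<xi> x $$ (i, j)) (\<lambda>x. \<eta> x $$ (k, l)))
      = 0\<^sub>m (rep_dim \<xi>) (rep_dim \<eta>)"
    by (rule inequivalent_intertwiner_zero[OF R \<xi>\<eta> _ averaged_intertwiner[OF r\<xi> r\<eta> ij(2) kl(2)]]) simp
  from arg_cong[OF this, of "\<lambda>M. M $$ (i, k)"] show ?thesis using ij kl by simp
qed

end

section \<open>The Peter--Weyl theorem\<close>

text \<open>Inductive generation lets continuity, invariance under translation and under
  convolution, and finally the validity of the nuclear expansion be checked on a single
  coefficient.\<close>

inductive_set coeff_span :: "('g::topological_group_add \<Rightarrow> complex mat) set \<Rightarrow> ('g \<Rightarrow> complex) set"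
  for R where
  coefficient: "\<xi> \<in> R \<Longrightarrow> i < rep_dim \<xi> \<Longrightarrow> j < rep_dim \<xi> \<Longrightarrow> (\<lambda>x. \<xi> x $$ (i, j)) \<in> coeff_span R"
| zero: "(\<lambda>x. 0) \<in> coeff_span R"
| add: "f \<in> coeff_span R \<Longrightarrow> g \<in> coeff_span R \<Longrightarrow> (\<lambda>x. f x + g x) \<in> coeff_span R"
| scale: "f \<in> coeff_span R \<Longrightarrow> (\<lambda>x. c * f x) \<in> coeff_span R"

lemma coeff_span_sum:
  assumes "\<And>i. i \<in> I \<Longrightarrow> f i \<in> coeff_span R"
  shows "(\<lambda>x. \<Sum>i\<in>I. f i x) \<in> coeff_span R"
  using assms
proof (induction I rule: infinite_finite_induct)
  case (insert a I)
  then show ?case using coeff_span.add[of "f a" R "\<lambda>x. \<Sum>i\<in>I. f i x"] by simp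
qed (auto intro: coeff_span.zero)

text \<open>An intertwiner \<open>T\<close> with inverse \<open>U\<close> gives D(x) = U \<xi>(x) T,
  whose entries are fixed linear combinations of those of \<xi>(x).\<close>

lemma irreducible_coefficient_in_span:
  assumes R: "unitary_dual_representatives R" and D: "irreducible_unitary_rep m D"
    and ij: "i < m" "j < m"
  shows "(\<lambda>x. D x $$ (i, j)) \<in> coeff_span R"
proof -
  obtain \<xi> where \<xi>: "\<xi> \<in> R" "equivalent_reps D \<xi>"
    using R D unfolding unitary_dual_representatives_def by blast
  then obtain T where T: "T \<in> carrier_mat (rep_dim \<xi>) m" "invertible_mat T" "\<And>x. T * D x = \<xi> x * T"
    using rep_dim_eq[OF D] by (auto simp: equivalent_reps_def)
  then have d: "rep_dim \<xi> = m" by (auto simp: invertible_mat_def)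
  note T = T[unfolded d]
  obtain U where U: "inverts_mat T U" "inverts_mat U T"
    using T(2) by (auto simp: invertible_mat_def)
  have "dim_col U = m"
    using arg_cong[OF U(1)[unfolded inverts_mat_def], of dim_col] T(1) by simp
  moreover have "dim_row U = m"
    using arg_cong[OF U(2)[unfolded inverts_mat_def], of dim_col] T(1) by simp
  ultimately have cU: "U \<in> carrier_mat m m" by auto
  have cD: "D x \<in> carrier_mat m m" for x
    using D unitary_rep_carrier by (auto simp: irreducible_unitary_rep_def)
  have "irreducible_unitary_rep m \<xi>"
    using R \<xi>(1) d by (auto simp: unitary_dual_representatives_def)
  then have c\<xi>: "\<xi> x \<in> carrier_mat m m" for x
    using unitary_rep_carrier by (auto simp: irreducible_unitary_rep_def)
  have "D x $$ (i, j) = (\<Sum>p<m. \<Sum>q<m. U $$ (i, p) * (T $$ (q, j) * \<xi> x $$ (p, q)))" for x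
  proof -
    have "D x = (U * T) * D x"
      using U(2) cU cD[of x] by (simp add: inverts_mat_def)
    also have "\<dots> = U * (\<xi> x * T)"
      unfolding T(3)[symmetric] by (rule assoc_mult_mat[OF cU T(1) cD])
    finally have "D x $$ (i, j) = (\<Sum>p<m. U $$ (i, p) * (\<xi> x * T) $$ (p, j))"
      using index_mult_mat_sum[OF cU mult_carrier_mat[OF c\<xi>[of x] T(1)] ij] by simp
    also have "\<dots> = (\<Sum>p<m. U $$ (i, p) * (\<Sum>q<m. \<xi> x $$ (p, q) * T $$ (q, j)))"
      using index_mult_mat_sum[OF c\<xi>[of x] T(1) _ ij(2)] by (intro sum.cong) auto
    finally show ?thesis by (simp add: sum_distrib_left mult.commute[of "_ $$ (_, j)"])
  qed
  then show ?thesis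
    using \<xi>(1) d by (auto intro!: coeff_span_sum coeff_span.scale coeff_span.coefficient)
qed

context haar_group
begin

text \<open>The conjugate of the representation by left translation on \<open>S\<close>, in an orthonormal basis;
  with the conjugate, \<open>S\<close> is spanned by coefficients rather than by conjugates of coefficients.\<close>

lemma minimal_invariant_subspace_coefficients:
  assumes S: "fun_subspace S" "translation_invariant S" "S \<noteq> {\<lambda>x. 0}"
    and minimal: "\<And>S'. S' \<subseteq> S \<Longrightarrow> fun_subspace S' \<Longrightarrow> translation_invariant S' \<Longrightarrow> S' = {\<lambda>x. 0} \<or> S' = S"
    and K: "\<And>m. orthonormal_in S m \<Longrightarrow> m \<le> K"
  obtains m D g where "irreducible_unitary_rep m D" "orthonormal m g" "\<forall>i<m. g i \<in> S"
    "\<forall>j<m. g j = (\<lambda>x. \<Sum>i<m. g i 0 * D x $$ (j, i))"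
proof -
  obtain m g where g: "orthonormal m g" "\<forall>i<m. g i \<in> S"
    and spans: "\<forall>f\<in>S. f = (\<lambda>x. \<Sum>i<m. ip f (g i) * g i x)"
    by (rule exists_orthonormal_basis[OF S(1) K])
  note cg = orthonormalD(1)[OF g(1)]
  define D where "D x = mat m m (\<lambda>(i, j). ip (g i) (\<lambda>y. g j (- x + y)))" for x
  have cD: "D x \<in> carrier_mat m m" for x by (simp add: D_def)
  have [simp]: "dim_row (D x) = m" "dim_col (D x) = m" for x by (simp_all add: D_def)
  have D: "D x $$ (i, j) = ip (g i) (\<lambda>y. g j (- x + y))" if "i < m" "j < m" for i j x
    using that by (simp add: D_def)
  have expand: "g j (- x + y) = (\<Sum>i<m. cnj (D x $$ (i, j)) * g i y)" if j: "j < m" for j x y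
  proof -
    have "(\<lambda>y. g j (- x + y)) \<in> S" using S(2) g(2) j by (auto simp: translation_invariant_def)
    from spans[rule_format, OF this]
    have "g j (- x + y) = (\<Sum>i<m. ip (\<lambda>y. g j (- x + y)) (g i) * g i y)" by (rule fun_cong)
    then show ?thesis using j by (simp add: D ip_commute[of "\<lambda>y. g j (- x + y)"])
  qed
  have mult: "D (x + z) = D x * D z" for x z
  proof (rule eq_matI)
    fix i j assume "i < dim_row (D x * D z)" "j < dim_col (D x * D z)"
    then have ij: "i < m" "j < m" using cD[of x] cD[of z] by auto
    have "g j (- (x + z) + y) = (\<Sum>p<m. cnj (D z $$ (p, j)) * g p (- x + y))" for y
      unfolding expand[OF ij(2), symmetric] by (simp only: minus_add add.assoc)
    then have "D (x + z) $$ (i, j) = ip (g i) (\<lambda>y. \<Sum>p<m. cnj (D z $$ (p, j)) * g p (- x + y))"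
      using D[OF ij, of "x + z"] by simp
    also have "\<dots> = (\<Sum>p<m. ip (g i) (\<lambda>y. cnj (D z $$ (p, j)) * g p (- x + y)))"
      by (rule ip_sum_right)
        (use ij in \<open>auto intro!: continuous_on_mult continuous_on_const cts_translate cg\<close>)
    also have "\<dots> = (\<Sum>p<m. D x $$ (i, p) * D z $$ (p, j))"
      using ij by (intro sum.cong) (auto simp: ip_scale_right D)
    also have "\<dots> = (D x * D z) $$ (i, j)" by (rule index_mult_mat_sum[OF cD cD ij, symmetric])
    finally show "D (x + z) $$ (i, j) = (D x * D z) $$ (i, j)" .
  qed auto
  have zero: "D 0 = 1\<^sub>m m"
    by (rule eq_matI) (simp_all add: D orthonormalD(2)[OF g(1)])
  have adj: "mat_adjoint (D x) = D (- x)" for x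
  proof (rule eq_matI)
    fix i j assume "i < dim_row (D (- x))" "j < dim_col (D (- x))"
    then have ij: "i < m" "j < m" using cD[of "- x"] by auto
    have "mat_adjoint (D x) $$ (i, j) = cnj (ip (g j) (\<lambda>y. g i (- x + y)))"
      using ij cD[of x] by (simp add: D)
    also have "\<dots> = ip (\<lambda>y. g i (- x + y)) (g j)" by (rule ip_commute[symmetric])
    also have "\<dots> = ip (\<lambda>y. g i (- x + (x + y))) (\<lambda>y. g j (x + y))"
      by (rule ip_translate[symmetric]) (intro cts_translate cg ij)+
    also have "\<dots> = D (- x) $$ (i, j)" using ij by (simp add: D)
    finally show "mat_adjoint (D x) $$ (i, j) = D (- x) $$ (i, j)" .
  qed (use cD[of x] cD[of "- x"] in auto)
  have cont: "cts (\<lambda>x. D x $$ (i, j))" if ij: "i < m" "j < m" for i j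
  proof -
    have "continuous_on UNIV (\<lambda>z. g j (- fst z + snd z))"
      by (rule cts_comp2[OF cg[OF ij(2)]]) (intro continuous_intros)
    then have "cts (\<lambda>x. CLINT y|\<mu>. g i y * cnj (g j (- x + y)))"
      by (intro cts_parametric_integral continuous_on_mult continuous_on_cnj cts_snd cg ij)
    then show ?thesis using ij by (simp add: D ip_def)
  qed
  have "D x * D (- x) = 1\<^sub>m m" "D (- x) * D x = 1\<^sub>m m" for x
    by (simp_all add: mult[symmetric] zero)
  then have rep: "unitary_rep m D"
    unfolding unitary_rep_def unitary_mat_def adj using cD cont mult by blast
  have "0 < m"
  proof (rule ccontr)
    assume "\<not> 0 < m"
    then have "f = (\<lambda>x. 0)" if "f \<in> S" for f using spans that by auto
    then show False using S(3) fun_subspaceD(2)[OF S(1)] by blast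
  qed
  have irr: "W = {0\<^sub>v m} \<or> W = carrier_vec m"
    if W: "VectorSpace.subspace class_ring W (module_vec TYPE(complex) m)"
      and inv: "\<And>x w. w \<in> W \<Longrightarrow> D x *\<^sub>v w \<in> W" for W
  proof -
    note W = W[unfolded subspace_carrier_vec_iff]
    \<comment> \<open>\<open>\<Phi>\<close> carries subspaces invariant under \<open>D\<close> to
      translation invariant subspaces of \<open>S\<close>, so minimality of \<open>S\<close> becomes
      irreducibility of \<open>D\<close>. It is conjugate linear because \<open>D\<close> is the
      conjugate of the translation action.\<close>
    define \<Phi> where "\<Phi> w = (\<lambda>x. \<Sum>i<m. cnj (w $ i) * g i x)" for w :: "complex vec"
    have ip\<Phi>: "ip (\<Phi> w) (g i) = cnj (w $ i)" if "i < m" for w i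
      unfolding \<Phi>_def by (rule ip_combination[OF g(1) that])
    have \<Phi>S: "\<Phi> w \<in> S" for w
      unfolding \<Phi>_def
      by (rule fun_subspace_sum[OF S(1), of "{..<m}" "\<lambda>i x. cnj (w $ i) * g i x"])
        (use g(2) fun_subspaceD(4)[OF S(1)] in auto)
    have sub: "fun_subspace (\<Phi> ` W)"
      unfolding fun_subspace_def
    proof (intro conjI ballI allI)
      show "cts f" if "f \<in> \<Phi> ` W" for f using that \<Phi>S fun_subspaceD(1)[OF S(1)] by blast
      have "(\<lambda>x. 0) = \<Phi> (0\<^sub>v m)" by (simp add: \<Phi>_def)
      then show "(\<lambda>x. 0) \<in> \<Phi> ` W" using W by blast
    next
      fix f h assume "f \<in> \<Phi> ` W" "h \<in> \<Phi> ` W"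
      then obtain v w where vw: "v \<in> W" "w \<in> W" "f = \<Phi> v" "h = \<Phi> w" by blast
      then have "v \<in> carrier_vec m" "w \<in> carrier_vec m" using W by blast+
      then have "(\<lambda>x. f x + h x) = \<Phi> (v + w)"
        by (simp add: vw(3,4) \<Phi>_def distrib_right sum.distrib)
      then show "(\<lambda>x. f x + h x) \<in> \<Phi> ` W" using W vw by blast
    next
      fix c f assume "f \<in> \<Phi> ` W"
      then obtain v where v: "v \<in> W" "f = \<Phi> v" by blast
      then have "v \<in> carrier_vec m" using W by blast
      then have "(\<lambda>x. c * f x) = \<Phi> (cnj c \<cdot>\<^sub>v v)"
        by (simp add: v(2) \<Phi>_def sum_distrib_left mult.assoc)
      then show "(\<lambda>x. c * f x) \<in> \<Phi> ` W" using W v by blast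
    qed
    have tr: "translation_invariant (\<Phi> ` W)"
      unfolding translation_invariant_def
    proof (intro ballI allI)
      fix f a assume "f \<in> \<Phi> ` W"
      then obtain w where w: "w \<in> W" "f = \<Phi> w" by blast
      then have cw: "w \<in> carrier_vec m" using W by blast
      have "f (a + y) = \<Phi> (D (- a) *\<^sub>v w) y" for y
      proof -
        have "f (a + y) = (\<Sum>j<m. cnj (w $ j) * (\<Sum>i<m. cnj (D (- a) $$ (i, j)) * g i y))"
          using expand[of _ "- a" y] by (simp add: w(2) \<Phi>_def)
        also have "\<dots> = (\<Sum>i<m. \<Sum>j<m. cnj (w $ j) * (cnj (D (- a) $$ (i, j)) * g i y))"
          unfolding sum_distrib_left by (rule sum.swap)
        also have "\<dots> = (\<Sum>i<m. cnj ((D (- a) *\<^sub>v w) $ i) * g i y)"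
        proof (intro sum.cong refl)
          fix i assume "i \<in> {..<m}"
          then show "(\<Sum>j<m. cnj (w $ j) * (cnj (D (- a) $$ (i, j)) * g i y)) = cnj ((D (- a) *\<^sub>v w) $ i) * g i y"
            by (subst index_mult_mat_vec_sum[OF cD cw]) (auto simp: sum_distrib_right intro!: sum.cong)
        qed
        finally show ?thesis by (simp add: \<Phi>_def)
      qed
      then have "(\<lambda>x. f (a + x)) = \<Phi> (D (- a) *\<^sub>v w)" by (rule ext)
      then show "(\<lambda>x. f (a + x)) \<in> \<Phi> ` W" using inv[OF w(1)] by blast
    qed
    have "\<Phi> ` W \<subseteq> S" using \<Phi>S by blast
    from minimal[OF this sub tr] show ?thesis
    proof
      assume triv: "\<Phi> ` W = {\<lambda>x. 0}"
      have "w = 0\<^sub>v m" if "w \<in> W" for w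
      proof (rule eq_vecI)
        have "\<Phi> w = (\<lambda>x. 0)" using triv that by blast
        then show "w $ i = 0\<^sub>v m $ i" if "i < dim_vec (0\<^sub>v m :: complex vec)" for i
          using ip\<Phi>[of i w] that by simp
      qed (use that W in auto)
      then show ?thesis using W by blast
    next
      assume all: "\<Phi> ` W = S"
      have "v \<in> W" if v: "v \<in> carrier_vec m" for v
      proof -
        have "\<Phi> v \<in> \<Phi> ` W" unfolding all by (rule \<Phi>S)
        then obtain w where w: "w \<in> W" "\<Phi> v = \<Phi> w" by blast
        have "v = w"
        proof (rule eq_vecI)
          show "v $ i = w $ i" if "i < dim_vec w" for i
            using ip\<Phi>[of i v] ip\<Phi>[of i w] w W that by fastforce
        qed (use v w W in auto)
        then show ?thesis using w by simp
      qed
      then show ?thesis using W by blast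
    qed
  qed
  have "irreducible_unitary_rep m D"
    unfolding irreducible_unitary_rep_def using \<open>0 < m\<close> rep irr by blast
  moreover have "\<forall>j<m. g j = (\<lambda>x. \<Sum>i<m. g i 0 * D x $$ (j, i))"
  proof (intro allI impI ext)
    fix j x assume j: "j < m"
    \<comment> \<open>The expansion of the left translate by \<open>- x\<close>, evaluated at 0,
      recovers the value of \<open>g j\<close> at \<open>x\<close> as a combination of coefficients
      of \<open>D\<close>.\<close>
    have "g j x = (\<Sum>i<m. cnj (D (- x) $$ (i, j)) * g i 0)" using expand[OF j, of "- x" 0] by simp
    also have "\<dots> = (\<Sum>i<m. g i 0 * D x $$ (j, i))"
      using j cD[of x] by (intro sum.cong) (auto simp: adj[symmetric] mult.commute)
    finally show "g j x = (\<Sum>i<m. g i 0 * D x $$ (j, i))" .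
  qed
  ultimately show thesis using that g by blast
qed

section \<open>Invariance of the coefficient span\<close>

lemma coeff_span_cts:
  assumes R: "unitary_dual_representatives R" and "f \<in> coeff_span R"
  shows "cts f"
  using assms(2)
proof induction
  case (coefficient \<xi> i j)
  then show ?case by (rule cts_coefficient[OF representative_rep[OF R]])
qed (auto intro!: continuous_intros)

lemma coeff_span_translate:
  assumes R: "unitary_dual_representatives R" and "f \<in> coeff_span R"
  shows "(\<lambda>x. f (a + x)) \<in> coeff_span R"
  using assms(2)
proof induction
  case (coefficient \<xi> i j)
  note r = representative_rep[OF R coefficient(1)]
  show ?case
    unfolding coefficient_translate[OF r coefficient(2,3)]
    using coefficient
    by (auto intro!: coeff_span_sum coeff_span.scale coeff_span.coefficient)
qed (auto intro: coeff_span.intros)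

lemma conv_eq_translated:
  assumes "cts k" "cts f"
  shows "conv k f x = (CLINT y|\<mu>. f (x + y) * k (- y))"
proof -
  have "cts (\<lambda>y. f y * k (- y + x))" by (intro continuous_on_mult cts_kernel assms)
  from integral_translate[OF cts_measurable[OF this], of x]
  show ?thesis
    using minus_add_cancel_translate[of x _ 0] by (simp add: conv_def)
qed

text \<open>After substituting x + y for y, multiplicativity of \<xi> splits off the dependence on
  \<open>x\<close>: the result combines the coefficients in row \<open>i\<close> with constants
  given by integrals.\<close>

lemma coeff_span_conv:
  assumes R: "unitary_dual_representatives R" and k: "cts k" and "f \<in> coeff_span R"
  shows "conv k f \<in> coeff_span R"
  using assms(3)
proof induction
  case (coefficient \<xi> i j)
  note r = representative_rep[OF R coefficient(1)]
  note c = cts_coefficient[OF r]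
  have ck: "cts (\<lambda>y. k (- y))" using cts_kernel(1)[OF k, of 0] by simp
  have "conv k (\<lambda>x. \<xi> x $$ (i, j)) x =
      (\<Sum>p<rep_dim \<xi>. (CLINT y|\<mu>. \<xi> y $$ (p, j) * k (- y)) * \<xi> x $$ (i, p))" for x
  proof -
    have "conv k (\<lambda>x. \<xi> x $$ (i, j)) x =
        (CLINT y|\<mu>. \<Sum>p<rep_dim \<xi>. \<xi> x $$ (i, p) * (\<xi> y $$ (p, j) * k (- y)))"
      unfolding conv_eq_translated[OF k c[OF coefficient(2,3)]]
        coefficient_translate[OF r coefficient(2,3)]
      by (simp add: sum_distrib_right mult.assoc)
    also have "\<dots> = (\<Sum>p<rep_dim \<xi>. CLINT y|\<mu>. \<xi> x $$ (i, p) * (\<xi> y $$ (p, j) * k (- y)))"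
      using coefficient
      by (intro Bochner_Integration.integral_sum integrable_cts continuous_on_mult continuous_on_const c ck) auto
    finally show ?thesis by (simp add: mult.commute)
  qed
  then show ?case
    using coefficient
    by (auto intro!: coeff_span_sum coeff_span.scale coeff_span.coefficient)
next
  case (add f g)
  then show ?case
    by (subst conv_add) (auto intro: k coeff_span.add coeff_span_cts[OF R])
next
  case (scale f c)
  then show ?case by (auto simp: conv_scale intro: coeff_span.scale)
qed (auto intro: coeff_span.zero)

definition orth :: "('g \<Rightarrow> complex) set \<Rightarrow> ('g \<Rightarrow> complex) set" where
  "orth M = {f. cts f \<and> (\<forall>h\<in>M. ip f h = 0)}"

text \<open>Provides the closedness under uniform limits that \<open>exists_eigenfunction\<close>
  requires of its space.\<close>

lemma orth_limit:
  assumes "\<And>n. F n \<in> orth M" "cts g" "uniform_limit UNIV F g sequentially" "\<And>h. h \<in> M \<Longrightarrow> cts h"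
  shows "g \<in> orth M"
  unfolding orth_def
proof (intro CollectI conjI ballI assms(2))
  fix h assume h: "h \<in> M"
  have "(\<lambda>n. ip (F n) h) \<longlonglongrightarrow> ip g h"
    by (rule ip_tendsto[OF assms(3) _ assms(2) assms(4)[OF h]]) (use assms(1) in \<open>auto simp: orth_def\<close>)
  moreover have "ip (F n) h = 0" for n using assms(1)[of n] h by (auto simp: orth_def)
  ultimately show "ip g h = 0" using LIMSEQ_unique[OF _ tendsto_const[of 0]] by fastforce
qed

lemma conv_vanishes_on_orth:
  assumes R: "unitary_dual_representatives R" and k: "cts k" "\<And>x. k (- x) = cnj (k x)"
    and f: "f \<in> orth (coeff_span R)"
  shows "conv k f = (\<lambda>x. 0)"
proof (rule ccontr)
  let ?M = "coeff_span R" and ?N = "orth (coeff_span R)"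
  assume nz: "conv k f \<noteq> (\<lambda>x. 0)"
  note cM = coeff_span_cts[OF R]
  have subN: "fun_subspace ?N"
    unfolding fun_subspace_def orth_def
    using cM by (auto simp: ip_add_left ip_scale_left intro!: continuous_intros)
  have trN: "translation_invariant ?N"
    unfolding translation_invariant_def
  proof (intro ballI allI)
    fix h a assume h: "h \<in> ?N"
    then have ch: "cts h" by (simp add: orth_def)
    have "ip (\<lambda>x. h (a + x)) m = 0" if m: "m \<in> ?M" for m
    proof -
      have "ip (\<lambda>x. h (a + x)) m = ip (\<lambda>x. h (a + (- a + x))) (\<lambda>x. m (- a + x))"
        by (rule ip_translate[symmetric]) (intro cts_translate ch cM m)+
      then show ?thesis using h coeff_span_translate[OF R m, of "- a"] by (simp add: orth_def)
    qed
    then show "(\<lambda>x. h (a + x)) \<in> ?N" using cts_translate[OF ch] by (simp add: orth_def)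
  qed
  \<comment> \<open>By symmetry the operator can be moved onto the coefficient, and the span is
    stable under it.\<close>
  have TN: "conv k h \<in> ?N" if "h \<in> ?N" for h
    using that cM coeff_span_conv[OF R k(1)]
    by (auto simp: orth_def conv_symmetric[OF k] intro: cts_conv[OF k(1)])
  have "\<exists>f\<in>?N. conv k f \<noteq> (\<lambda>x. 0)" using f nz by blast
  moreover have "g \<in> ?N" if "\<And>n. F n \<in> ?N" "cts g" "uniform_limit UNIV F g sequentially" for F g
    using that(1,2,3) cM by (rule orth_limit)
  ultimately obtain s u where su: "0 < s" "u \<in> ?N" "u \<noteq> (\<lambda>x. 0)"
    "conv k (conv k u) = (\<lambda>x. complex_of_real s * u x)"
    using exists_eigenfunction[of k ?N, OF k subN TN] by blast
  define E where "E = {h \<in> ?N. conv k (conv k h) = (\<lambda>x. complex_of_real s * h x)}"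
  note cN = fun_subspaceD(1)[OF subN]
  have subE: "fun_subspace E"
    unfolding fun_subspace_def
  proof (intro conjI ballI allI)
    show "cts h" if "h \<in> E" for h using that cN by (simp add: E_def)
    show "(\<lambda>x. 0) \<in> E" using fun_subspaceD(2)[OF subN] by (simp add: E_def)
    show "(\<lambda>x. h x + h' x) \<in> E" if "h \<in> E" "h' \<in> E" for h h'
    proof -
      have "cts h" "cts h'" using that cN by (auto simp: E_def)
      then show ?thesis
        using that fun_subspaceD(3)[OF subN, of h h']
        by (simp add: E_def conv_add k cts_conv distrib_left)
    qed
    show "(\<lambda>x. c * h x) \<in> E" if "h \<in> E" for c h
      using that fun_subspaceD(4)[OF subN, of h c] by (simp add: E_def conv_scale mult.left_commute)
  qed
  have trE: "translation_invariant E"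
    unfolding translation_invariant_def
  proof (intro ballI allI)
    fix h a assume h: "h \<in> E"
    then have "cts h" using cN by (simp add: E_def)
    then show "(\<lambda>x. h (a + x)) \<in> E"
      using h trN by (simp add: E_def conv_translate k cts_conv translation_invariant_def)
  qed
  have "u \<in> E" using su by (simp add: E_def)
  then have Enz: "E \<noteq> {\<lambda>x. 0}" using su(3) by auto
  obtain K where "\<forall>m g. orthonormal m g \<longrightarrow>
      (\<forall>i<m. conv k (conv k (g i)) = (\<lambda>x. complex_of_real s * g i x)) \<longrightarrow> m \<le> K"
    using eigenspace_bounded_dim[OF k su(1)] ..
  then have K: "m \<le> K" if "orthonormal_in E m" for m
    using that by (force simp: orthonormal_in_def E_def)
  obtain S where S: "S \<subseteq> E" "fun_subspace S" "translation_invariant S" "S \<noteq> {\<lambda>x. 0}"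
    "\<And>S'. S' \<subseteq> S \<Longrightarrow> fun_subspace S' \<Longrightarrow> translation_invariant S' \<Longrightarrow> S' = {\<lambda>x. 0} \<or> S' = S"
    by (rule exists_minimal_invariant_subspace[OF subE trE Enz K]) blast+
  have KS: "\<And>m. orthonormal_in S m \<Longrightarrow> m \<le> K" using K S(1) unfolding orthonormal_in_def by blast
  obtain m D g where D: "irreducible_unitary_rep m D" and g: "orthonormal m g" "\<forall>i<m. g i \<in> S"
    and coeff: "\<forall>j<m. g j = (\<lambda>x. \<Sum>i<m. g i 0 * D x $$ (j, i))"
    by (rule minimal_invariant_subspace_coefficients[OF S(2-4) S(5) KS])
  have m: "0 < m" using D by (simp add: irreducible_unitary_rep_def)
  have "(\<lambda>x. \<Sum>i<m. g i 0 * D x $$ (0, i)) \<in> ?M"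
    by (intro coeff_span_sum coeff_span.scale irreducible_coefficient_in_span[OF R D] m) auto
  then have "g 0 \<in> ?M"
    by (rule subst[OF coeff[rule_format, OF m, symmetric], of "\<lambda>f. f \<in> ?M"])
  moreover have "g 0 \<in> ?N" using g(2) m S(1) by (auto simp: E_def)
  ultimately have "ip (g 0) (g 0) = 0" by (simp add: orth_def)
  then show False using orthonormalD(2)[OF g(1) m m] by simp
qed

text \<open>The distance from \<open>f\<close> to the span need not be attained, so elements
  \<open>h n\<close> with nearly minimal distance are taken. Their residuals \<open>d n\<close> are
  asymptotically orthogonal to the span, and a subsequence of \<open>conv k (d n)\<close> has a
  uniform limit \<open>g\<close>, which is orthogonal to it. Hence \<open>conv k g\<close> vanishes,
  and symmetry makes every \<open>conv k (d n)\<close> orthogonal to \<open>g\<close>; so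
  \<open>g\<close> is orthogonal to itself and is zero.\<close>

lemma conv_uniformly_approximable:
  assumes R: "unitary_dual_representatives R" and k: "cts k" "\<And>x. k (- x) = cnj (k x)"
    and f: "cts f"
  shows "\<exists>h. (\<forall>n::nat. h n \<in> coeff_span R) \<and> uniform_limit UNIV h (conv k f) sequentially"
proof -
  let ?M = "coeff_span R"
  note cM = coeff_span_cts[OF R]
  define V where "V = (\<lambda>h. nsq (\<lambda>x. f x - h x)) ` ?M"
  define \<delta> where "\<delta> = Inf V"
  have bdd: "bdd_below V" unfolding V_def by (intro bdd_belowI[of _ 0]) auto
  have Vne: "V \<noteq> {}" unfolding V_def using coeff_span.zero by blast
  have "\<forall>n. \<exists>h. h \<in> ?M \<and> nsq (\<lambda>x. f x - h x) < \<delta> + 1 / Suc n"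
  proof
    fix n
    have "\<exists>v\<in>V. v < \<delta> + 1 / Suc n"
      using cInf_less_iff[OF Vne bdd, of "\<delta> + 1 / Suc n"] by (simp add: \<delta>_def)
    then show "\<exists>h. h \<in> ?M \<and> nsq (\<lambda>x. f x - h x) < \<delta> + 1 / Suc n" unfolding V_def by blast
  qed
  from choice[OF this] obtain h where
    "\<forall>n. h n \<in> ?M \<and> nsq (\<lambda>x. f x - h n x) < \<delta> + 1 / Suc n" ..
  then have hM: "h n \<in> ?M" and h\<delta>: "nsq (\<lambda>x. f x - h n x) < \<delta> + 1 / Suc n" for n by simp_all
  define d where "d n = (\<lambda>x. f x - h n x)" for n
  have cd: "cts (d n)" for n unfolding d_def by (intro continuous_on_diff f cM hM)
  \<comment> \<open>Adding to \<open>h n\<close> the projection of \<open>d n\<close> onto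
    \<open>m\<close> cannot lower the squared distance below \<delta>; the gain computed in
    \<open>nsq_residual\<close> is therefore at most the slack \<open>1 / Suc n\<close>.\<close>
  have near: "(cmod (ip (d n) m))\<^sup>2 \<le> nsq m / Suc n" if m: "m \<in> ?M" for n m
  proof (cases "nsq m = 0")
    case True
    then have "m = (\<lambda>x. 0)" using nsq_eq_0 cM m by blast
    then show ?thesis by simp
  next
    case False
    then have pos: "0 < nsq m" using nsq_nonneg[of m] by linarith
    let ?c = "ip (d n) m / complex_of_real (nsq m)"
    have "(\<lambda>x. h n x + ?c * m x) \<in> ?M" by (intro coeff_span.add coeff_span.scale hM m)
    then have "nsq (\<lambda>x. f x - (h n x + ?c * m x)) \<in> V" unfolding V_def by (rule imageI)
    then have "\<delta> \<le> nsq (\<lambda>x. f x - (h n x + ?c * m x))" unfolding \<delta>_def by (intro cInf_lower bdd)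
    also have "\<dots> = nsq (\<lambda>x. d n x - ?c * m x)" by (simp add: d_def diff_diff_eq)
    also have "\<dots> = nsq (d n) - (cmod (ip (d n) m))\<^sup>2 / nsq m"
      by (rule nsq_residual[OF cd cM[OF m] False])
    finally have "(cmod (ip (d n) m))\<^sup>2 / nsq m \<le> nsq (d n) - \<delta>" by simp
    also have "\<dots> \<le> 1 / Suc n" using h\<delta>[of n] by (simp add: d_def)
    finally show ?thesis using pos by (simp add: field_simps)
  qed
  have "nsq (d n) \<le> \<delta> + 1" for n
  proof -
    have "1 / real (Suc n) \<le> 1" by simp
    then show ?thesis using h\<delta>[of n] unfolding d_def by linarith
  qed
  obtain s :: "nat \<Rightarrow> nat" and g where
    s: "strict_mono s" and g: "cts g" and lim: "uniform_limit UNIV (\<lambda>n. conv k (d (s n))) g sequentially"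
    by (rule conv_compact[OF k(1) cd \<open>\<And>n. nsq (d n) \<le> \<delta> + 1\<close>])
  have cTd: "cts (conv k (d n))" for n by (intro cts_conv k cd)
  have "g \<in> orth ?M"
    unfolding orth_def
  proof (intro CollectI conjI ballI g)
    fix m assume m: "m \<in> ?M"
    have "conv k m \<in> ?M" by (rule coeff_span_conv[OF R k(1) m])
    have "(\<lambda>n. ip (conv k (d (s n))) m) \<longlonglongrightarrow> ip g m"
      by (rule ip_tendsto[OF lim cTd g cM[OF m]])
    moreover have "(\<lambda>n. ip (conv k (d (s n))) m) \<longlonglongrightarrow> 0"
    proof (rule tendsto_norm_zero_cancel, rule tendsto_sandwich[of "\<lambda>n. 0"])
      have "(\<lambda>n. sqrt (nsq (conv k m) * (1 / Suc n))) \<longlonglongrightarrow> sqrt (nsq (conv k m) * 0)"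
        by (intro tendsto_intros LIMSEQ_Suc[OF lim_1_over_n])
      then show "(\<lambda>n. sqrt (nsq (conv k m) * (1 / Suc n))) \<longlonglongrightarrow> 0" by simp
      have "cmod (ip (conv k (d (s n))) m) \<le> sqrt (nsq (conv k m) * (1 / Suc n))" for n
      proof (rule real_le_rsqrt)
        have "(cmod (ip (conv k (d (s n))) m))\<^sup>2 \<le> nsq (conv k m) / Suc (s n)"
          unfolding conv_symmetric[OF k cd cM[OF m]] by (rule near) fact
        also have "\<dots> \<le> nsq (conv k m) / Suc n"
          using strict_mono_imp_increasing[OF s] by (intro divide_left_mono) auto
        finally show "(cmod (ip (conv k (d (s n))) m))\<^sup>2 \<le> nsq (conv k m) * (1 / Suc n)" by simp
      qed
      then show "\<forall>\<^sub>F n in sequentially. cmod (ip (conv k (d (s n))) m) \<le> sqrt (nsq (conv k m) * (1 / Suc n))"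
        by simp
    qed auto
    ultimately show "ip g m = 0" by (rule LIMSEQ_unique)
  qed
  then have Tg: "conv k g = (\<lambda>x. 0)" by (rule conv_vanishes_on_orth[OF R k])
  have "(\<lambda>n. ip (conv k (d (s n))) g) \<longlonglongrightarrow> ip g g" by (rule ip_tendsto[OF lim cTd g g])
  moreover have "ip (conv k (d (s n))) g = 0" for n
    unfolding conv_symmetric[OF k cd g] Tg by simp
  ultimately have "ip g g = 0" by (simp add: LIMSEQ_const_iff)
  then have "g = (\<lambda>x. 0)" using nsq_eq_0[OF g] by (simp add: ip_self)
  have "conv k (d n) = (\<lambda>x. conv k f x - conv k (h n) x)" for n
    unfolding d_def by (rule conv_diff[OF k(1) f cM[OF hM]])
  with lim \<open>g = _\<close> have "uniform_limit UNIV (\<lambda>n x. conv k f x - conv k (h (s n)) x) (\<lambda>x. 0) sequentially"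
    by simp
  then have "uniform_limit UNIV (\<lambda>n. conv k (h (s n))) (conv k f) sequentially"
    by (simp add: uniform_limit_iff dist_norm norm_minus_commute)
  moreover have "conv k (h (s n)) \<in> ?M" for n by (rule coeff_span_conv[OF R k(1) hM])
  ultimately show ?thesis by (intro exI[of _ "\<lambda>n. conv k (h (s n))"]) simp
qed

section \<open>Approximate identities and uniform density\<close>

lemma urysohn:
  fixes S T :: "'g set"
  assumes "closed S" "closed T" "S \<inter> T = {}"
  shows "\<exists>u :: 'g \<Rightarrow> real. cts u \<and> (\<forall>x. 0 \<le> u x \<and> u x \<le> 1) \<and>
    (\<forall>x\<in>S. u x = 0) \<and> (\<forall>x\<in>T. u x = 1)"
proof -
  have "Hausdorff_space (euclidean :: 'g topology)"
    unfolding Hausdorff_space_def disjnt_def by (simp add: separation_t2)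
  moreover have "compact_space (euclidean :: 'g topology)"
    using compact_group by (simp add: compact_space_def)
  ultimately have "normal_space (euclidean :: 'g topology)"
    by (intro compact_Hausdorff_or_regular_imp_normal_space) auto
  then obtain u where u: "continuous_map euclidean (top_of_set {0..1::real}) u"
      "u ` S \<subseteq> {0}" "u ` T \<subseteq> {1}"
    using Urysohn_lemma[of "euclidean :: 'g topology" S T 0 1] assms by (auto simp: disjnt_def)
  then have "cts u" "u \<in> UNIV \<rightarrow> {0..1}" by (auto simp: continuous_map_in_subtopology)
  then show ?thesis using u(2,3) by (intro exI[of _ u]) (auto simp: Pi_iff)
qed

lemma approximate_identity:
  fixes f :: "'g \<Rightarrow> complex"
  assumes f: "cts f" and e: "0 < e"
  shows "\<exists>k. cts k \<and> (\<forall>x. k (- x) = cnj (k x)) \<and> (\<forall>x. cmod (conv k f x - f x) \<le> e)"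
proof -
  obtain V where V: "open V" "0 \<in> V" "\<And>x v. v \<in> V \<Longrightarrow> cmod (f (x + v) - f x) \<le> e"
    using cts_uniform[OF f e] by blast
  have "closed (- V)" "closed {0::'g}" "- V \<inter> {0} = {}" using V by auto
  from urysohn[OF this] obtain u :: "'g \<Rightarrow> real" where
    "cts u \<and> (\<forall>x. 0 \<le> u x \<and> u x \<le> 1) \<and> (\<forall>x\<in>- V. u x = 0) \<and> (\<forall>x\<in>{0}. u x = 1)" ..
  then have u: "cts u" "0 \<le> u x" "u x \<le> 1" "x \<in> - V \<Longrightarrow> u x = 0" "u 0 = 1" for x
    by simp_all
  \<comment> \<open>Multiplying by the reflected function makes the real bump even, hence a
    hermitian kernel, while it still vanishes outside \<open>V\<close> and equals 1 at 0.\<close>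
  define w where "w x = u x * u (- x)" for x
  have cu: "cts (\<lambda>x. u (- x))"
    by (rule continuous_on_compose2[OF u(1)]) (auto intro!: continuous_intros)
  have cw: "cts w" unfolding w_def by (intro continuous_on_mult u cu)
  have w01: "0 \<le> w x" "w x \<le> 1" for x
    unfolding w_def using u(2,3) by (simp_all add: mult_le_one)
  have wV: "w x = 0" if "x \<notin> V" for x using u(4)[of x] that by (simp add: w_def)
  have wsym: "w (- x) = w x" for x by (simp add: w_def mult.commute)
  define c where "c = (LINT x|\<mu>. w x)"
  \<comment> \<open>Positivity of the integral \<open>c\<close> comes through the square:
    \<open>w\<close> is nonzero and continuous, and its square is at most \<open>w\<close> because
    its values lie between 0 and 1.\<close>
  have "nsq (\<lambda>x. complex_of_real (w x)) \<noteq> 0"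
  proof
    assume "nsq (\<lambda>x. complex_of_real (w x)) = 0"
    then have "(\<lambda>x. complex_of_real (w x)) = (\<lambda>x. 0)"
      using cw by (intro nsq_eq_0 continuous_on_of_real) auto
    from fun_cong[OF this, of 0] show False using u(5) by (simp add: w_def)
  qed
  then have "0 < nsq (\<lambda>x. complex_of_real (w x))" using nsq_nonneg order_le_less by metis
  also have "\<dots> \<le> c"
    unfolding nsq_def c_def
  proof (intro integral_mono)
    show "(cmod (complex_of_real (w x)))\<^sup>2 \<le> w x" for x
      using w01[of x] by (simp add: power2_eq_square mult_left_le)
  qed (use cw in \<open>auto intro!: integrable_cts continuous_intros\<close>)
  finally have c: "0 < c" .
  define k where "k x = complex_of_real (w x / c)" for x
  have ck: "cts k" unfolding k_def using cw c by (auto intro!: continuous_intros)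
  have ksym: "k (- x) = cnj (k x)" for x by (simp add: k_def wsym)
  have cwt: "cts (\<lambda>y. w (- y + x))" for x
    by (rule continuous_on_compose2[OF cw]) (auto intro!: continuous_intros)
  have int1: "(LINT y|\<mu>. w (- y + x)) = c" for x
  proof -
    \<comment> \<open>Evenness replaces \<open>- y + x\<close> by \<open>- x + y\<close>, a left
      translate of \<open>y\<close>, to which invariance of the measure applies directly.\<close>
    have "w (- y + x) = w (- x + y)" for y using wsym[of "- y + x"] by (simp add: minus_add)
    then show ?thesis
      using integral_translate[OF cts_measurable[OF cw], of "- x"] by (simp add: c_def)
  qed
  have "cmod (conv k f x - f x) \<le> e" for x
  proof -
    have cf: "cts (\<lambda>y. (f y - f x) * k (- y + x))"
      by (intro continuous_on_mult continuous_on_diff f continuous_on_const cts_kernel ck)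
    have "(CLINT y|\<mu>. k (- y + x)) = 1"
      unfolding k_def using c int1[of x] by simp
    then have "f x = (CLINT y|\<mu>. f x * k (- y + x))" by simp
    then have "conv k f x - f x = (CLINT y|\<mu>. f y * k (- y + x)) - (CLINT y|\<mu>. f x * k (- y + x))"
      by (simp add: conv_def)
    also have "\<dots> = (CLINT y|\<mu>. (f y - f x) * k (- y + x))"
      unfolding left_diff_distrib
      by (intro Bochner_Integration.integral_diff[symmetric] integrable_cts continuous_on_mult f
          continuous_on_const cts_kernel ck)
    also have "cmod \<dots> \<le> (LINT y|\<mu>. cmod ((f y - f x) * k (- y + x)))" by (rule integral_norm_bound)
    also have "\<dots> \<le> (LINT y|\<mu>. e / c * w (- y + x))"
    proof (intro integral_mono integrable_cts continuous_on_norm cf)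
      fix y
      show "cmod ((f y - f x) * k (- y + x)) \<le> e / c * w (- y + x)"
      proof (cases "- y + x \<in> V")
        case True
        have "cmod (f y - f x) \<le> e" using V(3)[OF True, of y] by (simp add: norm_minus_commute)
        then have "cmod (f y - f x) * (w (- y + x) / c) \<le> e * (w (- y + x) / c)"
          using w01 c by (intro mult_right_mono) auto
        then show ?thesis using w01[of "- y + x"] c by (simp add: norm_mult norm_divide k_def)
      qed (simp add: wV k_def)
    qed (use cwt c in \<open>auto intro!: continuous_intros\<close>)
    also have "\<dots> = e" using int1[of x] c by simp
    finally show ?thesis .
  qed
  then show ?thesis using ck ksym by (intro exI[of _ k] conjI allI)
qed

theorem coeff_span_uniformly_dense:
  assumes R: "unitary_dual_representatives R" and f: "cts f" and e: "0 < e"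
  shows "\<exists>h\<in>coeff_span R. \<forall>x. cmod (f x - h x) < e"
proof -
  have e2: "0 < e / 2" using e by simp
  obtain k where
    "cts k \<and> (\<forall>x. k (- x) = cnj (k x)) \<and> (\<forall>x. cmod (conv k f x - f x) \<le> e / 2)"
    using approximate_identity[OF f e2] ..
  then have k: "cts k" "k (- x) = cnj (k x)" "cmod (conv k f x - f x) \<le> e / 2" for x by simp_all
  obtain h where "(\<forall>n::nat. h n \<in> coeff_span R) \<and> uniform_limit UNIV h (conv k f) sequentially"
    using conv_uniformly_approximable[OF R k(1,2) f] ..
  then have h: "\<forall>n::nat. h n \<in> coeff_span R" "uniform_limit UNIV h (conv k f) sequentially"
    by simp_all
  obtain n where n: "\<And>x. dist (h n x) (conv k f x) < e / 2"
    using uniform_limitD[OF h(2) e2] by (auto simp: eventually_sequentially)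
  have "cmod (f x - h n x) < e" for x
    using n[of x] k(3)[of x] dist_triangle[of "f x" "h n x" "conv k f x"]
    by (simp add: dist_norm norm_minus_commute)
  then show ?thesis using h(1) by blast
qed

section \<open>Density in Lebesgue spaces\<close>

lemma Lp_space_bounded:
  assumes "f \<in> borel_measurable \<mu>" "\<And>x. cmod (f x) \<le> B" "0 < p"
  shows "f \<in> Lp_space \<mu> p"
  by (rule Lp_space_dominated[of _ _ "\<lambda>x. B powr p"]) (use assms in \<open>auto intro: powr_mono2\<close>)

lemma Lp_space_cts:
  fixes f :: "'g \<Rightarrow> complex"
  assumes "cts f" "0 < p"
  shows "f \<in> Lp_space \<mu> p"
proof -
  obtain B where "\<And>x. cmod (f x) \<le> B" using cts_bounded[OF assms(1)] by metis
  then show ?thesis using assms by (intro Lp_space_bounded cts_measurable)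
qed

lemma Lp_norm_bounded:
  assumes "\<And>x. cmod (f x) \<le> B" "0 < p"
  shows "Lp_norm \<mu> p f \<le> B"
proof -
  have B: "0 \<le> B" using assms(1)[of undefined] norm_ge_zero order_trans by blast
  have "norm (LINT x|\<mu>. cmod (f x) powr p) \<le> B powr p"
    using assms by (intro integral_norm_le) (auto intro: powr_mono2)
  then show ?thesis using B assms by (simp add: Lp_norm_le_iff)
qed

definition approximable :: "real \<Rightarrow> ('g \<Rightarrow> complex) \<Rightarrow> bool" where
  "approximable p f \<longleftrightarrow> f \<in> Lp_space \<mu> p \<and> (\<forall>e>0. \<exists>h. cts h \<and> Lp_norm \<mu> p (\<lambda>x. f x - h x) < e)"

lemma approximableD:
  assumes "approximable p f"
  shows "f \<in> Lp_space \<mu> p" "0 < e \<Longrightarrow> \<exists>h. cts h \<and> Lp_norm \<mu> p (\<lambda>x. f x - h x) < e"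
  using assms by (auto simp: approximable_def)

lemma approximable_limit:
  assumes p: "1 \<le> p" and f: "f \<in> Lp_space \<mu> p" and F: "\<And>n::nat. approximable p (F n)"
    and lim: "(\<lambda>n. Lp_norm \<mu> p (\<lambda>x. f x - F n x)) \<longlonglongrightarrow> 0"
  shows "approximable p f"
  unfolding approximable_def
proof (intro conjI f allI impI)
  fix e :: real assume "0 < e"
  then have e2: "0 < e / 2" by simp
  obtain n where n: "Lp_norm \<mu> p (\<lambda>x. f x - F n x) < e / 2"
    using order_tendstoD(2)[OF lim e2] by (auto simp: eventually_sequentially)
  obtain h where h: "cts h" "Lp_norm \<mu> p (\<lambda>x. F n x - h x) < e / 2"
    using approximableD(2)[OF F e2] by blast
  have "Lp_norm \<mu> p (\<lambda>x. (f x - F n x) + (F n x - h x)) \<le>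
      Lp_norm \<mu> p (\<lambda>x. f x - F n x) + Lp_norm \<mu> p (\<lambda>x. F n x - h x)"
    using p by (intro Lp_norm_triangle Lp_space_diff f approximableD(1)[OF F] Lp_space_cts h) auto
  then have "Lp_norm \<mu> p (\<lambda>x. f x - h x) < e" using n h(2) by simp
  then show "\<exists>h. cts h \<and> Lp_norm \<mu> p (\<lambda>x. f x - h x) < e" using h by blast
qed

lemma approximable_add:
  assumes p: "1 \<le> p" and f: "approximable p f" and g: "approximable p g"
  shows "approximable p (\<lambda>x. f x + g x)"
  unfolding approximable_def
proof (intro conjI allI impI)
  note fg = approximableD(1)[OF f] approximableD(1)[OF g]
  show "(\<lambda>x. f x + g x) \<in> Lp_space \<mu> p" using p by (intro Lp_space_add fg) auto
  fix e :: real assume "0 < e"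
  then have e2: "0 < e / 2" by simp
  obtain a where a: "cts a" "Lp_norm \<mu> p (\<lambda>x. f x - a x) < e / 2"
    using approximableD(2)[OF f e2] by blast
  obtain b where b: "cts b" "Lp_norm \<mu> p (\<lambda>x. g x - b x) < e / 2"
    using approximableD(2)[OF g e2] by blast
  have "Lp_norm \<mu> p (\<lambda>x. (f x - a x) + (g x - b x)) \<le>
      Lp_norm \<mu> p (\<lambda>x. f x - a x) + Lp_norm \<mu> p (\<lambda>x. g x - b x)"
    using p by (intro Lp_norm_triangle Lp_space_diff fg Lp_space_cts a b) auto
  then have "Lp_norm \<mu> p (\<lambda>x. f x + g x - (a x + b x)) < e"
    using a(2) b(2) by (simp add: algebra_simps)
  then show "\<exists>h. cts h \<and> Lp_norm \<mu> p (\<lambda>x. f x + g x - h x) < e"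
    by (intro exI[of _ "\<lambda>x. a x + b x"] conjI continuous_on_add a b)
qed

lemma approximable_scale:
  assumes p: "1 \<le> p" and f: "approximable p f"
  shows "approximable p (\<lambda>x. c * f x)"
  unfolding approximable_def
proof (intro conjI allI impI)
  show "(\<lambda>x. c * f x) \<in> Lp_space \<mu> p" by (intro Lp_space_scale approximableD(1)[OF f])
  fix e :: real assume e: "0 < e"
  have c: "0 < cmod c + 1" by (simp add: add_nonneg_pos)
  then have "0 < e / (cmod c + 1)" using e by simp
  from approximableD(2)[OF f this]
  obtain a where a: "cts a" "Lp_norm \<mu> p (\<lambda>x. f x - a x) < e / (cmod c + 1)" by blast
  have "Lp_norm \<mu> p (\<lambda>x. c * f x - c * a x) = cmod c * Lp_norm \<mu> p (\<lambda>x. f x - a x)"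
    using p by (subst Lp_norm_scale[symmetric]) (auto simp: right_diff_distrib)
  also have "\<dots> \<le> (cmod c + 1) * Lp_norm \<mu> p (\<lambda>x. f x - a x)"
    by (intro mult_right_mono Lp_norm_nonneg) simp
  also have "\<dots> < e" using a(2) c by (simp add: field_simps)
  finally show "\<exists>h. cts h \<and> Lp_norm \<mu> p (\<lambda>x. c * f x - h x) < e"
    by (intro exI[of _ "\<lambda>x. c * a x"] conjI continuous_on_mult continuous_on_const a)
qed

lemma Lp_tendsto_dominated:
  fixes f :: "'g \<Rightarrow> complex"
  assumes p: "1 \<le> p" and f: "f \<in> borel_measurable \<mu>" and F: "\<And>n::nat. F n \<in> borel_measurable \<mu>"
    and dom: "\<And>n x. cmod (f x - F n x) powr p \<le> h x" "integrable \<mu> h"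
    and lim: "\<And>x. (\<lambda>n. F n x) \<longlonglongrightarrow> f x"
  shows "(\<lambda>n. Lp_norm \<mu> p (\<lambda>x. f x - F n x)) \<longlonglongrightarrow> 0"
proof -
  have "(\<lambda>n. LINT x|\<mu>. cmod (f x - F n x) powr p) \<longlonglongrightarrow> (LINT x|\<mu>. 0)"
  proof (rule integral_dominated_convergence[OF _ _ dom(2)])
    show "(\<lambda>x. cmod (f x - F n x) powr p) \<in> borel_measurable \<mu>" for n using f F by measurable
    have "(\<lambda>n. cmod (f x - F n x)) \<longlonglongrightarrow> cmod (f x - f x)" for x
      by (intro tendsto_intros lim)
    then have "(\<lambda>n. cmod (f x - F n x) powr p) \<longlonglongrightarrow> 0 powr p" for x
      using p by (intro tendsto_powr') auto
    then show "AE x in \<mu>. (\<lambda>n. cmod (f x - F n x) powr p) \<longlonglongrightarrow> 0" using p by simp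
    show "AE x in \<mu>. norm (cmod (f x - F n x) powr p) \<le> h x" for n using dom(1) by simp
  qed simp
  then have "(\<lambda>n. (LINT x|\<mu>. cmod (f x - F n x) powr p) powr (1 / p)) \<longlonglongrightarrow> 0 powr (1 / p)"
    using p by (intro tendsto_powr') auto
  then show ?thesis by (simp add: Lp_norm_def)
qed

text \<open>Open sets are countable unions of closed ones: a Urysohn function separating
  \<open>x\<close> from the complement of \<open>U\<close> yields a basic neighbourhood of
  \<open>x\<close> whose closure stays in \<open>U\<close>. Finite unions over an enumeration make
  the sequence increasing.\<close>

lemma open_increasing_closed:
  fixes U :: "'g set"
  assumes "open U"
  shows "\<exists>K :: nat \<Rightarrow> 'g set. (\<forall>n. closed (K n) \<and> K n \<subseteq> U) \<and> (\<forall>x\<in>U. \<exists>N. \<forall>n\<ge>N. x \<in> K n)"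
proof -
  obtain \<B> :: "'g set set" where \<B>: "countable \<B>" "topological_basis \<B>"
    using ex_countable_basis by blast
  \<comment> \<open>The empty set keeps the family nonempty, so that it is the range of a
    sequence.\<close>
  define \<C> where "\<C> = insert {} {B \<in> \<B>. closure B \<subseteq> U}"
  have "countable \<C>" "\<C> \<noteq> {}" using \<B>(1) by (auto simp: \<C>_def)
  then obtain c :: "nat \<Rightarrow> 'g set" where c: "range c = \<C>" using uncountable_def by metis
  define K where "K n = (\<Union>i\<le>n. closure (c i))" for n
  have "closure (c i) \<subseteq> U" for i using c rangeI[of c i] by (auto simp: \<C>_def)
  then have "K n \<subseteq> U" for n by (auto simp: K_def)
  moreover have "closed (K n)" for n by (auto simp: K_def)
  moreover have "\<exists>N. \<forall>n\<ge>N. x \<in> K n" if x: "x \<in> U" for x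
  proof -
    have "closed (- U)" "closed {x}" "- U \<inter> {x} = {}" using assms x by auto
    from urysohn[OF this] obtain u :: "'g \<Rightarrow> real" where
      "cts u \<and> (\<forall>y. 0 \<le> u y \<and> u y \<le> 1) \<and> (\<forall>y\<in>- U. u y = 0) \<and> (\<forall>y\<in>{x}. u y = 1)" ..
    then have u: "cts u" "y \<in> - U \<Longrightarrow> u y = 0" "u x = 1" for y by simp_all
    have "open {y. 1/2 < u y}" "closed {y. 1/2 \<le> u y}"
      using u(1) by (auto intro!: open_Collect_less closed_Collect_le continuous_intros)
    moreover have "x \<in> {y. 1/2 < u y}" using u(3) by simp
    ultimately obtain B where B: "B \<in> \<B>" "x \<in> B" "B \<subseteq> {y. 1/2 < u y}"
      using topological_basisE[OF \<B>(2)] by metis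
    have "closure B \<subseteq> {y. 1/2 \<le> u y}"
      using B(3) \<open>closed {y. 1/2 \<le> u y}\<close> by (intro closure_minimal) auto
    also have "\<dots> \<subseteq> U" using u(2) by force
    finally have "B \<in> \<C>" using B by (simp add: \<C>_def)
    then obtain N where "B = c N" using c by blast
    then have "x \<in> K n" if "N \<le> n" for n
      using that B(2) closure_subset[of B] unfolding K_def by blast
    then show ?thesis by blast
  qed
  ultimately show ?thesis by (intro exI[of _ K] conjI allI ballI)
qed

text \<open>Induction over the sigma-algebra from the intersection-stable family of open sets. For
  open \<open>U\<close>, Urysohn functions that are 1 on the closed \<open>K n\<close> and 0 off
  \<open>U\<close> converge pointwise to the indicator; complements and disjoint unions follow by
  linearity and dominated convergence.\<close>

lemma approximable_indicator:
  assumes p: "1 \<le> p" and "B \<in> sets borel"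
  shows "approximable p (\<lambda>x. indicator B x)"
proof -
  have ind: "(\<lambda>x. indicator B x :: complex) \<in> Lp_space \<mu> p" if "B \<in> sets borel" for B
    using that p by (intro Lp_space_bounded[of _ 1]) (auto simp: indicator_def measurable_haar)
  have self: "approximable p f" if "cts f" for f
    unfolding approximable_def using that Lp_space_cts[OF that, of p] p
    by (auto intro!: exI[of _ f] simp: Lp_norm_zero)
  have "Int_stable (Collect open :: 'g set set)" "Collect open \<subseteq> Pow (UNIV :: 'g set)"
    by (auto simp: Int_stable_def)
  moreover have "B \<in> sigma_sets UNIV (Collect open)" using assms(2) by (simp add: borel_def)
  ultimately show ?thesis
  proof (induction rule: sigma_sets_induct_disjoint)
    case (basic U)
    then have U: "open U" by simp
    obtain K :: "nat \<Rightarrow> 'g set" where "(\<forall>n. closed (K n) \<and> K n \<subseteq> U) \<and> (\<forall>x\<in>U. \<exists>N. \<forall>n\<ge>N. x \<in> K n)"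
      using open_increasing_closed[OF U] ..
    then have K: "closed (K n)" "K n \<subseteq> U" "x \<in> U \<Longrightarrow> \<exists>N. \<forall>n\<ge>N. x \<in> K n" for n x by simp_all
    have "\<forall>n. \<exists>u :: 'g \<Rightarrow> real. cts u \<and> (\<forall>x. 0 \<le> u x \<and> u x \<le> 1) \<and>
        (\<forall>x\<in>- U. u x = 0) \<and> (\<forall>x\<in>K n. u x = 1)"
    proof
      fix n
      have "closed (- U)" "- U \<inter> K n = {}" using U K(2)[of n] by auto
      from urysohn[OF this(1) K(1) this(2)]
      show "\<exists>u :: 'g \<Rightarrow> real. cts u \<and> (\<forall>x. 0 \<le> u x \<and> u x \<le> 1) \<and>
        (\<forall>x\<in>- U. u x = 0) \<and> (\<forall>x\<in>K n. u x = 1)" .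
    qed
    from choice[OF this] obtain u :: "nat \<Rightarrow> 'g \<Rightarrow> real" where
      "\<forall>n. cts (u n) \<and> (\<forall>x. 0 \<le> u n x \<and> u n x \<le> 1) \<and>
        (\<forall>x\<in>- U. u n x = 0) \<and> (\<forall>x\<in>K n. u n x = 1)" ..
    then have u: "cts (u n)" "0 \<le> u n x" "u n x \<le> 1" "x \<notin> U \<Longrightarrow> u n x = 0" "x \<in> K n \<Longrightarrow> u n x = 1" for n x
      by simp_all
    let ?F = "\<lambda>n x. complex_of_real (u n x)"
    have cF: "cts (?F n)" for n by (intro continuous_on_of_real u)
    show ?case
    proof (rule approximable_limit[OF p ind self[OF cF]])
      show "U \<in> sets borel" using U by simp
      show "(\<lambda>n. Lp_norm \<mu> p (\<lambda>x. indicator U x - ?F n x)) \<longlonglongrightarrow> 0"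
      proof (rule Lp_tendsto_dominated[OF p _ cts_measurable[OF cF]])
        show "(\<lambda>x. indicator U x) \<in> borel_measurable \<mu>" using U by (simp add: measurable_haar)
        show "cmod (indicator U x - ?F n x) powr p \<le> 1" for n x
        proof -
          have "indicator U x - ?F n x = complex_of_real (indicator U x - u n x)"
            by (simp add: indicator_def)
          then have "cmod (indicator U x - ?F n x) = \<bar>indicator U x - u n x\<bar>"
            by (simp only: norm_of_real)
          also have "\<dots> \<le> 1" using u(2,3)[of n x] by (simp add: indicator_def)
          finally have "cmod (indicator U x - ?F n x) powr p \<le> 1 powr p"
            using p by (intro powr_mono2) auto
          then show ?thesis by simp
        qed
        show "(\<lambda>n. ?F n x) \<longlonglongrightarrow> indicator U x" for x
        proof (cases "x \<in> U")
          case True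
          then obtain N where "\<forall>n\<ge>N. x \<in> K n" using K(3) by blast
          then have "\<forall>\<^sub>F n in sequentially. ?F n x = 1"
            using u(5) by (auto simp: eventually_sequentially)
          then show ?thesis using True by (simp add: tendsto_eventually)
        qed (use u(4) in simp)
      qed simp
    qed
  next
    case empty
    show ?case using self[of "\<lambda>x. 0"] by (simp add: continuous_on_const)
  next
    case (compl A)
    have "approximable p (\<lambda>x. 1 + (- 1) * indicator A x)"
      by (intro approximable_add[OF p] approximable_scale[OF p] self compl continuous_on_const)
    moreover have "(\<lambda>x. 1 + (- 1) * indicator A x) = (\<lambda>x. indicator (UNIV - A) x :: complex)"
      by (auto simp: indicator_def)
    ultimately show ?case by (simp only:)
  next
    case (union A)
    have Ab: "A i \<in> sets borel" for i using union(2) by (auto simp: borel_def)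
    let ?F = "\<lambda>n x. \<Sum>i<n. indicator (A i) x :: complex"
    have F: "?F n x = indicator (\<Union>i<n. A i) x" for n x
      using union(1) by (subst indicator_UN_disjoint) (auto simp: disjoint_family_on_def)
    have apF: "approximable p (?F n)" for n
    proof (induction n)
      case 0
      show ?case using self[of "\<lambda>x. 0"] by (simp add: continuous_on_const)
    next
      case (Suc n)
      show ?case using approximable_add[OF p Suc union(3)[of n]] by simp
    qed
    show ?case
    proof (rule approximable_limit[OF p ind apF])
      show UA: "(\<Union>i. A i) \<in> sets borel" using Ab by blast
      show "(\<lambda>n. Lp_norm \<mu> p (\<lambda>x. indicator (\<Union>i. A i) x - ?F n x)) \<longlonglongrightarrow> 0"
        unfolding F
      proof (rule Lp_tendsto_dominated[OF p])
        show "(\<lambda>x. indicator (\<Union>i. A i) x) \<in> borel_measurable \<mu>" using UA by (simp add: measurable_haar)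
        show "(\<lambda>x. indicator (\<Union>i<n. A i) x) \<in> borel_measurable \<mu>" for n
          using Ab by (simp add: measurable_haar sets.finite_UN)
        show "cmod (indicator (\<Union>i. A i) x - indicator (\<Union>i<n. A i) x) powr p \<le> 1" for n x
          by (auto simp: indicator_def)
        show "(\<lambda>n. indicator (\<Union>i<n. A i) x) \<longlonglongrightarrow> (indicator (\<Union>i. A i) x :: complex)" for x
          by (rule LIMSEQ_indicator_UN)
      qed simp
    qed
  qed
qed

lemma approximable_Lp:
  assumes p: "1 \<le> p" and f: "f \<in> Lp_space \<mu> p"
  shows "approximable p f"
proof -
  have zero: "approximable p (\<lambda>x. 0)"
    using approximable_indicator[OF p, of "{}"] by simp
  have mf: "f \<in> borel_measurable \<mu>" using f by (rule Lp_space_measurable)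
  obtain F where F: "\<And>i. simple_function \<mu> (F i)" "\<And>x. (\<lambda>i. F i x) \<longlonglongrightarrow> f x"
    "\<And>i x. dist (F i x) 0 \<le> 2 * dist (f x) 0"
    using borel_measurable_implies_sequence_metric[OF mf, of 0] by auto
  have apF: "approximable p (F n)" for n
  proof -
    have fin: "finite (range (F n))" using simple_functionD(1)[OF F(1)[of n]] by simp
    have "approximable p (\<lambda>x. \<Sum>y\<in>Y. y * indicator (F n -` {y}) x)" if "Y \<subseteq> range (F n)" "finite Y" for Y
      using that(2,1)
    proof (induction Y rule: finite_induct)
      case (insert y Y)
      have "F n -` {y} \<in> sets borel"
        using simple_functionD(2)[OF F(1)[of n], of "{y}"] by (simp add: sets_haar)
      then have y: "approximable p (\<lambda>x. y * indicator (F n -` {y}) x)"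
        by (intro approximable_scale[OF p] approximable_indicator p)
      have Y: "approximable p (\<lambda>x. \<Sum>y\<in>Y. y * indicator (F n -` {y}) x)"
        using insert by blast
      show ?case unfolding sum.insert[OF insert(1,2)] by (rule approximable_add[OF p y Y])
    qed (simp add: zero)
    from this[OF subset_refl fin]
    have "approximable p (\<lambda>x. \<Sum>y\<in>range (F n). y * indicator (F n -` {y}) x)" .
    moreover have "(\<Sum>y\<in>range (F n). y * indicator (F n -` {y}) x) = F n x" for x
    proof -
      have "(\<Sum>y\<in>range (F n). y * indicator (F n -` {y}) x) = (\<Sum>y\<in>range (F n). if y = F n x then y else 0)"
        by (intro sum.cong) (auto simp: indicator_def)
      then show ?thesis using fin by simp
    qed
    ultimately show ?thesis by simp
  qed
  show ?thesis
  proof (rule approximable_limit[OF p f apF Lp_tendsto_dominated[OF p mf _ _ _ F(2)]])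
    show "F n \<in> borel_measurable \<mu>" for n using F(1) by (rule borel_measurable_simple_function)
    \<comment> \<open>The simple functions satisfy |F_n| \<le> 2 |f|, so the error is at most 3
      |f|.\<close>
    show "integrable \<mu> (\<lambda>x. 3 powr p * cmod (f x) powr p)"
      using Lp_space_integrable[OF f] by simp
    fix n x
    have "cmod (f x - F n x) \<le> 3 * cmod (f x)"
      using norm_triangle_ineq4[of "f x" "F n x"] F(3)[of n x] by simp
    then have "cmod (f x - F n x) powr p \<le> (3 * cmod (f x)) powr p"
      using p by (intro powr_mono2) auto
    then show "cmod (f x - F n x) powr p \<le> 3 powr p * cmod (f x) powr p" by (simp add: powr_mult)
  qed
qed

theorem coeff_span_Lp_dense:
  assumes R: "unitary_dual_representatives R" and p: "1 \<le> p" and f: "f \<in> Lp_space \<mu> p" and e: "0 < e"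
  shows "\<exists>h\<in>coeff_span R. Lp_norm \<mu> p (\<lambda>x. f x - h x) < e"
proof -
  have e2: "0 < e / 2" using e by simp
  obtain g where g: "cts g" "Lp_norm \<mu> p (\<lambda>x. f x - g x) < e / 2"
    using approximableD(2)[OF approximable_Lp[OF p f] e2] by blast
  obtain h where h: "h \<in> coeff_span R" "\<And>x. cmod (g x - h x) < e / 2"
    using coeff_span_uniformly_dense[OF R g(1) e2] by blast
  have hL: "h \<in> Lp_space \<mu> p" using p by (intro Lp_space_cts coeff_span_cts[OF R h(1)]) auto
  have "Lp_norm \<mu> p (\<lambda>x. (f x - g x) + (g x - h x)) \<le>
      Lp_norm \<mu> p (\<lambda>x. f x - g x) + Lp_norm \<mu> p (\<lambda>x. g x - h x)"
    using p by (intro Lp_norm_triangle Lp_space_diff f Lp_space_cts[OF g(1)] hL) auto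
  moreover have "Lp_norm \<mu> p (\<lambda>x. g x - h x) \<le> e / 2"
    using p h(2) by (intro Lp_norm_bounded less_imp_le) auto
  ultimately have "Lp_norm \<mu> p (\<lambda>x. f x - h x) < e" using g(2) by simp
  then show ?thesis using h(1) by blast
qed

end

section \<open>Schatten norms of diagonal matrices\<close>

text \<open>The identity matrix provides one diagonalisation. For any other, with unitary
  \<open>U\<close> and eigenvalues \<open>f\<close>, comparing entries gives e_i U_ij = U_ij f_j. So
  \<open>e i = f j\<close> wherever the entry of \<open>U\<close> is nonzero, and the relation
  survives taking powers; this is the uniqueness that \<open>THE\<close> asks for.\<close>

lemma psd_powr_mat_diag:
  assumes e: "\<And>i. i < d \<Longrightarrow> 0 \<le> e i"
  shows "psd_powr (mat_diag d (\<lambda>i. complex_of_real (e i))) s =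
    mat_diag d (\<lambda>i. complex_of_real (e i powr s))"
proof -
  let ?diag = "\<lambda>e. mat_diag d (\<lambda>i. complex_of_real (e i))"
  have D: "?diag f \<in> carrier_mat d d" for f by simp
  have dim: "dim_row (?diag e) = d" by (simp add: mat_diag_def)
  show ?thesis
    unfolding psd_powr_def dim
  proof (rule the_equality)
    have "unitary_mat d (1\<^sub>m d)" by (simp add: unitary_mat_def)
    moreover have "1\<^sub>m d * ?diag f * mat_adjoint (1\<^sub>m d) = ?diag f" for f
      by (simp only: left_mult_one_mat[OF D] right_mult_one_mat[OF D] mat_adjoint_one)
    ultimately show "\<exists>U f. unitary_mat d U \<and> (\<forall>i<d. 0 \<le> f i) \<and>
        ?diag e = U * ?diag f * mat_adjoint U \<and>
        ?diag (\<lambda>i. e i powr s) = U * ?diag (\<lambda>i. f i powr s) * mat_adjoint U"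
      using e by (intro exI[of _ "1\<^sub>m d"] exI[of _ e]) simp
  next
    fix Q
    assume "\<exists>U f. unitary_mat d U \<and> (\<forall>i<d. 0 \<le> f i) \<and>
        ?diag e = U * ?diag f * mat_adjoint U \<and> Q = U * ?diag (\<lambda>i. f i powr s) * mat_adjoint U"
    then obtain U f where U: "unitary_mat d U"
      and eq: "?diag e = U * ?diag f * mat_adjoint U"
      and Q: "Q = U * ?diag (\<lambda>i. f i powr s) * mat_adjoint U" by blast
    have cU: "U \<in> carrier_mat d d" "mat_adjoint U \<in> carrier_mat d d"
      and UU: "mat_adjoint U * U = 1\<^sub>m d" "U * mat_adjoint U = 1\<^sub>m d"
      using U by (auto simp: unitary_mat_def)
    have "?diag e * U = (U * ?diag f) * (mat_adjoint U * U)"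
      unfolding eq by (rule assoc_mult_mat[OF mult_carrier_mat[OF cU(1) D] cU(2,1)])
    also have "\<dots> = U * ?diag f"
      unfolding UU by (rule right_mult_one_mat[OF mult_carrier_mat[OF cU(1) D]])
    finally have comm: "?diag e * U = U * ?diag f" .
    have "complex_of_real (e i powr s) * U $$ (i, j) = U $$ (i, j) * complex_of_real (f j powr s)"
      if "i < d" "j < d" for i j
    proof -
      have "complex_of_real (e i) * U $$ (i, j) = U $$ (i, j) * complex_of_real (f j)"
        using arg_cong[OF comm, of "\<lambda>M. M $$ (i, j)"] that
        by (simp add: mat_diag_mult_left[OF cU(1)] mat_diag_mult_right[OF cU(1)])
      then show ?thesis by (cases "U $$ (i, j) = 0") auto
    qed
    then have "?diag (\<lambda>i. e i powr s) * U = U * ?diag (\<lambda>i. f i powr s)"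
      unfolding mat_diag_mult_left[OF cU(1)] mat_diag_mult_right[OF cU(1)]
      by (intro eq_matI) auto
    then have "Q = (?diag (\<lambda>i. e i powr s) * U) * mat_adjoint U" using Q by simp
    also have "\<dots> = ?diag (\<lambda>i. e i powr s) * (U * mat_adjoint U)"
      by (rule assoc_mult_mat[OF D cU])
    also have "\<dots> = ?diag (\<lambda>i. e i powr s)" unfolding UU by (rule right_mult_one_mat[OF D])
    finally show "Q = ?diag (\<lambda>i. e i powr s)" .
  qed
qed

lemma schatten_norm_diagonal:
  assumes S: "S \<in> carrier_mat d d" "diagonal_mat S" and r: "0 < r"
  shows "schatten_norm r S powr r = (\<Sum>i<d. cmod (S $$ (i, i)) powr r)"
proof -
  have diag: "S = mat_diag d (\<lambda>i. S $$ (i, i))"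
    using S by (intro eq_matI) (auto simp: mat_diag_def diagonal_mat_def)
  have "mat_adjoint S * S = mat_diag d (\<lambda>i. complex_of_real ((cmod (S $$ (i, i)))\<^sup>2))"
  proof (rule eq_matI)
    fix i j assume "i < dim_row (mat_diag d (\<lambda>i. complex_of_real ((cmod (S $$ (i, i)))\<^sup>2)))"
      "j < dim_col (mat_diag d (\<lambda>i. complex_of_real ((cmod (S $$ (i, i)))\<^sup>2)))"
    then have ij: "i < d" "j < d" by (auto simp: mat_diag_def)
    have "(mat_adjoint S * S) $$ (i, j) = (\<Sum>l<d. cnj (S $$ (l, i)) * S $$ (l, j))"
      using S(1) ij by (subst index_mult_mat_sum[OF mat_adjoint_carrier[OF S(1)] S(1)]) auto
    also have "\<dots> = (\<Sum>l<d. if l = i then cnj (S $$ (i, i)) * S $$ (i, j) else 0)"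
      using S ij by (intro sum.cong) (auto simp: diagonal_mat_def)
    also have "\<dots> = (if i = j then complex_of_real ((cmod (S $$ (i, i)))\<^sup>2) else 0)"
      using S ij complex_norm_square[of "S $$ (i, i)"] by (auto simp: diagonal_mat_def mult.commute)
    finally show "(mat_adjoint S * S) $$ (i, j) =
        mat_diag d (\<lambda>i. complex_of_real ((cmod (S $$ (i, i)))\<^sup>2)) $$ (i, j)"
      using ij by (simp add: mat_diag_def)
  qed (use S in \<open>auto simp: mat_diag_def\<close>)
  then have "mat_abs S = mat_diag d (\<lambda>i. complex_of_real ((cmod (S $$ (i, i)))\<^sup>2 powr (1 / 2)))"
    unfolding mat_abs_def by (simp only: psd_powr_mat_diag zero_le_power2)
  also have "\<dots> = mat_diag d (\<lambda>i. complex_of_real (cmod (S $$ (i, i))))"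
    by (simp add: powr_half_sqrt)
  finally have "psd_powr (mat_abs S) r = mat_diag d (\<lambda>i. complex_of_real (cmod (S $$ (i, i)) powr r))"
    by (simp only: psd_powr_mat_diag norm_ge_zero)
  then have "Re (mat_trace (psd_powr (mat_abs S) r)) = (\<Sum>i<d. cmod (S $$ (i, i)) powr r)"
    by (simp add: mat_trace_def mat_diag_def)
  then show ?thesis
    using r by (simp add: schatten_norm_def powr_powr sum_nonneg)
qed

section \<open>Nuclear expansions on a dense set\<close>

text \<open>Isolates the passage from a dense set to all of L^p. The numbers \<open>C n\<close> are
  explicit bounds for the functionals, so the supremum in \<open>dual_norm\<close> enters only when
  the conclusion is drawn.\<close>

locale nuclear_expansion =
  fixes \<mu> :: "'a measure" and \<nu> :: "'b measure" and p q r :: real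
    and A :: "('a \<Rightarrow> complex) \<Rightarrow> 'b \<Rightarrow> complex"
    and \<phi> :: "nat \<Rightarrow> ('a \<Rightarrow> complex) \<Rightarrow> complex" and y :: "nat \<Rightarrow> 'b \<Rightarrow> complex"
    and C :: "nat \<Rightarrow> real"
  assumes p: "1 \<le> p" and q: "1 \<le> q" and r: "0 < r" "r \<le> 1"
    and A: "bounded_operator (Lp_space \<mu> p) (Lp_norm \<mu> p) (Lp_space \<nu> q) (Lp_norm \<nu> q) A"
    and dual: "\<And>n. \<phi> n \<in> dual_space (Lp_space \<mu> p) (Lp_norm \<mu> p)"
    and y: "\<And>n. y n \<in> Lp_space \<nu> q"
    and \<phi>_bound: "\<And>n f. f \<in> Lp_space \<mu> p \<Longrightarrow> cmod (\<phi> n f) \<le> C n * Lp_norm \<mu> p f"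
    and C_nonneg: "\<And>n. 0 \<le> C n"
    and summable_r: "summable (\<lambda>n. (C n * Lp_norm \<nu> q (y n)) powr r)"
begin

abbreviation "E \<equiv> Lp_space \<mu> p"
abbreviation "NE \<equiv> Lp_norm \<mu> p"
abbreviation "F \<equiv> Lp_space \<nu> q"
abbreviation "NF \<equiv> Lp_norm \<nu> q"

lemma A_in: "f \<in> E \<Longrightarrow> A f \<in> F"
  and A_add: "f \<in> E \<Longrightarrow> g \<in> E \<Longrightarrow>
    NF (\<lambda>x. A (\<lambda>z. f z + g z) x - (A f x + A g x)) = 0"
  and A_scale: "f \<in> E \<Longrightarrow> NF (\<lambda>x. A (\<lambda>z. c * f z) x - c * A f x) = 0"
  using A by (auto simp: bounded_operator_def)

lemma \<phi>_add: "f \<in> E \<Longrightarrow> g \<in> E \<Longrightarrow> \<phi> n (\<lambda>z. f z + g z) = \<phi> n f + \<phi> n g"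
  and \<phi>_scale: "f \<in> E \<Longrightarrow> \<phi> n (\<lambda>z. c * f z) = c * \<phi> n f"
  using dual[of n] by (auto simp: dual_space_def)

definition partial_sum :: "nat \<Rightarrow> ('a \<Rightarrow> complex) \<Rightarrow> 'b \<Rightarrow> complex" where
  "partial_sum k f x = (\<Sum>n<k. \<phi> n f * y n x)"

definition expands :: "('a \<Rightarrow> complex) \<Rightarrow> bool" where
  "expands f \<longleftrightarrow> (\<lambda>k. NF (\<lambda>x. A f x - partial_sum k f x)) \<longlonglongrightarrow> 0"

lemma partial_sum_in: "partial_sum k f \<in> F"
  unfolding partial_sum_def[abs_def] using q by (intro Lp_space_sum Lp_space_scale y) auto

lemma error_in: "f \<in> E \<Longrightarrow> (\<lambda>x. A f x - partial_sum k f x) \<in> F"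
  using q by (intro Lp_space_diff A_in partial_sum_in) auto

lemma error_add:
  assumes f: "f \<in> E" and g: "g \<in> E"
  shows "NF (\<lambda>x. A (\<lambda>z. f z + g z) x - partial_sum k (\<lambda>z. f z + g z) x) \<le>
    NF (\<lambda>x. A f x - partial_sum k f x) + NF (\<lambda>x. A g x - partial_sum k g x)"
proof -
  have fg: "(\<lambda>z. f z + g z) \<in> E" using p by (intro Lp_space_add f g) auto
  have S: "partial_sum k (\<lambda>z. f z + g z) x = partial_sum k f x + partial_sum k g x" for x
    by (simp add: partial_sum_def \<phi>_add[OF f g] distrib_right sum.distrib)
  \<comment> \<open>\<open>?d\<close> is the additivity defect of \<open>A\<close>: the operator is
    additive only modulo functions of seminorm zero, so the defect is carried along as a third
    summand.\<close>
  let ?d = "\<lambda>x. A (\<lambda>z. f z + g z) x - (A f x + A g x)"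
  let ?f = "\<lambda>x. A f x - partial_sum k f x" and ?g = "\<lambda>x. A g x - partial_sum k g x"
  have q0: "0 < q" using q by simp
  have d: "?d \<in> F"
    by (intro Lp_space_diff Lp_space_add A_in f g fg q0)
  have s: "(\<lambda>x. ?f x + ?g x) \<in> F"
    by (intro Lp_space_add[OF _ _ q0] error_in f g)
  have "NF (\<lambda>x. ?d x + (?f x + ?g x)) \<le> NF ?d + NF (\<lambda>x. ?f x + ?g x)"
    by (rule Lp_norm_triangle[OF d s q])
  also have "\<dots> \<le> 0 + (NF ?f + NF ?g)"
    using A_add[OF f g] Lp_norm_triangle[OF error_in[OF f] error_in[OF g] q, of k k] by simp
  finally show ?thesis by (simp add: S algebra_simps)
qed

lemma expands_add:
  assumes f: "f \<in> E" "expands f" and g: "g \<in> E" "expands g"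
  shows "expands (\<lambda>z. f z + g z)"
  unfolding expands_def
proof (rule tendsto_sandwich[of "\<lambda>k. 0"])
  show "(\<lambda>k. NF (\<lambda>x. A f x - partial_sum k f x) +
      NF (\<lambda>x. A g x - partial_sum k g x)) \<longlonglongrightarrow> 0"
    using tendsto_add[OF f(2)[unfolded expands_def] g(2)[unfolded expands_def]] by simp
qed (use error_add[OF f(1) g(1)] in \<open>auto simp: Lp_norm_nonneg\<close>)

lemma expands_scale:
  assumes f: "f \<in> E" "expands f"
  shows "expands (\<lambda>z. c * f z)"
  unfolding expands_def
proof (rule tendsto_sandwich[of "\<lambda>k. 0"])
  have q0: "0 < q" using q by simp
  have cf: "(\<lambda>z. c * f z) \<in> E" by (rule Lp_space_scale[OF f(1)])
  show "(\<lambda>k. cmod c * NF (\<lambda>x. A f x - partial_sum k f x)) \<longlonglongrightarrow> 0"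
    using tendsto_mult[OF tendsto_const f(2)[unfolded expands_def], of "cmod c"] by simp
  have "NF (\<lambda>x. A (\<lambda>z. c * f z) x - partial_sum k (\<lambda>z. c * f z) x) \<le>
      cmod c * NF (\<lambda>x. A f x - partial_sum k f x)" for k
  proof -
    let ?d = "\<lambda>x. A (\<lambda>z. c * f z) x - c * A f x"
    let ?s = "\<lambda>x. c * (A f x - partial_sum k f x)"
    have S: "partial_sum k (\<lambda>z. c * f z) x = c * partial_sum k f x" for x
      by (simp add: partial_sum_def \<phi>_scale[OF f(1)] sum_distrib_left mult.assoc)
    have "NF (\<lambda>x. ?d x + ?s x) \<le> NF ?d + NF ?s"
      by (rule Lp_norm_triangle[OF _ _ q])
        (intro Lp_space_diff Lp_space_scale A_in f cf error_in q0)+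
    also have "\<dots> = cmod c * NF (\<lambda>x. A f x - partial_sum k f x)"
      using A_scale[OF f(1)] Lp_norm_scale[OF q0] by simp
    finally show ?thesis by (simp add: S algebra_simps)
  qed
  then show "\<forall>\<^sub>F k in sequentially. NF (\<lambda>x. A (\<lambda>z. c * f z) x - partial_sum k (\<lambda>z. c * f z) x)
      \<le> cmod c * NF (\<lambda>x. A f x - partial_sum k f x)" by simp
qed (auto simp: Lp_norm_nonneg)

text \<open>The image of the zero function is only known to have seminorm zero; this is the scaling
  law with factor 0.\<close>

lemma expands_zero: "expands (\<lambda>z. 0)"
proof -
  have "NF (A (\<lambda>z. 0)) = 0"
    using A_scale[OF Lp_space_zero, of 0] by simp
  moreover have "\<phi> n (\<lambda>z. 0) = 0" for n
    using \<phi>_scale[OF Lp_space_zero, of n 0] by simp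
  ultimately show ?thesis by (simp add: expands_def partial_sum_def)
qed

text \<open>The terms tend to 0, so they are eventually below 1, where t \<le> t^r because r \<le>
  1.\<close>

lemma summable_bound: "summable (\<lambda>n. C n * NF (y n))"
proof (rule summable_comparison_test_ev[OF _ summable_r])
  have "\<forall>\<^sub>F n in sequentially. (C n * NF (y n)) powr r < 1"
    using summable_LIMSEQ_zero[OF summable_r] by (rule order_tendstoD) simp
  then show "\<forall>\<^sub>F n in sequentially. norm (C n * NF (y n)) \<le> (C n * NF (y n)) powr r"
  proof eventually_elim
    case (elim n)
    let ?b = "C n * NF (y n)"
    have b: "0 \<le> ?b" using C_nonneg Lp_norm_nonneg by (intro mult_nonneg_nonneg)
    have "?b < 1"
    proof (rule ccontr)
      assume "\<not> ?b < 1"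
      then have "1 \<le> ?b powr r" using r by (intro ge_one_powr_ge_zero) auto
      then show False using elim by simp
    qed
    have "?b \<le> ?b powr r"
    proof (cases "?b = 0")
      case False
      then have "?b powr 1 \<le> ?b powr r" using b \<open>?b < 1\<close> r by (intro powr_mono') auto
      then show ?thesis using b by simp
    next
      case True
      then show ?thesis unfolding True by simp
    qed
    then show ?case using b by simp
  qed
qed

text \<open>The bound does not depend on \<open>k\<close>; together with the boundedness of
  \<open>A\<close> it makes the error operators equibounded.\<close>

lemma partial_sum_bound:
  assumes f: "f \<in> E"
  shows "NF (partial_sum k f) \<le> (\<Sum>n. C n * NF (y n)) * NE f"
proof -
  have "NF (partial_sum k f) \<le> (\<Sum>n<k. NF (\<lambda>x. \<phi> n f * y n x))"
    unfolding partial_sum_def[abs_def] by (intro Lp_norm_sum Lp_space_scale y q)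
  also have "\<dots> = (\<Sum>n<k. cmod (\<phi> n f) * NF (y n))"
    using q by (simp add: Lp_norm_scale)
  also have "\<dots> \<le> (\<Sum>n<k. (C n * NF (y n)) * NE f)"
  proof (rule sum_mono)
    fix n
    show "cmod (\<phi> n f) * NF (y n) \<le> (C n * NF (y n)) * NE f"
      using mult_right_mono[OF \<phi>_bound[OF f, of n] Lp_norm_nonneg[of \<nu> q "y n"]]
      by (simp add: mult_ac)
  qed
  also have "\<dots> \<le> (\<Sum>n. C n * NF (y n)) * NE f"
    unfolding sum_distrib_right[symmetric]
    by (intro mult_right_mono sum_le_suminf summable_bound)
      (auto intro: mult_nonneg_nonneg C_nonneg Lp_norm_nonneg)
  finally show ?thesis .
qed

text \<open>Approximate \<open>f\<close> by \<open>h\<close> in \<open>M\<close>: the error at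
  \<open>f - h\<close> is controlled by the equibound \<open>L\<close> for every \<open>k\<close>,
  and the error at \<open>h\<close> tends to 0.\<close>

lemma expands_of_dense:
  assumes dense: "\<And>f e. f \<in> E \<Longrightarrow> 0 < e \<Longrightarrow>
      \<exists>h\<in>M. h \<in> E \<and> NE (\<lambda>x. f x - h x) < e"
    and M: "\<And>h. h \<in> M \<Longrightarrow> expands h" and f: "f \<in> E"
  shows "expands f"
proof -
  obtain K where K: "\<And>f. f \<in> E \<Longrightarrow> NF (A f) \<le> K * NE f"
    using A unfolding bounded_operator_def by metis
  define B where "B = (\<Sum>n. C n * NF (y n))"
  \<comment> \<open>The constant \<open>K\<close> may be negative and the denominator below must be
    positive; hence the absolute values and the summand 1.\<close>
  define L where "L = \<bar>K\<bar> + \<bar>B\<bar> + 1"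
  have L: "0 < L" by (simp add: L_def)
  have bound: "NF (\<lambda>x. A g x - partial_sum k g x) \<le> L * NE g"
    if g: "g \<in> E" for g k
  proof -
    have "NF (\<lambda>x. A g x - partial_sum k g x) \<le> NF (A g) + NF (partial_sum k g)"
      by (rule Lp_norm_triangle_diff[OF A_in[OF g] partial_sum_in q])
    also have "\<dots> \<le> K * NE g + B * NE g"
      using K[OF g] partial_sum_bound[OF g, of k] by (simp add: B_def)
    also have "\<dots> = (K + B) * NE g" by (simp add: distrib_right)
    also have "\<dots> \<le> L * NE g"
      by (intro mult_right_mono Lp_norm_nonneg) (auto simp: L_def)
    finally show ?thesis .
  qed
  show ?thesis
    unfolding expands_def
  proof (rule LIMSEQ_I)
    fix e :: real assume e: "0 < e"
    then have "0 < e / (2 * L)" using L by simp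
    from dense[OF f this] obtain h where h: "h \<in> M" "h \<in> E"
      "NE (\<lambda>x. f x - h x) < e / (2 * L)" by blast
    have "0 < e / 2" using e by simp
    from order_tendstoD(2)[OF M[OF h(1), unfolded expands_def] this]
    obtain N where N: "\<And>k. N \<le> k \<Longrightarrow> NF (\<lambda>x. A h x - partial_sum k h x) < e / 2"
      by (auto simp: eventually_sequentially)
    have fh: "(\<lambda>x. f x - h x) \<in> E" using p by (intro Lp_space_diff f h) auto
    have "norm (NF (\<lambda>x. A f x - partial_sum k f x) - 0) < e" if "N \<le> k" for k
    proof -
      have "NF (\<lambda>x. A f x - partial_sum k f x) \<le>
          NF (\<lambda>x. A (\<lambda>z. f z - h z) x - partial_sum k (\<lambda>z. f z - h z) x) +
          NF (\<lambda>x. A h x - partial_sum k h x)"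
        using error_add[OF fh h(2), of k] by simp
      also have "\<dots> < L * (e / (2 * L)) + e / 2"
        using bound[OF fh, of k] N[OF that] mult_strict_left_mono[OF h(3) L] by linarith
      also have "\<dots> = e" using L by (simp add: field_simps)
      finally show ?thesis by (simp add: Lp_norm_nonneg)
    qed
    then show "\<exists>N. \<forall>k\<ge>N. norm (NF (\<lambda>x. A f x - partial_sum k f x) - 0) < e" by blast
  qed
qed

lemma dual_norm_bounds:
  "0 \<le> dual_norm E NE (\<phi> n)"
  "dual_norm E NE (\<phi> n) \<le> C n"
proof -
  let ?X = "{f \<in> E. NE f \<le> 1}"
  have z: "(\<lambda>x. 0) \<in> ?X" by (simp add: Lp_space_zero Lp_norm_zero)
  have le: "cmod (\<phi> n f) \<le> C n" if "f \<in> ?X" for f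
  proof -
    have "cmod (\<phi> n f) \<le> C n * NE f" using \<phi>_bound that by simp
    also have "\<dots> \<le> C n * 1" using that C_nonneg by (intro mult_left_mono) auto
    finally show ?thesis by simp
  qed
  then have bdd: "bdd_above ((\<lambda>f. cmod (\<phi> n f)) ` ?X)" by (intro bdd_aboveI2)
  have "cmod (\<phi> n (\<lambda>x. 0)) \<le> dual_norm E NE (\<phi> n)"
    unfolding dual_norm_def by (rule cSUP_upper[OF z bdd])
  then show "0 \<le> dual_norm E NE (\<phi> n)"
    using norm_ge_zero order_trans by blast
  show "dual_norm E NE (\<phi> n) \<le> C n"
    unfolding dual_norm_def using z le by (intro cSUP_least) auto
qed

lemma r_nuclear_of_expands:
  assumes "\<And>f. f \<in> E \<Longrightarrow> expands f"
  shows "r_nuclear r E NE F NF A"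
  unfolding r_nuclear_def
proof (intro exI[of _ \<phi>] exI[of _ y] conjI allI ballI dual y)
  show "(\<lambda>k. NF (\<lambda>x. A f x - (\<Sum>n<k. \<phi> n f * y n x))) \<longlonglongrightarrow> 0" if "f \<in> E" for f
    using assms[OF that] by (simp add: expands_def partial_sum_def)
  show "summable (\<lambda>n. dual_norm E NE (\<phi> n) powr r * NF (y n) powr r)"
  proof (rule summable_comparison_test'[OF summable_r, of 0])
    fix n :: nat
    have "dual_norm E NE (\<phi> n) powr r \<le> C n powr r"
      using dual_norm_bounds r by (intro powr_mono2) auto
    then show "norm (dual_norm E NE (\<phi> n) powr r * NF (y n) powr r)
        \<le> (C n * NF (y n)) powr r"
      using C_nonneg[of n] by (simp add: powr_mult Lp_norm_nonneg mult_right_mono)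
  qed
qed

end

section \<open>Multipliers with diagonal symbol\<close>

lemma unitary_entry_le_1:
  assumes U: "unitary_mat d U" and ij: "i < d" "j < d"
  shows "cmod (U $$ (i, j)) \<le> 1"
proof -
  note c = unitary_mat_carrier[OF U]
  have "1 = (U * mat_adjoint U) $$ (i, i)" using U ij by (simp add: unitary_mat_def)
  also have "\<dots> = (\<Sum>l<d. U $$ (i, l) * cnj (U $$ (i, l)))"
    using c ij by (subst index_mult_mat_sum[OF c mat_adjoint_carrier[OF c]]) (auto intro!: sum.cong)
  also have "\<dots> = complex_of_real (\<Sum>l<d. (cmod (U $$ (i, l)))\<^sup>2)"
    unfolding of_real_sum by (intro sum.cong refl complex_norm_square[symmetric])
  finally have "(\<Sum>l<d. (cmod (U $$ (i, l)))\<^sup>2) = 1" unfolding eq_commute[of 1] of_real_eq_1_iff .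
  moreover have "(cmod (U $$ (i, j)))\<^sup>2 \<le> (\<Sum>l<d. (cmod (U $$ (i, l)))\<^sup>2)"
    using ij by (intro member_le_sum) auto
  ultimately show ?thesis by (simp add: power2_le_imp_le[of _ 1])
qed

context haar_group
begin

text \<open>Young's inequality for the normalised |f|^t and the constant 1, with weights s/t and 1 -
  s/t; the constant integrates to 1 because the total mass is 1.\<close>

lemma Lp_norm_mono:
  assumes f: "f \<in> Lp_space \<mu> t" and st: "1 \<le> s" "s \<le> t"
  shows "f \<in> Lp_space \<mu> s" "Lp_norm \<mu> s f \<le> Lp_norm \<mu> t f"
proof -
  have int: "integrable \<mu> (\<lambda>x. cmod (f x) powr t)" using f by (rule Lp_space_integrable)
  have young: "cmod (f x) powr s \<le> a powr s * (s / t * (cmod (f x) powr t / a powr t) + (1 - s / t))"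
    if a: "0 < a" for a x
  proof (cases "f x = 0")
    case False
    have "cmod (f x) powr s = a powr s * ((cmod (f x) powr t / a powr t) powr (s / t) * 1 powr (1 - s / t))"
      using a st False by (simp add: powr_divide powr_powr)
    also have "\<dots> \<le> a powr s * (s / t * (cmod (f x) powr t / a powr t) + (1 - s / t) * 1)"
      using a st False by (intro mult_left_mono Youngs_inequality_0) auto
    finally show ?thesis by simp
  qed (use st in auto)
  show fs: "f \<in> Lp_space \<mu> s"
    by (rule Lp_space_dominated[OF Lp_space_measurable[OF f] _ young[of 1]]) (use int in auto)
  have "Lp_norm \<mu> s f \<le> a" if a: "0 < a" "Lp_norm \<mu> t f \<le> a" for a
  proof -
    have F: "(LINT x|\<mu>. cmod (f x) powr t) \<le> a powr t"
      using a st Lp_norm_le_iff[of t a \<mu> f] by auto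
    have "(LINT x|\<mu>. cmod (f x) powr s) \<le>
        (LINT x|\<mu>. a powr s * (s / t * (cmod (f x) powr t / a powr t) + (1 - s / t)))"
      by (intro integral_mono Lp_space_integrable[OF fs] young a) (use int in auto)
    also have "\<dots> = a powr s * (s / t * ((LINT x|\<mu>. cmod (f x) powr t) / a powr t) + (1 - s / t))"
      using int by simp
    also have "\<dots> \<le> a powr s * (s / t * 1 + (1 - s / t))"
      using F a st by (intro mult_left_mono add_right_mono) auto
    finally show ?thesis using a st by (simp add: Lp_norm_le_iff)
  qed
  then have "Lp_norm \<mu> s f \<le> Lp_norm \<mu> t f + e" if "0 < e" for e
    using that Lp_norm_nonneg[of \<mu> t f] by simp
  then show "Lp_norm \<mu> s f \<le> Lp_norm \<mu> t f" by (rule field_le_epsilon)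
qed

context
  fixes d :: nat and \<xi> :: "'g \<Rightarrow> complex mat" and i j :: nat
  assumes irr: "irreducible_unitary_rep d \<xi>" and ij: "i < d" "j < d"
begin

lemma coefficient_cts: "cts (\<lambda>x. \<xi> x $$ (i, j))"
  using irr ij by (auto simp: irreducible_unitary_rep_def intro: cts_coefficient)

lemma coefficient_le_1: "cmod (\<xi> x $$ (i, j)) \<le> 1"
  using irr ij by (auto simp: irreducible_unitary_rep_def unitary_rep_def intro: unitary_entry_le_1)

lemma coefficient_nsq: "(LINT x|\<mu>. (cmod (\<xi> x $$ (i, j)))\<^sup>2) = 1 / real d"
proof -
  have "complex_of_real (nsq (\<lambda>x. \<xi> x $$ (i, j))) = complex_of_real (1 / real d)"
    using schur_orthogonality_same[OF irr ij ij] by (simp add: ip_self)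
  then show ?thesis unfolding of_real_eq_iff nsq_def .
qed

lemma coefficient_Lp_norm:
  assumes q: "1 \<le> q"
  shows "Lp_norm \<mu> q (\<lambda>x. \<xi> x $$ (i, j)) \<le> real d powr (- (1 / max 2 q))"
proof -
  have d: "0 < d" using irr by (simp add: irreducible_unitary_rep_def)
  have large: "Lp_norm \<mu> t (\<lambda>x. \<xi> x $$ (i, j)) \<le> real d powr (- (1 / t))" if t: "2 \<le> t" for t
  proof -
    have "(LINT x|\<mu>. cmod (\<xi> x $$ (i, j)) powr t) \<le> (LINT x|\<mu>. (cmod (\<xi> x $$ (i, j)))\<^sup>2)"
    proof (rule integral_mono)
      show "integrable \<mu> (\<lambda>x. cmod (\<xi> x $$ (i, j)) powr t)"
        using t by (intro Lp_space_integrable Lp_space_cts coefficient_cts) auto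
      show "integrable \<mu> (\<lambda>x. (cmod (\<xi> x $$ (i, j)))\<^sup>2)"
        by (intro integrable_nsq coefficient_cts)
      show "cmod (\<xi> x $$ (i, j)) powr t \<le> (cmod (\<xi> x $$ (i, j)))\<^sup>2" for x
      proof (cases "\<xi> x $$ (i, j) = 0")
        case False
        then have "cmod (\<xi> x $$ (i, j)) powr t \<le> cmod (\<xi> x $$ (i, j)) powr 2"
          using t coefficient_le_1[of x] by (intro powr_mono') auto
        then show ?thesis using False by (simp add: powr_numeral)
      qed simp
    qed
    also have "\<dots> = real d powr (- 1)"
      using d by (simp add: coefficient_nsq powr_minus_divide)
    also have "\<dots> = (real d powr (- (1 / t))) powr t"
      using t by (simp add: powr_powr)
    finally show ?thesis using t by (simp add: Lp_norm_le_iff)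
  qed
  have "(\<lambda>x. \<xi> x $$ (i, j)) \<in> Lp_space \<mu> (max 2 q)" by (intro Lp_space_cts coefficient_cts) auto
  \<comment> \<open>An exponent below 2 is raised to 2, which is why the decay rate involves
    \<open>max 2 q\<close>.\<close>
  then have "Lp_norm \<mu> q (\<lambda>x. \<xi> x $$ (i, j)) \<le> Lp_norm \<mu> (max 2 q) (\<lambda>x. \<xi> x $$ (i, j))"
    by (rule Lp_norm_mono(2)) (use q in auto)
  also have "\<dots> \<le> real d powr (- (1 / max 2 q))" by (intro large) auto
  finally show ?thesis .
qed

text \<open>For p > 2 the function is first regarded as an element of L^2, which explains
  \<open>min 2 p\<close>. Hoelder's inequality then contributes the squared L^2 norm 1/d of the
  coefficient to the power 1 - 1 / \<open>min 2 p\<close>.\<close>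

lemma coefficient_functional:
  assumes p: "1 \<le> p" and f: "f \<in> Lp_space \<mu> p"
  shows "integrable \<mu> (\<lambda>x. f x * cnj (\<xi> x $$ (i, j)))"
    and "cmod (ip f (\<lambda>x. \<xi> x $$ (i, j))) \<le> real d powr (1 / min 2 p - 1) * Lp_norm \<mu> p f"
proof -
  have d: "0 < d" using irr by (simp add: irreducible_unitary_rep_def)
  have p': "1 \<le> min 2 p" "min 2 p \<le> 2" "min 2 p \<le> p" using p by auto
  have f': "f \<in> Lp_space \<mu> (min 2 p)" "Lp_norm \<mu> (min 2 p) f \<le> Lp_norm \<mu> p f"
    using Lp_norm_mono[OF f p'(1,3)] by auto
  have g: "(\<lambda>x. cnj (\<xi> x $$ (i, j))) \<in> Lp_space \<mu> 2"
    by (intro Lp_space_cts continuous_on_cnj coefficient_cts) auto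
  have g1: "cmod (cnj (\<xi> x $$ (i, j))) \<le> 1" for x using coefficient_le_1 by simp
  show "integrable \<mu> (\<lambda>x. f x * cnj (\<xi> x $$ (i, j)))"
    by (rule Holder_bounded(1)[OF f'(1) p'(1,2) g g1])
  have "cmod (ip f (\<lambda>x. \<xi> x $$ (i, j))) \<le> Lp_norm \<mu> (min 2 p) f * (1 / real d) powr (1 - 1 / min 2 p)"
    using Holder_bounded(2)[OF f'(1) p'(1,2) g g1] by (simp add: ip_def coefficient_nsq)
  also have "(1 / real d) powr (1 - 1 / min 2 p) = real d powr (1 / min 2 p - 1)"
  proof -
    have "real d powr (1 / min 2 p - 1) = real d powr (- (1 - 1 / min 2 p))" by simp
    also have "\<dots> = 1 / real d powr (1 - 1 / min 2 p)" by (rule powr_minus_divide)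
    also have "\<dots> = (1 / real d) powr (1 - 1 / min 2 p)" using d by (subst powr_divide) auto
    finally show ?thesis by simp
  qed
  also have "Lp_norm \<mu> (min 2 p) f * real d powr (1 / min 2 p - 1) \<le> Lp_norm \<mu> p f * real d powr (1 / min 2 p - 1)"
    by (intro mult_right_mono f') simp
  finally show "cmod (ip f (\<lambda>x. \<xi> x $$ (i, j))) \<le> real d powr (1 / min 2 p - 1) * Lp_norm \<mu> p f"
    by (simp add: mult.commute)
qed

lemma coefficient_functional_dual:
  assumes p: "1 \<le> p"
  shows "(\<lambda>f. c * ip f (\<lambda>x. \<xi> x $$ (i, j))) \<in> dual_space (Lp_space \<mu> p) (Lp_norm \<mu> p)"
  unfolding dual_space_def
proof (intro CollectI conjI ballI allI)
  fix f g assume f: "f \<in> Lp_space \<mu> p" and g: "g \<in> Lp_space \<mu> p"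
  show "c * ip (\<lambda>y. f y + g y) (\<lambda>x. \<xi> x $$ (i, j)) =
      c * ip f (\<lambda>x. \<xi> x $$ (i, j)) + c * ip g (\<lambda>x. \<xi> x $$ (i, j))"
    using coefficient_functional(1)[OF p f] coefficient_functional(1)[OF p g]
    by (simp add: ip_def distrib_right distrib_left)
next
  show "c * ip (\<lambda>y. a * f y) (\<lambda>x. \<xi> x $$ (i, j)) = a * (c * ip f (\<lambda>x. \<xi> x $$ (i, j)))" for a f
    by (simp add: ip_scale_left)
  show "\<exists>K. \<forall>f\<in>Lp_space \<mu> p. cmod (c * ip f (\<lambda>x. \<xi> x $$ (i, j))) \<le> K * Lp_norm \<mu> p f"
  proof (intro exI ballI)
    fix f assume f: "f \<in> Lp_space \<mu> p"
    show "cmod (c * ip f (\<lambda>x. \<xi> x $$ (i, j))) \<le> (cmod c * real d powr (1 / min 2 p - 1)) * Lp_norm \<mu> p f"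
      unfolding norm_mult mult.assoc by (intro mult_left_mono coefficient_functional(2) p f) simp
  qed
qed

end

text \<open>Since \<xi>(x) is unitary, the symbol formula can be solved for A\<xi> = \<xi> S; a
  diagonal \<open>S\<close> multiplies column \<open>j\<close> by its j-th diagonal entry.\<close>

lemma multiplier_coefficient:
  assumes irr: "irreducible_unitary_rep d \<xi>" and S: "S \<in> carrier_mat d d" "diagonal_mat S"
    and ae: "AE x in \<mu>. op_symbol A x \<xi> = S" and ij: "i < d" "j < d"
  shows "AE x in \<mu>. A (\<lambda>y. \<xi> y $$ (i, j)) x = S $$ (j, j) * \<xi> x $$ (i, j)"
  using ae
proof eventually_elim
  case (elim x)
  have r: "unitary_rep d \<xi>" using irr by (simp add: irreducible_unitary_rep_def)
  note c = unitary_rep_carrier[OF r, of x]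
  let ?M = "mat d d (\<lambda>(i, j). A (\<lambda>y. \<xi> y $$ (i, j)) x)"
  have M: "?M \<in> carrier_mat d d" by simp
  have "S = mat_adjoint (\<xi> x) * ?M" using elim by (simp add: op_symbol_def rep_dim_eq[OF irr])
  then have "\<xi> x * S = \<xi> x * (mat_adjoint (\<xi> x) * ?M)" by simp
  also have "\<dots> = (\<xi> x * mat_adjoint (\<xi> x)) * ?M"
    by (rule assoc_mult_mat[symmetric, OF c mat_adjoint_carrier[OF c] M])
  also have "\<dots> = ?M" unfolding unitary_repD(2)[OF r] by (rule left_mult_one_mat[OF M])
  finally have "A (\<lambda>y. \<xi> y $$ (i, j)) x = (\<xi> x * S) $$ (i, j)" using ij by simp
  also have "\<dots> = (\<Sum>l<d. \<xi> x $$ (i, l) * S $$ (l, j))" by (rule index_mult_mat_sum[OF c S(1) ij])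
  also have "\<dots> = (\<Sum>l<d. if l = j then \<xi> x $$ (i, j) * S $$ (j, j) else 0)"
    using S ij by (intro sum.cong) (auto simp: diagonal_mat_def)
  finally show ?case using ij by (simp add: mult.commute)
qed

end

theorem theorem3p4:
  fixes \<A> :: "'g::{topological_group_add, t2_space, second_countable_topology} chart set"
    and n :: nat
    and \<mu> :: "'g measure"
    and R :: "('g \<Rightarrow> complex mat) set"
    and A :: "('g \<Rightarrow> complex) \<Rightarrow> ('g \<Rightarrow> complex)"
    and \<sigma> :: "('g \<Rightarrow> complex mat) \<Rightarrow> complex mat"
    and p\<^sub>1 p\<^sub>2 r :: real
  assumes "lie_group n \<A>" and "compact (UNIV :: 'g set)"
    and "normalised_haar \<mu>"
    and "unitary_dual_representatives R"
    and "1 \<le> p\<^sub>1" and "1 \<le> p\<^sub>2" and "0 < r" and "r \<le> 1"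
    and "bounded_operator (Lp_space \<mu> p\<^sub>1) (Lp_norm \<mu> p\<^sub>1) (Lp_space \<mu> p\<^sub>2) (Lp_norm \<mu> p\<^sub>2) A"
    and "\<And>\<xi>. \<xi> \<in> R \<Longrightarrow> AE x in \<mu>. op_symbol A x \<xi> = \<sigma> \<xi>"
    and "\<And>\<xi>. \<xi> \<in> R \<Longrightarrow> diagonal_mat (\<sigma> \<xi>)"
    and "(\<lambda>\<xi>. real (rep_dim \<xi>) powr (1 + (1 / min 2 p\<^sub>1 - 1 / max 2 p\<^sub>2) * r)
               * schatten_norm r (\<sigma> \<xi>) powr r) summable_on R"
  shows "r_nuclear r (Lp_space \<mu> p\<^sub>1) (Lp_norm \<mu> p\<^sub>1) (Lp_space \<mu> p\<^sub>2) (Lp_norm \<mu> p\<^sub>2) A"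
proof -
  note R = assms(4) and p1 = assms(5) and p2 = assms(6) and r = assms(7,8) and A = assms(9)
  interpret haar_group \<mu> by standard (use assms in auto)
  have irr: "irreducible_unitary_rep (rep_dim \<xi>) \<xi>" if "\<xi> \<in> R" for \<xi>
    using R that by (auto simp: unitary_dual_representatives_def)
  have dpos: "0 < rep_dim \<xi>" if "\<xi> \<in> R" for \<xi>
    using irr[OF that] by (simp add: irreducible_unitary_rep_def)
  \<comment> \<open>The dimensions of \<sigma> are read off from the symbol at a single point where
    the two agree; such a point exists because the measure is not zero.\<close>
  have c\<sigma>: "\<sigma> \<xi> \<in> carrier_mat (rep_dim \<xi>) (rep_dim \<xi>)" if "\<xi> \<in> R" for \<xi>
  proof -
    have "\<exists>x. op_symbol A x \<xi> = \<sigma> \<xi>"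
    proof (rule ccontr)
      assume "\<nexists>x. op_symbol A x \<xi> = \<sigma> \<xi>"
      then have "AE x in \<mu>. False" using assms(10)[OF that] by simp
      then show False
        using emeasure_open_pos[of UNIV] AE_iff_measurable[of UNIV \<mu> "\<lambda>x. False"]
        by (simp add: sets_haar)
    qed
    then obtain x where x: "\<sigma> \<xi> = op_symbol A x \<xi>" by metis
    have "\<xi> x \<in> carrier_mat (rep_dim \<xi>) (rep_dim \<xi>)"
      using irr[OF that] unitary_rep_carrier by (auto simp: irreducible_unitary_rep_def)
    then show ?thesis unfolding x op_symbol_def by auto
  qed
  define \<delta> where "\<delta> = 1 / min 2 p\<^sub>1 - 1 / max 2 p\<^sub>2"
  define J where "J = (SIGMA \<xi>:R. {..<rep_dim \<xi>} \<times> {..<rep_dim \<xi>})"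
  \<comment> \<open>\<open>b\<close> collects the factors of one rank-one term: d |\<sigma>_jj| from
    the Fourier expansion, d to the power 1 / \<open>min 2 p\<^sub>1\<close> - 1 from the
    functional, and d to the power - 1 / \<open>max 2 p\<^sub>2\<close> from the coefficient. It
    does not involve \<open>i\<close>, whose d values produce the summand 1 in the exponent of the
    hypothesis.\<close>
  define b where "b = (\<lambda>(\<xi>, i :: nat, j). real (rep_dim \<xi>) powr \<delta> * cmod (\<sigma> \<xi> $$ (j, j)))"
  have "(\<lambda>z. b z powr r) summable_on J"
    unfolding J_def
  proof (rule summable_on_SigmaI[OF _ assms(12)])
    fix \<xi> assume \<xi>: "\<xi> \<in> R"
    let ?d = "rep_dim \<xi>"
    have "(\<Sum>z\<in>{..<?d} \<times> {..<?d}. b (\<xi>, z) powr r) =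
        (\<Sum>i<?d. \<Sum>j<?d. real ?d powr (\<delta> * r) * cmod (\<sigma> \<xi> $$ (j, j)) powr r)"
      unfolding sum.cartesian_product
      by (intro sum.cong) (auto simp: b_def powr_mult powr_powr)
    also have "\<dots> = real ?d * real ?d powr (\<delta> * r) * schatten_norm r (\<sigma> \<xi>) powr r"
      by (simp add: schatten_norm_diagonal[OF c\<sigma>[OF \<xi>] assms(11)[OF \<xi>] r(1)] sum_distrib_left mult.assoc)
    also have "real ?d * real ?d powr (\<delta> * r) = real ?d powr (1 + \<delta> * r)"
      using dpos[OF \<xi>] by (simp add: powr_add)
    finally show "((\<lambda>z. b (\<xi>, z) powr r) has_sum
        real ?d powr (1 + (1 / min 2 p\<^sub>1 - 1 / max 2 p\<^sub>2) * r) * schatten_norm r (\<sigma> \<xi>) powr r)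
        ({..<?d} \<times> {..<?d})"
      unfolding \<delta>_def by (intro has_sum_finiteI) auto
  qed simp
  \<comment> \<open>Discarding the zero terms leaves the support of a summable real family, which is
    countable and can be numbered even though nothing is said about the size of
    \<open>R\<close>.\<close>
  define I where "I = {z \<in> J. b z powr r \<noteq> 0}"
  have sumI: "(\<lambda>z. b z powr r) summable_on I"
    by (rule summable_on_subset[OF \<open>_ summable_on J\<close>]) (auto simp: I_def)
  have cI: "countable I"
    unfolding I_def by (rule summable_countable_real[OF \<open>_ summable_on J\<close>])
  let ?code = "to_nat_on I" and ?dec = "from_nat_into I"
  define \<phi>' where "\<phi>' = (\<lambda>(\<xi>, i, j) f. of_nat (rep_dim \<xi>) * \<sigma> \<xi> $$ (j, j) * ip f (\<lambda>x. \<xi> x $$ (i, j)))"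
  define C' where "C' = (\<lambda>(\<xi>, i :: nat, j). real (rep_dim \<xi>) powr (1 / min 2 p\<^sub>1) * cmod (\<sigma> \<xi> $$ (j, j)))"
  define y' :: "('g \<Rightarrow> complex mat) \<times> nat \<times> nat \<Rightarrow> 'g \<Rightarrow> complex"
    where "y' = (\<lambda>(\<xi>, i, j) x. \<xi> x $$ (i, j))"
  \<comment> \<open>\<open>I\<close> may be finite, so a natural number that is not a code receives
    a zero term.\<close>
  define \<phi> where "\<phi> n = (if n \<in> ?code ` I then \<phi>' (?dec n) else (\<lambda>f. 0))" for n
  define C where "C n = (if n \<in> ?code ` I then C' (?dec n) else 0)" for n
  define y where "y n = (if n \<in> ?code ` I then y' (?dec n) else (\<lambda>x. 0))" for n
  have memJ: "\<xi> \<in> R" "i < rep_dim \<xi>" "j < rep_dim \<xi>" if "(\<xi>, i, j) \<in> I" for \<xi> i j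
    using that by (auto simp: I_def J_def)
  have \<phi>'_dual: "\<phi>' z \<in> dual_space (Lp_space \<mu> p\<^sub>1) (Lp_norm \<mu> p\<^sub>1)" if "z \<in> I" for z
  proof -
    obtain \<xi> i j where z: "z = (\<xi>, i, j)" by (cases z)
    note m = memJ[OF that[unfolded z]]
    show ?thesis
      unfolding z \<phi>'_def split_conv by (rule coefficient_functional_dual[OF irr[OF m(1)] m(2,3) p1])
  qed
  have \<phi>'_bound: "cmod (\<phi>' z f) \<le> C' z * Lp_norm \<mu> p\<^sub>1 f" if "z \<in> I" "f \<in> Lp_space \<mu> p\<^sub>1" for z f
  proof -
    obtain \<xi> i j where z: "z = (\<xi>, i, j)" by (cases z)
    note m = memJ[OF that(1)[unfolded z]]
    let ?d = "real (rep_dim \<xi>)"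
    have "cmod (\<phi>' z f) = ?d * cmod (\<sigma> \<xi> $$ (j, j)) * cmod (ip f (\<lambda>x. \<xi> x $$ (i, j)))"
      by (simp add: z \<phi>'_def norm_mult)
    also have "\<dots> \<le> ?d * cmod (\<sigma> \<xi> $$ (j, j)) * (?d powr (1 / min 2 p\<^sub>1 - 1) * Lp_norm \<mu> p\<^sub>1 f)"
      by (intro mult_left_mono coefficient_functional(2)[OF irr[OF m(1)] m(2,3) p1 that(2)]) auto
    also have "\<dots> = (?d powr 1 * ?d powr (1 / min 2 p\<^sub>1 - 1)) * cmod (\<sigma> \<xi> $$ (j, j)) * Lp_norm \<mu> p\<^sub>1 f"
      using dpos[OF m(1)] by simp
    also have "?d powr 1 * ?d powr (1 / min 2 p\<^sub>1 - 1) = ?d powr (1 / min 2 p\<^sub>1)"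
      by (simp only: powr_add[symmetric]) simp
    finally show ?thesis by (simp add: z C'_def)
  qed
  have y'_in: "y' z \<in> Lp_space \<mu> p\<^sub>2" if "z \<in> I" for z
  proof -
    obtain \<xi> i j where z: "z = (\<xi>, i, j)" by (cases z)
    note m = memJ[OF that[unfolded z]]
    show ?thesis
      unfolding z y'_def split_conv
      by (rule Lp_space_cts[OF coefficient_cts[OF irr[OF m(1)] m(2,3)]]) (use p2 in simp)
  qed
  have Cy: "C' z * Lp_norm \<mu> p\<^sub>2 (y' z) \<le> b z" if "z \<in> I" for z
  proof -
    obtain \<xi> i j where z: "z = (\<xi>, i, j)" by (cases z)
    note m = memJ[OF that[unfolded z]]
    let ?d = "real (rep_dim \<xi>)"
    have "C' z * Lp_norm \<mu> p\<^sub>2 (y' z) \<le> C' z * ?d powr (- (1 / max 2 p\<^sub>2))"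
      using coefficient_Lp_norm[OF irr[OF m(1)] m(2,3) p2]
      by (intro mult_left_mono) (auto simp: z y'_def C'_def)
    also have "\<dots> = (?d powr (1 / min 2 p\<^sub>1) * ?d powr (- (1 / max 2 p\<^sub>2))) * cmod (\<sigma> \<xi> $$ (j, j))"
      by (simp add: z C'_def)
    also have "\<dots> = b z" by (simp add: powr_add[symmetric] z b_def \<delta>_def)
    finally show ?thesis .
  qed
  interpret nuclear_expansion \<mu> \<mu> p\<^sub>1 p\<^sub>2 r A \<phi> y C
  proof
    have dec: "?dec n \<in> I" if "n \<in> ?code ` I" for n using that cI by auto
    show "\<phi> n \<in> dual_space (Lp_space \<mu> p\<^sub>1) (Lp_norm \<mu> p\<^sub>1)" for n
    proof (cases "n \<in> ?code ` I")
      case False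
      then show ?thesis by (auto simp: \<phi>_def dual_space_def intro!: exI[of _ 0])
    qed (simp add: \<phi>_def \<phi>'_dual dec)
    show "y n \<in> Lp_space \<mu> p\<^sub>2" for n by (simp add: y_def Lp_space_zero y'_in dec)
    show "cmod (\<phi> n f) \<le> C n * Lp_norm \<mu> p\<^sub>1 f" if "f \<in> Lp_space \<mu> p\<^sub>1" for n f
      by (simp add: \<phi>_def C_def \<phi>'_bound dec that)
    have C'0: "0 \<le> C' z" for z by (cases z) (simp add: C'_def)
    show C0: "0 \<le> C n" for n by (simp add: C_def C'0)
    \<comment> \<open>The unordered sum over \<open>I\<close> is carried to the codes and extended
      by zero to an ordinary series over the natural numbers.\<close>
    have "(\<lambda>n. b (?dec n) powr r) summable_on (?code ` I)"
      using sumI inj_on_to_nat_on[OF cI]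
      by (subst summable_on_reindex) (auto simp: o_def cI cong: summable_on_cong)
    then have "(\<lambda>n. if n \<in> ?code ` I then b (?dec n) powr r else 0) summable_on UNIV"
      by (subst (asm) summable_on_cong_neutral[where T = UNIV]) auto
    then have "summable (\<lambda>n. if n \<in> ?code ` I then b (?dec n) powr r else 0)"
      by (subst (asm) summable_on_UNIV_nonneg_real_iff) auto
    then show "summable (\<lambda>n. (C n * Lp_norm \<mu> p\<^sub>2 (y n)) powr r)"
    proof (rule summable_comparison_test'[where N = 0])
      fix n :: nat
      show "norm ((C n * Lp_norm \<mu> p\<^sub>2 (y n)) powr r) \<le>
          (if n \<in> ?code ` I then b (?dec n) powr r else 0)"
      proof (cases "n \<in> ?code ` I")
        case True
        have "(C' (?dec n) * Lp_norm \<mu> p\<^sub>2 (y' (?dec n))) powr r \<le> b (?dec n) powr r"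
          using r by (intro powr_mono2 Cy dec True mult_nonneg_nonneg C'0 Lp_norm_nonneg) simp
        then show ?thesis using True by (simp add: C_def y_def)
      qed (simp add: C_def)
    qed
  qed (use p1 p2 r A in auto)
  have coefficient: "expands (\<lambda>x. \<xi> x $$ (i, j))" if \<xi>: "\<xi> \<in> R" and ij: "i < rep_dim \<xi>" "j < rep_dim \<xi>" for \<xi> i j
  proof -
    let ?f = "\<lambda>x. \<xi> x $$ (i, j)" and ?z = "(\<xi>, i, j)"
    have \<phi>'_other: "\<phi>' z ?f = 0" if "z \<in> I" "z \<noteq> ?z" for z
    proof -
      obtain \<eta> k l where z: "z = (\<eta>, k, l)" by (cases z)
      note m = memJ[OF that(1)[unfolded z]]
      have "ip ?f (\<lambda>x. \<eta> x $$ (k, l)) = 0"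
      proof (cases "\<xi> = \<eta>")
        case True
        then show ?thesis
          using schur_orthogonality_same[OF irr[OF \<xi>] ij, of k l] m that(2) by (auto simp: z)
      qed (use schur_orthogonality_distinct[OF R \<xi> m(1) _ ij m(2,3)] in simp)
      then show ?thesis by (simp add: z \<phi>'_def)
    qed
    \<comment> \<open>The factor d of the expansion cancels the 1/d of Schur orthogonality.\<close>
    have \<phi>'_self: "\<phi>' ?z ?f = \<sigma> \<xi> $$ (j, j)"
      using schur_orthogonality_same[OF irr[OF \<xi>] ij ij] dpos[OF \<xi>] by (simp add: \<phi>'_def)
    have Af: "AE x in \<mu>. A ?f x = \<sigma> \<xi> $$ (j, j) * ?f x"
      by (rule multiplier_coefficient[OF irr[OF \<xi>] c\<sigma>[OF \<xi>] assms(11)[OF \<xi>] assms(10)[OF \<xi>] ij])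
    have fL: "?f \<in> Lp_space \<mu> p\<^sub>1"
      using p1 by (intro Lp_space_cts coefficient_cts[OF irr[OF \<xi>] ij]) auto
    \<comment> \<open>By orthogonality only the term with index \<open>?z\<close> survives, so the
      partial sums are constant once its code has been passed. If \<open>?z\<close> is not in
      \<open>I\<close>, then \<sigma>_jj = 0 and both sides vanish, whatever the value of
      \<open>?code ?z\<close>.\<close>
    have S: "partial_sum k ?f x = \<sigma> \<xi> $$ (j, j) * ?f x" if k: "?code ?z < k" for k x
    proof (cases "?z \<in> I")
      case True
      have "\<phi> n ?f * y n x = (if n = ?code ?z then \<sigma> \<xi> $$ (j, j) * ?f x else 0)" for n
      proof (cases "n \<in> ?code ` I")
        case in_code: True
        then obtain z where z: "z \<in> I" "n = ?code z" by blast
        then have "?dec n = z" using cI by simp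
        moreover have "n = ?code ?z \<longleftrightarrow> z = ?z" using z True cI by simp
        ultimately show ?thesis
          using in_code \<phi>'_self \<phi>'_other[OF z(1)] by (auto simp: \<phi>_def y_def y'_def)
      next
        case False
        then have "n \<noteq> ?code ?z" using True by auto
        then show ?thesis using False by (simp add: \<phi>_def)
      qed
      then show ?thesis using k by (simp add: partial_sum_def)
    next
      case False
      have "\<sigma> \<xi> $$ (j, j) = 0"
      proof (rule ccontr)
        assume "\<sigma> \<xi> $$ (j, j) \<noteq> 0"
        then have "b ?z powr r \<noteq> 0" using dpos[OF \<xi>] by (simp add: b_def)
        then show False using False \<xi> ij by (simp add: I_def J_def)
      qed
      moreover have "\<phi> n ?f = 0" for n
      proof (cases "n \<in> ?code ` I")
        case True
        then have "?dec n \<in> I" using cI by auto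
        then show ?thesis using True False \<phi>'_other by (cases "?dec n = ?z") (simp_all add: \<phi>_def)
      qed (simp add: \<phi>_def)
      ultimately show ?thesis by (simp add: partial_sum_def)
    qed
    have "Lp_norm \<mu> p\<^sub>2 (\<lambda>x. A ?f x - partial_sum k ?f x) = 0" if "?code ?z < k" for k
    proof -
      have "AE x in \<mu>. A ?f x - partial_sum k ?f x = 0"
        using Af by eventually_elim (simp add: S[OF that])
      from Lp_norm_cong_AE[OF this Lp_space_measurable[OF error_in[OF fL]]]
      show ?thesis by (simp add: Lp_norm_zero)
    qed
    then have "\<forall>\<^sub>F k in sequentially. Lp_norm \<mu> p\<^sub>2 (\<lambda>x. A ?f x - partial_sum k ?f x) = 0"
      by (intro eventually_mono[OF eventually_gt_at_top[of "?code ?z"]]) simp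
    then show ?thesis unfolding expands_def by (rule tendsto_eventually)
  qed
  have span_in: "h \<in> Lp_space \<mu> p\<^sub>1" if "h \<in> coeff_span R" for h
    using p1 by (intro Lp_space_cts coeff_span_cts[OF R that]) auto
  have "expands h" if "h \<in> coeff_span R" for h
    using that
    by induction (auto intro: coefficient expands_zero expands_add expands_scale span_in)
  then have "expands f" if "f \<in> Lp_space \<mu> p\<^sub>1" for f
    using expands_of_dense[of "coeff_span R"] coeff_span_Lp_dense[OF R p1] span_in that
    by blast
  then show ?thesis by (rule r_nuclear_of_expands)
qed

end
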